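(* Let $(\Sigma_1,g_1)$ and $(\Sigma_2,g_2)$ be connected, complete, oriented Riemannian 2-manifolds and $\epsilon\in\{1,-1\}$. Let $\Phi=(\phi,\psi)$ be a projected rank one Hamiltonian $G^{\epsilon}$-minimal immersion in $(\Sigma_1\times\Sigma_2,G^{\epsilon})$ such that $\kappa(g_1)\leq -2k_{\phi}^2$ and $\kappa(g_2)\leq -2k_{\psi}^2$ along the curves $\phi$ and $\psi$ respectively. Then $\Phi$ is a local minimizer of the volume in its Hamiltonian isotopy class.
   Context: For $k=1,2$, $j_k$ is the rotation by $+\pi/2$ in $T\Sigma_k$ and $\omega_k(\cdot,\cdot)=g_k(j_k\cdot,\cdot)$. Let $\pi_i:\Sigma_1\times\Sigma_2\to\Sigma_i$ be the projections. Define $G^{\epsilon}=\pi_1^{*}g_1+\epsilon\,\pi_2^{*}g_2$, $\Omega^{\epsilon}=\pi_1^{*}\omega_1+\epsilon\,\pi_2^{*}\omega_2$, $J=j_1\oplus j_2$; $\kappa(g_k)$ is the Gauss curvature of $g_k$. An immersion $\Phi:S\to\Sigma_1\times\Sigma_2$ of a surface is Lagrangian if $\Phi^{*}\Omega^{\epsilon}=0$. Write $\Phi=(\phi,\psi)$ with $\phi=\pi_1\circ\Phi$, $\psi=\pi_2\circ\Phi$. $\Phi$ is of projected rank one if at every $p\in S$ the derivative of $\phi$ or that of $\psi$ has rank one. A projected rank one Lagrangian immersion is locally of the form $(s,t)\mapsto(\phi(s),\psi(t))$ with $\phi,\psi$ regular curves in $\Sigma_1,\Sigma_2$, which may be parametrised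 by arclength; $k_\phi,k_\psi$ are their curvatures: $D^1_{\phi'}\phi'=k_\phi j_1\phi'$, $D^2_{\psi'}\psi'=k_\psi j_2\psi'$, with $D^i$ the Levi-Civita connection of $g_i$. A compactly supported Hamiltonian variation of a Lagrangian immersion $\Phi$ is a smooth family $\Phi_\tau$ of Lagrangian immersions with $\Phi_0=\Phi$, constant in $\tau$ outside a compact set, such that for each $\tau$ the 1-form $\Omega^{\epsilon}(\partial_\tau\Phi_\tau,d\Phi_\tau\cdot)$ is the differential of a compactly supported function on $S$; its initial velocity is, up to tangential terms, $X=J\nabla u$ with $u\in C_c^{\infty}(S)$, $\nabla$ being the gradient of the induced metric. $\Phi$ is Hamiltonian $G^{\epsilon}$-minimal if it is Lagrangian and critical for the volume under all such variations. For such $\Phi$ the second variation of the volume in the direction $X=J\nabla u$ is $$\delta^2V(S)(X)=\int_S\Big((\Delta u)^2-\mathrm{Ric}^{\epsilon}(\nabla u,\nabla u)-2G^{\epsilon}(h(\nabla u,\nabla u),2\vec H)+G^{\epsilon}(2\vec H,J\nabla u)^2\Big)dV,$$ where $h$ is the second fundamental form, $2\vec H$ its trace, $\mathrm{Ric}^{\epsilon}$ the Ricci tensor of $G^{\epsilon}$, and $\Delta,\nabla,dV$ are those of the induced metric. "Local minimizer of the volume in its Hamiltonian isotopy class" is understood in the second-variation sense: $\delta^2V(S)(J\nabla u)\ge 0$ for every $u\in C_c^{\infty}(S)$. *)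

theory Defs
  imports "HOL-Analysis.Analysis"
begin

section \<open>Smooth functions\<close>

text \<open>Both predicates are meant for open sets \<open>U\<close> in finite-dimensional spaces, where continuity
  of all directional derivatives is the usual \<open>C\<^sup>k\<close> condition.\<close>

primrec Ck_on :: "nat \<Rightarrow> 'a::real_normed_vector set \<Rightarrow> ('a \<Rightarrow> 'b::real_normed_vector) \<Rightarrow> bool" where
  "Ck_on 0 U f \<longleftrightarrow> continuous_on U f"
| "Ck_on (Suc k) U f \<longleftrightarrow>
     (\<forall>x\<in>U. f differentiable (at x)) \<and> (\<forall>v. Ck_on k U (\<lambda>x. frechet_derivative f (at x) v))"

definition smooth_on :: "'a::real_normed_vector set \<Rightarrow> ('a \<Rightarrow> 'b::real_normed_vector) \<Rightarrow> bool" where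
  "smooth_on U f \<longleftrightarrow> (\<forall>k. Ck_on k U f)"

section \<open>Charts, atlases and smooth maps\<close>

text \<open>A chart is a pair of its domain and its coordinate map; the values of the coordinate map
  outside the domain are irrelevant.\<close>

type_synonym ('a, 'n) chart = "'a set \<times> ('a \<Rightarrow> real ^ 'n)"

abbreviation cdom :: "('a, 'n::finite) chart \<Rightarrow> 'a set" where
  "cdom c \<equiv> fst c"

abbreviation coord :: "('a, 'n::finite) chart \<Rightarrow> 'a \<Rightarrow> real ^ 'n" where
  "coord c \<equiv> snd c"

definition cimg :: "('a, 'n::finite) chart \<Rightarrow> (real ^ 'n) set" where
  "cimg c = coord c ` cdom c"

definition cinv :: "('a, 'n::finite) chart \<Rightarrow> real ^ 'n \<Rightarrow> 'a" where
  "cinv c = inv_into (cdom c) (coord c)"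

definition is_chart :: "('a::topological_space, 'n::finite) chart \<Rightarrow> bool" where
  "is_chart c \<longleftrightarrow>
     open (cdom c) \<and> open (cimg c) \<and> homeomorphism (cdom c) (cimg c) (coord c) (cinv c)"

definition transition :: "('a, 'n::finite) chart \<Rightarrow> ('a, 'n) chart \<Rightarrow> real ^ 'n \<Rightarrow> real ^ 'n" where
  "transition c c' = coord c' \<circ> cinv c"

definition overlap :: "('a, 'n::finite) chart \<Rightarrow> ('a, 'n) chart \<Rightarrow> (real ^ 'n) set" where
  "overlap c c' = coord c ` (cdom c \<inter> cdom c')"

definition smooth_atlas :: "('a::topological_space, 'n::finite) chart set \<Rightarrow> bool" where
  "smooth_atlas A \<longleftrightarrow>
     (\<forall>c\<in>A. is_chart c) \<and> (\<Union>c\<in>A. cdom c) = UNIV \<and>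
     (\<forall>c\<in>A. \<forall>c'\<in>A. smooth_on (overlap c c') (transition c c'))"

definition oriented_atlas :: "('a, 'n::finite) chart set \<Rightarrow> bool" where
  "oriented_atlas A \<longleftrightarrow>
     (\<forall>c\<in>A. \<forall>c'\<in>A. \<forall>x\<in>overlap c c'.
        det (matrix (frechet_derivative (transition c c') (at x))) > 0)"

text \<open>Membership in the maximal atlas generated by \<open>A\<close>.\<close>

definition compatible_chart :: "('a::topological_space, 'n::finite) chart set \<Rightarrow> ('a, 'n) chart \<Rightarrow> bool"
  where
  "compatible_chart A c \<longleftrightarrow>
     is_chart c \<and>
     (\<forall>c'\<in>A. smooth_on (overlap c c') (transition c c') \<and> smooth_on (overlap c' c) (transition c' c))"

text \<open>Tensorial quantities at a point are evaluated in an arbitrary chart around that point.\<close>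

definition chart_at :: "('a, 'n::finite) chart set \<Rightarrow> 'a \<Rightarrow> ('a, 'n) chart" where
  "chart_at A p = (SOME c. c \<in> A \<and> p \<in> cdom c)"

definition rep :: "('a, 'm::finite) chart \<Rightarrow> ('b, 'n::finite) chart \<Rightarrow> ('a \<Rightarrow> 'b) \<Rightarrow> real ^ 'm \<Rightarrow> real ^ 'n"
  where
  "rep c d f = coord d \<circ> f \<circ> cinv c"

definition smooth_map ::
  "('a::topological_space, 'm::finite) chart set \<Rightarrow> ('b::topological_space, 'n::finite) chart set \<Rightarrow>
   ('a \<Rightarrow> 'b) \<Rightarrow> bool" where
  "smooth_map A B f \<longleftrightarrow>
     continuous_on UNIV f \<and>
     (\<forall>c\<in>A. \<forall>d\<in>B. smooth_on (coord c ` (cdom c \<inter> f -` cdom d)) (rep c d f))"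

definition smooth_fun :: "('a, 'n::finite) chart set \<Rightarrow> ('a \<Rightarrow> real) \<Rightarrow> bool" where
  "smooth_fun A u \<longleftrightarrow> (\<forall>c\<in>A. smooth_on (cimg c) (u \<circ> cinv c))"

definition compactly_supported :: "('a::topological_space \<Rightarrow> real) \<Rightarrow> bool" where
  "compactly_supported u \<longleftrightarrow> compact (closure {p. u p \<noteq> 0})"

definition rank_at ::
  "('a, 'm::finite) chart set \<Rightarrow> ('b, 'n::finite) chart set \<Rightarrow> ('a \<Rightarrow> 'b) \<Rightarrow> 'a \<Rightarrow> nat" where
  "rank_at A B f p =
     (let c = chart_at A p; d = chart_at B (f p)
      in rank (matrix (frechet_derivative (rep c d f) (at (coord c p)))))"

section \<open>Pseudo-Riemannian geometry in coordinates\<close>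

text \<open>Here \<open>g\<close> is the matrix function of a metric tensor on an open set of coordinate space.\<close>

definition mform :: "real ^ 'n ^ 'n \<Rightarrow> real ^ 'n \<Rightarrow> real ^ 'n \<Rightarrow> real" where
  "mform M v w = v \<bullet> (M *v w)"

definition partial :: "'n::finite \<Rightarrow> (real ^ 'n \<Rightarrow> 'b::real_normed_vector) \<Rightarrow> real ^ 'n \<Rightarrow> 'b" where
  "partial i f x = frechet_derivative f (at x) (axis i 1)"

definition christoffel ::
  "(real ^ 'n \<Rightarrow> real ^ 'n ^ 'n) \<Rightarrow> 'n::finite \<Rightarrow> 'n \<Rightarrow> 'n \<Rightarrow> real ^ 'n \<Rightarrow> real" where
  "christoffel g k i j x =
     (\<Sum>l\<in>UNIV. matrix_inv (g x) $ k $ l *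
        (partial i (\<lambda>y. g y $ j $ l) x + partial j (\<lambda>y. g y $ i $ l) x
         - partial l (\<lambda>y. g y $ i $ j) x)) / 2"

text \<open>\<open>riemann g l k i j\<close> is the \<open>l\<close>-th component of \<open>R(\<partial>\<^sub>i,\<partial>\<^sub>j)\<partial>\<^sub>k\<close>, where
  \<open>R(X,Y) = [D\<^sub>X,D\<^sub>Y] - D\<^bsub>[X,Y]\<^esub>\<close>.\<close>

definition riemann ::
  "(real ^ 'n \<Rightarrow> real ^ 'n ^ 'n) \<Rightarrow> 'n::finite \<Rightarrow> 'n \<Rightarrow> 'n \<Rightarrow> 'n \<Rightarrow> real ^ 'n \<Rightarrow> real" where
  "riemann g l k i j x =
     partial i (christoffel g l j k) x - partial j (christoffel g l i k) x
     + (\<Sum>m\<in>UNIV. christoffel g l i m x * christoffel g m j k x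
                  - christoffel g l j m x * christoffel g m i k x)"

definition ricci :: "(real ^ 'n \<Rightarrow> real ^ 'n ^ 'n) \<Rightarrow> real ^ 'n::finite \<Rightarrow> real ^ 'n \<Rightarrow> real ^ 'n \<Rightarrow> real"
  where
  "ricci g x v w = (\<Sum>j\<in>UNIV. \<Sum>k\<in>UNIV. (\<Sum>i\<in>UNIV. riemann g i k i j x) * v $ j * w $ k)"

definition gauss_curvature_local :: "(real ^ 2 \<Rightarrow> real ^ 2 ^ 2) \<Rightarrow> real ^ 2 \<Rightarrow> real" where
  "gauss_curvature_local g x = (\<Sum>l\<in>UNIV. g x $ 1 $ l * riemann g l 2 1 2 x) / det (g x)"

definition gradient :: "(real ^ 'n \<Rightarrow> real ^ 'n ^ 'n) \<Rightarrow> (real ^ 'n \<Rightarrow> real) \<Rightarrow> real ^ 'n::finite \<Rightarrow> real ^ 'n"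
  where
  "gradient g u x = matrix_inv (g x) *v (\<chi> i. partial i u x)"

definition laplacian :: "(real ^ 'n \<Rightarrow> real ^ 'n ^ 'n) \<Rightarrow> (real ^ 'n \<Rightarrow> real) \<Rightarrow> real ^ 'n::finite \<Rightarrow> real"
  where
  "laplacian g u x =
     (\<Sum>i\<in>UNIV. \<Sum>j\<in>UNIV. matrix_inv (g x) $ i $ j *
        (partial i (partial j u) x - (\<Sum>k\<in>UNIV. christoffel g k i j x * partial k u x)))"

definition pullback_metric ::
  "(real ^ 'n \<Rightarrow> real ^ 'n ^ 'n) \<Rightarrow> (real ^ 'm \<Rightarrow> real ^ 'n::finite) \<Rightarrow> real ^ 'm::finite \<Rightarrow> real ^ 'm ^ 'm"
  where
  "pullback_metric G F x = (\<chi> i j. mform (G (F x)) (partial i F x) (partial j F x))"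

text \<open>\<open>D\<^bsub>\<partial>i\<^esub> (dF \<partial>\<^sub>j)\<close>, the Levi-Civita derivative along \<open>F\<close> in the ambient space.\<close>

definition ambient_derivative ::
  "(real ^ 'n \<Rightarrow> real ^ 'n ^ 'n) \<Rightarrow> (real ^ 'm \<Rightarrow> real ^ 'n::finite) \<Rightarrow> 'm::finite \<Rightarrow> 'm \<Rightarrow>
   real ^ 'm \<Rightarrow> real ^ 'n" where
  "ambient_derivative G F i j x =
     (\<chi> a. partial i (partial j F) x $ a +
        (\<Sum>b\<in>UNIV. \<Sum>d\<in>UNIV.
           christoffel G a b d (F x) * partial i F x $ b * partial j F x $ d))"

definition normal_part ::
  "(real ^ 'n \<Rightarrow> real ^ 'n ^ 'n) \<Rightarrow> (real ^ 'm \<Rightarrow> real ^ 'n::finite) \<Rightarrow> real ^ 'm::finite \<Rightarrow>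
   real ^ 'n \<Rightarrow> real ^ 'n" where
  "normal_part G F x \<xi> =
     \<xi> - (\<Sum>i\<in>UNIV. \<Sum>j\<in>UNIV.
            (matrix_inv (pullback_metric G F x) $ i $ j * mform (G (F x)) \<xi> (partial j F x))
              *\<^sub>R partial i F x)"

definition second_fundamental_form ::
  "(real ^ 'n \<Rightarrow> real ^ 'n ^ 'n) \<Rightarrow> (real ^ 'm \<Rightarrow> real ^ 'n::finite) \<Rightarrow> real ^ 'm::finite \<Rightarrow>
   real ^ 'm \<Rightarrow> real ^ 'm \<Rightarrow> real ^ 'n" where
  "second_fundamental_form G F x v w =
     normal_part G F x
       (\<Sum>i\<in>UNIV. \<Sum>j\<in>UNIV. (v $ i * w $ j) *\<^sub>R ambient_derivative G F i j x)"

text \<open>The trace of the second fundamental form (twice the mean curvature vector of a surface).\<close>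

definition trace_sff ::
  "(real ^ 'n \<Rightarrow> real ^ 'n ^ 'n) \<Rightarrow> (real ^ 'm \<Rightarrow> real ^ 'n::finite) \<Rightarrow> real ^ 'm::finite \<Rightarrow> real ^ 'n"
  where
  "trace_sff G F x =
     (\<Sum>i\<in>UNIV. \<Sum>j\<in>UNIV. matrix_inv (pullback_metric G F x) $ i $ j *\<^sub>R
        second_fundamental_form G F x (axis i 1) (axis j 1))"

section \<open>Riemannian manifolds\<close>

text \<open>The metric is stored as its coordinate matrix in each chart of the atlas, as a function on the
  image of that chart.\<close>

record ('a, 'n) manifold =
  charts :: "('a, 'n::finite) chart set"
  metric :: "('a, 'n) chart \<Rightarrow> real ^ 'n \<Rightarrow> real ^ 'n ^ 'n"

definition riemannian_manifold :: "('a::topological_space, 'n::finite) manifold \<Rightarrow> bool" where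
  "riemannian_manifold M \<longleftrightarrow>
     smooth_atlas (charts M) \<and>
     (\<forall>c\<in>charts M. smooth_on (cimg c) (metric M c) \<and>
        (\<forall>x\<in>cimg c. transpose (metric M c x) = metric M c x \<and>
                     (\<forall>v. v \<noteq> 0 \<longrightarrow> mform (metric M c x) v v > 0))) \<and>
     (\<forall>c\<in>charts M. \<forall>c'\<in>charts M. \<forall>x\<in>overlap c c'.
        metric M c x =
          (let D = matrix (frechet_derivative (transition c c') (at x))
           in transpose D ** metric M c' (transition c c' x) ** D))"

definition gauss_curvature :: "('a, 2) manifold \<Rightarrow> 'a \<Rightarrow> real" where
  "gauss_curvature M p =
     (let c = chart_at (charts M) p in gauss_curvature_local (metric M c) (coord c p))"

text \<open>The measure given by \<open>sqrt \<bar>det g\<bar> dx\<close> in every chart; as there are countably many charts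
  covering the (second countable) manifold, it is determined by its values on Borel sets inside
  chart domains.\<close>

definition volume_measure ::
  "('a::topological_space, 'n::finite) chart set \<Rightarrow> (('a, 'n) chart \<Rightarrow> real ^ 'n \<Rightarrow> real ^ 'n ^ 'n) \<Rightarrow>
   'a measure" where
  "volume_measure A g =
     (THE \<mu>. sets \<mu> = sets borel \<and>
        (\<forall>c\<in>A. \<forall>B\<in>sets borel. B \<subseteq> cdom c \<longrightarrow>
           emeasure \<mu> B = (\<integral>\<^sup>+x\<in>coord c ` B. ennreal (sqrt \<bar>det (g c x)\<bar>) \<partial>lborel)))"

section \<open>Curves\<close>

definition smooth_curve ::
  "('a::topological_space, 'n::finite) manifold \<Rightarrow> real set \<Rightarrow> (real \<Rightarrow> 'a) \<Rightarrow> bool" where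
  "smooth_curve M I \<gamma> \<longleftrightarrow>
     continuous_on I \<gamma> \<and> (\<forall>c\<in>charts M. smooth_on {t\<in>I. \<gamma> t \<in> cdom c} (coord c \<circ> \<gamma>))"

definition velocity :: "('a, 'n::finite) chart \<Rightarrow> (real \<Rightarrow> 'a) \<Rightarrow> real \<Rightarrow> real ^ 'n" where
  "velocity c \<gamma> t = vector_derivative (coord c \<circ> \<gamma>) (at t)"

text \<open>The covariant derivative of \<open>\<gamma>'\<close> along \<open>\<gamma>\<close>.\<close>

definition acceleration ::
  "('a, 'n::finite) manifold \<Rightarrow> ('a, 'n) chart \<Rightarrow> (real \<Rightarrow> 'a) \<Rightarrow> real \<Rightarrow> real ^ 'n" where
  "acceleration M c \<gamma> t =
     (\<chi> k. vector_derivative (velocity c \<gamma>) (at t) $ k +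
        (\<Sum>i\<in>UNIV. \<Sum>j\<in>UNIV. christoffel (metric M c) k i j (coord c (\<gamma> t)) *
           velocity c \<gamma> t $ i * velocity c \<gamma> t $ j))"

definition unit_speed :: "('a, 'n::finite) manifold \<Rightarrow> real set \<Rightarrow> (real \<Rightarrow> 'a) \<Rightarrow> bool" where
  "unit_speed M I \<gamma> \<longleftrightarrow>
     (\<forall>t\<in>I. \<forall>c\<in>charts M. \<gamma> t \<in> cdom c \<longrightarrow>
        mform (metric M c (coord c (\<gamma> t))) (velocity c \<gamma> t) (velocity c \<gamma> t) = 1)"

definition geodesically_complete :: "('a::topological_space, 'n::finite) manifold \<Rightarrow> bool" where
  "geodesically_complete M \<longleftrightarrow>
     (\<forall>c\<in>charts M. \<forall>p\<in>cdom c. \<forall>v. \<exists>\<gamma>.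
        smooth_curve M UNIV \<gamma> \<and> \<gamma> 0 = p \<and> velocity c \<gamma> 0 = v \<and>
        (\<forall>t. \<forall>d\<in>charts M. \<gamma> t \<in> cdom d \<longrightarrow> acceleration M d \<gamma> t = 0))"

section \<open>Oriented surfaces and their products\<close>

text \<open>The matrix of the rotation by \<open>+\<pi>/2\<close> with respect to an inner product \<open>M\<close> on the
  positively oriented plane; see the lemma below.\<close>

definition rot :: "real ^ 2 ^ 2 \<Rightarrow> real ^ 2 ^ 2" where
  "rot M = (1 / sqrt (det M)) *\<^sub>R
     vector [vector [- M $ 1 $ 2, - M $ 2 $ 2], vector [M $ 1 $ 1, M $ 1 $ 2]]"

lemma rot_characterization:
  fixes M :: "real ^ 2 ^ 2"
  assumes sym: "transpose M = M" and pos: "det M > 0"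
  shows "mform M (rot M *v v) v = 0"
    and "mform M (rot M *v v) (rot M *v v) = mform M v v"
    and "det (vector [v, rot M *v v] :: real ^ 2 ^ 2) = mform M v v / sqrt (det M)"
proof -
  define a b d where "a = M $ 1 $ 1" and "b = M $ 1 $ 2" and "d = M $ 2 $ 2"
  have b': "M $ 2 $ 1 = b"
    using arg_cong[OF sym, of "\<lambda>A. A $ 2 $ 1"] by (simp add: transpose_def b_def)
  define r where "r = sqrt (det M)"
  have r: "r > 0" and r2: "r * r = a * d - b * b"
    using pos b' by (auto simp: r_def det_2 a_def b_def d_def)
  define x y where "x = v $ 1" and "y = v $ 2"
  have j1: "(rot M *v v) $ 1 = (- b * x - d * y) / r"
    and j2: "(rot M *v v) $ 2 = (a * x + b * y) / r"
    by (simp_all add: rot_def r_def[symmetric] matrix_vector_mult_def sum_2 x_def y_def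
        a_def b_def d_def diff_divide_distrib add_divide_distrib)
  have mf: "mform M u w = a * u $ 1 * w $ 1 + b * (u $ 1 * w $ 2 + u $ 2 * w $ 1) + d * u $ 2 * w $ 2"
    for u w
    by (simp add: mform_def inner_vec_def matrix_vector_mult_def sum_2 b' a_def b_def d_def
        algebra_simps)
  show "mform M (rot M *v v) v = 0"
    using r by (simp add: mf j1 j2 x_def[symmetric] y_def[symmetric] field_simps)
  define P Q where "P = - b * x - d * y" and "Q = a * x + b * y"
  have "mform M (rot M *v v) (rot M *v v) = (a * P * P + 2 * b * P * Q + d * Q * Q) / (r * r)"
    unfolding mf j1[folded P_def] j2[folded Q_def] using r by (simp add: field_simps)
  also have "a * P * P + 2 * b * P * Q + d * Q * Q = (a * x * x + 2 * b * x * y + d * y * y) * (r * r)"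
    unfolding r2 P_def Q_def by (simp add: algebra_simps)
  also have "\<dots> / (r * r) = a * x * x + 2 * b * x * y + d * y * y"
    using r by simp
  also have "\<dots> = mform M v v"
    by (simp add: mf x_def[symmetric] y_def[symmetric] algebra_simps)
  finally show "mform M (rot M *v v) (rot M *v v) = mform M v v" .
  show "det (vector [v, rot M *v v] :: real ^ 2 ^ 2) = mform M v v / sqrt (det M)"
    unfolding r_def[symmetric] using r
    by (simp add: det_2 mf j1 j2 x_def[symmetric] y_def[symmetric] field_simps)
qed

definition area_form :: "real ^ 2 ^ 2 \<Rightarrow> real ^ 2 \<Rightarrow> real ^ 2 \<Rightarrow> real" where
  "area_form M v w = mform M (rot M *v v) w"

text \<open>\<open>k\<close> is the curvature function of the unit speed curve \<open>\<gamma>\<close>: \<open>D\<^bsub>\<gamma>'\<^esub>\<gamma>' = k j\<gamma>'\<close>.\<close>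

definition has_curvature ::
  "('a, 2) manifold \<Rightarrow> real set \<Rightarrow> (real \<Rightarrow> 'a) \<Rightarrow> (real \<Rightarrow> real) \<Rightarrow> bool" where
  "has_curvature M I \<gamma> k \<longleftrightarrow>
     (\<forall>t\<in>I. \<forall>c\<in>charts M. \<gamma> t \<in> cdom c \<longrightarrow>
        acceleration M c \<gamma> t = k t *\<^sub>R (rot (metric M c (coord c (\<gamma> t))) *v velocity c \<gamma> t))"

text \<open>Coordinates on the product: pairs of coordinate vectors are joined to one vector indexed by
  the sum type.\<close>

definition join :: "real ^ 'm \<Rightarrow> real ^ 'n \<Rightarrow> real ^ ('m + 'n)" where
  "join v w = (\<chi> i. case i of Inl a \<Rightarrow> v $ a | Inr b \<Rightarrow> w $ b)"

definition left_part :: "real ^ ('m::finite + 'n::finite) \<Rightarrow> real ^ 'm" where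
  "left_part v = (\<chi> a. v $ Inl a)"

definition right_part :: "real ^ ('m::finite + 'n::finite) \<Rightarrow> real ^ 'n" where
  "right_part v = (\<chi> b. v $ Inr b)"

definition product_metric ::
  "real \<Rightarrow> (real ^ 2 \<Rightarrow> real ^ 2 ^ 2) \<Rightarrow> (real ^ 2 \<Rightarrow> real ^ 2 ^ 2) \<Rightarrow>
   real ^ (2 + 2) \<Rightarrow> real ^ (2 + 2) ^ (2 + 2)" where
  "product_metric \<epsilon> g1 g2 y =
     (\<chi> i j. case (i, j) of
        (Inl a, Inl b) \<Rightarrow> g1 (left_part y) $ a $ b
      | (Inr a, Inr b) \<Rightarrow> \<epsilon> * g2 (right_part y) $ a $ b
      | _ \<Rightarrow> 0)"

definition product_symplectic ::
  "real \<Rightarrow> (real ^ 2 \<Rightarrow> real ^ 2 ^ 2) \<Rightarrow> (real ^ 2 \<Rightarrow> real ^ 2 ^ 2) \<Rightarrow>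
   real ^ (2 + 2) \<Rightarrow> real ^ (2 + 2) \<Rightarrow> real ^ (2 + 2) \<Rightarrow> real" where
  "product_symplectic \<epsilon> g1 g2 y v w =
     area_form (g1 (left_part y)) (left_part v) (left_part w) + \<epsilon> * area_form (g2 (right_part y)) (right_part v) (right_part w)"

definition product_J ::
  "(real ^ 2 \<Rightarrow> real ^ 2 ^ 2) \<Rightarrow> (real ^ 2 \<Rightarrow> real ^ 2 ^ 2) \<Rightarrow>
   real ^ (2 + 2) \<Rightarrow> real ^ (2 + 2) \<Rightarrow> real ^ (2 + 2)" where
  "product_J g1 g2 y v = join (rot (g1 (left_part y)) *v left_part v) (rot (g2 (right_part y)) *v right_part v)"

definition prep ::
  "('s, 'm::finite) chart \<Rightarrow> ('a, 2) chart \<Rightarrow> ('b, 2) chart \<Rightarrow> ('s \<Rightarrow> 'a \<times> 'b) \<Rightarrow>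
   real ^ 'm \<Rightarrow> real ^ (2 + 2)" where
  "prep c c1 c2 \<Phi> x = join (rep c c1 (fst \<circ> \<Phi>) x) (rep c c2 (snd \<circ> \<Phi>) x)"

section \<open>Lagrangian immersions\<close>

definition immersion ::
  "('a::topological_space, 2) manifold \<Rightarrow> ('b::topological_space, 2) manifold \<Rightarrow>
   ('s::topological_space, 2) chart set \<Rightarrow> ('s \<Rightarrow> 'a \<times> 'b) \<Rightarrow> bool" where
  "immersion M1 M2 A \<Phi> \<longleftrightarrow>
     smooth_map A (charts M1) (fst \<circ> \<Phi>) \<and> smooth_map A (charts M2) (snd \<circ> \<Phi>) \<and>
     (\<forall>c\<in>A. \<forall>c1\<in>charts M1. \<forall>c2\<in>charts M2. \<forall>p\<in>cdom c. \<Phi> p \<in> cdom c1 \<times> cdom c2 \<longrightarrow>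
        inj (frechet_derivative (prep c c1 c2 \<Phi>) (at (coord c p))))"

definition lagrangian_immersion ::
  "real \<Rightarrow> ('a::topological_space, 2) manifold \<Rightarrow> ('b::topological_space, 2) manifold \<Rightarrow>
   ('s::topological_space, 2) chart set \<Rightarrow> ('s \<Rightarrow> 'a \<times> 'b) \<Rightarrow> bool" where
  "lagrangian_immersion \<epsilon> M1 M2 A \<Phi> \<longleftrightarrow>
     immersion M1 M2 A \<Phi> \<and>
     (\<forall>c\<in>A. \<forall>c1\<in>charts M1. \<forall>c2\<in>charts M2. \<forall>p\<in>cdom c. \<Phi> p \<in> cdom c1 \<times> cdom c2 \<longrightarrow>
        (let F = prep c c1 c2 \<Phi>; x = coord c p; dF = frechet_derivative F (at x)
         in \<forall>v w. product_symplectic \<epsilon> (metric M1 c1) (metric M2 c2) (F x) (dF v) (dF w) = 0))"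

definition projected_rank_one ::
  "('a, 2) manifold \<Rightarrow> ('b, 2) manifold \<Rightarrow> ('s, 2) chart set \<Rightarrow> ('s \<Rightarrow> 'a \<times> 'b) \<Rightarrow> bool" where
  "projected_rank_one M1 M2 A \<Phi> \<longleftrightarrow>
     (\<forall>p. rank_at A (charts M1) (fst \<circ> \<Phi>) p = 1 \<or> rank_at A (charts M2) (snd \<circ> \<Phi>) p = 1)"

text \<open>In the chart \<open>c\<close> of the source surface, whose image is the rectangle \<open>I \<times> J\<close>, the
  map \<open>\<Phi>\<close> is \<open>(s,t) \<mapsto> (\<alpha>(s),\<beta>(t))\<close> with \<open>\<alpha>\<close>, \<open>\<beta>\<close> parametrised by arclength.\<close>

definition arclength_splitting ::
  "('a::topological_space, 2) manifold \<Rightarrow> ('b::topological_space, 2) manifold \<Rightarrow>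
   ('s::topological_space, 2) chart set \<Rightarrow> ('s \<Rightarrow> 'a \<times> 'b) \<Rightarrow>
   ('s, 2) chart \<Rightarrow> real set \<Rightarrow> real set \<Rightarrow> (real \<Rightarrow> 'a) \<Rightarrow> (real \<Rightarrow> 'b) \<Rightarrow> bool" where
  "arclength_splitting M1 M2 A \<Phi> c I J \<alpha> \<beta> \<longleftrightarrow>
     compatible_chart A c \<and>
     open I \<and> is_interval I \<and> I \<noteq> {} \<and> open J \<and> is_interval J \<and> J \<noteq> {} \<and>
     cimg c = {x. x $ 1 \<in> I \<and> x $ 2 \<in> J} \<and>
     smooth_curve M1 I \<alpha> \<and> unit_speed M1 I \<alpha> \<and>
     smooth_curve M2 J \<beta> \<and> unit_speed M2 J \<beta> \<and>
     (\<forall>p\<in>cdom c. \<Phi> p = (\<alpha> (coord c p $ 1), \<beta> (coord c p $ 2)))"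

definition induced_metric ::
  "real \<Rightarrow> ('a, 2) manifold \<Rightarrow> ('b, 2) manifold \<Rightarrow> ('s \<Rightarrow> 'a \<times> 'b) \<Rightarrow>
   ('s, 2) chart \<Rightarrow> real ^ 2 \<Rightarrow> real ^ 2 ^ 2" where
  "induced_metric \<epsilon> M1 M2 \<Phi> c x =
     (let q = \<Phi> (cinv c x); c1 = chart_at (charts M1) (fst q); c2 = chart_at (charts M2) (snd q)
      in pullback_metric (product_metric \<epsilon> (metric M1 c1) (metric M2 c2)) (prep c c1 c2 \<Phi>) x)"

definition induced_volume ::
  "real \<Rightarrow> ('a, 2) manifold \<Rightarrow> ('b, 2) manifold \<Rightarrow> ('s::topological_space, 2) chart set \<Rightarrow>
   ('s \<Rightarrow> 'a \<times> 'b) \<Rightarrow> 's measure" where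
  "induced_volume \<epsilon> M1 M2 A \<Phi> = volume_measure A (induced_metric \<epsilon> M1 M2 \<Phi>)"

section \<open>Hamiltonian variations\<close>

definition smooth_family ::
  "('a::topological_space, 2) manifold \<Rightarrow> ('s::topological_space, 2) chart set \<Rightarrow> real \<Rightarrow>
   (real \<Rightarrow> 's \<Rightarrow> 'a) \<Rightarrow> bool" where
  "smooth_family M A \<delta> f \<longleftrightarrow>
     continuous_on ({-\<delta><..<\<delta>} \<times> UNIV) (\<lambda>(\<tau>, p). f \<tau> p) \<and>
     (\<forall>c\<in>A. \<forall>d\<in>charts M.
        smooth_on {(\<tau>, x). \<tau> \<in> {-\<delta><..<\<delta>} \<and> x \<in> cimg c \<and> f \<tau> (cinv c x) \<in> cdom d}
          (\<lambda>(\<tau>, x). rep c d (f \<tau>) x))"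

definition hamiltonian_variation ::
  "real \<Rightarrow> ('a::topological_space, 2) manifold \<Rightarrow> ('b::topological_space, 2) manifold \<Rightarrow>
   ('s::topological_space, 2) chart set \<Rightarrow> ('s \<Rightarrow> 'a \<times> 'b) \<Rightarrow>
   real \<Rightarrow> 's set \<Rightarrow> (real \<Rightarrow> 's \<Rightarrow> 'a \<times> 'b) \<Rightarrow> bool" where
  "hamiltonian_variation \<epsilon> M1 M2 A \<Phi> \<delta> K W \<longleftrightarrow>
     \<delta> > 0 \<and> compact K \<and> W 0 = \<Phi> \<and>
     smooth_family M1 A \<delta> (\<lambda>\<tau>. fst \<circ> W \<tau>) \<and> smooth_family M2 A \<delta> (\<lambda>\<tau>. snd \<circ> W \<tau>) \<and>
     (\<forall>\<tau>\<in>{-\<delta><..<\<delta>}.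
        lagrangian_immersion \<epsilon> M1 M2 A (W \<tau>) \<and>
        (\<forall>p. p \<notin> K \<longrightarrow> W \<tau> p = \<Phi> p) \<and>
        (\<exists>f. smooth_fun A f \<and> compactly_supported f \<and>
           (\<forall>c\<in>A. \<forall>c1\<in>charts M1. \<forall>c2\<in>charts M2. \<forall>p\<in>cdom c. W \<tau> p \<in> cdom c1 \<times> cdom c2 \<longrightarrow>
              (let F = \<lambda>\<sigma>. prep c c1 c2 (W \<sigma>); x = coord c p
               in \<forall>v. product_symplectic \<epsilon> (metric M1 c1) (metric M2 c2) (F \<tau> x)
                        (vector_derivative (\<lambda>\<sigma>. F \<sigma> x) (at \<tau>))
                        (frechet_derivative (F \<tau>) (at x) v)
                      = frechet_derivative (f \<circ> cinv c) (at x) v))))"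

definition hamiltonian_minimal ::
  "real \<Rightarrow> ('a::topological_space, 2) manifold \<Rightarrow> ('b::topological_space, 2) manifold \<Rightarrow>
   ('s::topological_space, 2) chart set \<Rightarrow> ('s \<Rightarrow> 'a \<times> 'b) \<Rightarrow> bool" where
  "hamiltonian_minimal \<epsilon> M1 M2 A \<Phi> \<longleftrightarrow>
     lagrangian_immersion \<epsilon> M1 M2 A \<Phi> \<and>
     (\<forall>\<delta> K W. hamiltonian_variation \<epsilon> M1 M2 A \<Phi> \<delta> K W \<longrightarrow>
        ((\<lambda>\<tau>. measure (induced_volume \<epsilon> M1 M2 A (W \<tau>)) K) has_real_derivative 0) (at 0))"

text \<open>The integrand at \<open>p\<close> of the second variation of the volume in the direction
  \<open>J\<nabla>u\<close>: \<open>(\<Delta>u)\<^sup>2 - Ric(\<nabla>u,\<nabla>u) - 2 G(h(\<nabla>u,\<nabla>u),2H) + G(2H,J\<nabla>u)\<^sup>2\<close>.\<close>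

definition second_variation_integrand ::
  "real \<Rightarrow> ('a, 2) manifold \<Rightarrow> ('b, 2) manifold \<Rightarrow> ('s, 2) chart set \<Rightarrow>
   ('s \<Rightarrow> 'a \<times> 'b) \<Rightarrow> ('s \<Rightarrow> real) \<Rightarrow> 's \<Rightarrow> real" where
  "second_variation_integrand \<epsilon> M1 M2 A \<Phi> u p =
     (let c = chart_at A p;
          c1 = chart_at (charts M1) (fst (\<Phi> p));
          c2 = chart_at (charts M2) (snd (\<Phi> p));
          g1 = metric M1 c1;
          g2 = metric M2 c2;
          G = product_metric \<epsilon> g1 g2;
          F = prep c c1 c2 \<Phi>;
          g = induced_metric \<epsilon> M1 M2 \<Phi> c;
          x = coord c p;
          y = F x;
          v = gradient g (u \<circ> cinv c) x;
          V = frechet_derivative F (at x) v;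
          H2 = trace_sff G F x
      in (laplacian g (u \<circ> cinv c) x)\<^sup>2
         - ricci G y V V
         - 2 * mform (G y) (second_fundamental_form G F x v v) H2
         + (mform (G y) H2 (product_J g1 g2 y V))\<^sup>2)"

definition second_variation ::
  "real \<Rightarrow> ('a, 2) manifold \<Rightarrow> ('b, 2) manifold \<Rightarrow> ('s::topological_space, 2) chart set \<Rightarrow>
   ('s \<Rightarrow> 'a \<times> 'b) \<Rightarrow> ('s \<Rightarrow> real) \<Rightarrow> real" where
  "second_variation \<epsilon> M1 M2 A \<Phi> u =
     (LINT p|induced_volume \<epsilon> M1 M2 A \<Phi>. second_variation_integrand \<epsilon> M1 M2 A \<Phi> u p)"

definition hamiltonian_local_minimizer ::
  "real \<Rightarrow> ('a, 2) manifold \<Rightarrow> ('b, 2) manifold \<Rightarrow> ('s::topological_space, 2) chart set \<Rightarrow>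
   ('s \<Rightarrow> 'a \<times> 'b) \<Rightarrow> bool" where
  "hamiltonian_local_minimizer \<epsilon> M1 M2 A \<Phi> \<longleftrightarrow>
     (\<forall>u. smooth_fun A u \<and> compactly_supported u \<longrightarrow> second_variation \<epsilon> M1 M2 A \<Phi> u \<ge> 0)"

end

theory Submission
  imports Defs
begin

text \<open>Let the immersion be \<open>(s,t) \<mapsto> (\<phi>(s), \<psi>(t))\<close> with both curves parametrised by arclength. The induced
  metric is \<open>ds\<^sup>2 + \<epsilon> dt\<^sup>2\<close>, and with \<open>d\<Phi>(\<nabla>u) = (a \<phi>', b \<psi>')\<close> the integrand of the second variation equals
  \<open>(\<Delta>u)\<^sup>2 - (\<kappa>\<^sub>1 + 2k\<^sub>\<phi>\<^sup>2) a\<^sup>2 - (\<kappa>\<^sub>2 + 2k\<^sub>\<psi>\<^sup>2) b\<^sup>2 + (k\<^sub>\<phi> a + k\<^sub>\<psi> b)\<^sup>2\<close>.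
  So it is nonnegative at every point, and no integration by parts is needed.

  The splitting exists near every point: the Lagrangian condition forces both projections to have
  rank one everywhere, so a component of \<open>\<phi>\<close> and a component of \<open>\<psi>\<close> are local coordinates in which each
  projection depends on one coordinate only, and arclength replaces these coordinates.\<close>

section \<open>Smooth functions\<close>

text \<open>The integrand of the second variation is defined in charts picked by
  \<open>chart_at\<close>, which are unrelated to the splitting. Instead of proving that Ricci form,
  second fundamental form and trace are independent of charts, the formula is derived in an
  arbitrary chart, where the immersion reads \<open>join (X (p z)) (Y (q z))\<close> with the
  arclength parameters \<open>p\<close> and \<open>q\<close> as functions of the coordinates. Their
  Hessians contribute tangentially and vanish in the normal part. What has to be compared between
  charts is the geometry of curves and the vanishing of Jacobian determinants. The curvature bound
  speaks of functions that satisfy the curvature equation in all charts at once; that such functions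
  exist rests on the naturality of covariant acceleration and, for the sign of the normal, on the
  orientation. For \<epsilon> = -1 the induced metric is indefinite, but \<epsilon> always meets
  another \<epsilon>: the connection does not see it, and the one in the trace of the second
  fundamental form cancels against the one in the product metric. Both signs therefore lead to the
  same expression.\<close>

lemma Ck_on_subset: "Ck_on k U f \<Longrightarrow> V \<subseteq> U \<Longrightarrow> Ck_on k V f"
  by (induction k arbitrary: f) (auto intro: continuous_on_subset)

text \<open>\<open>frechet_derivative\<close> is taken with respect to the whole space, so agreement
  on \<open>U\<close> passes to derivatives because \<open>U\<close> is open.\<close>

lemma Ck_on_cong:
  assumes "open U" "\<And>x. x \<in> U \<Longrightarrow> f x = g x" "Ck_on k U f"
  shows "Ck_on k U g"
  using assms(2,3)
proof (induction k arbitrary: f g)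
  case 0
  then show ?case by (auto cong: continuous_on_cong)
next
  case (Suc k)
  have "(g has_derivative frechet_derivative f (at x)) (at x)" if "x \<in> U" for x
    by (rule has_derivative_transform_within_open[where f = f, OF _ assms(1) that])
      (use Suc.prems that frechet_derivative_works in auto)
  then have D: "g differentiable (at x)" "frechet_derivative f (at x) = frechet_derivative g (at x)"
    if "x \<in> U" for x
    using that frechet_derivative_at differentiable_def by blast+
  have "Ck_on k U (\<lambda>x. frechet_derivative g (at x) v)" for v
    by (rule Suc.IH[of "\<lambda>x. frechet_derivative f (at x) v"]) (use Suc.prems(2) D(2) in simp_all)
  with D show ?case
    by simp
qed

text \<open>Lets a derivative computed by the usual rules stand for the choice term
  \<open>frechet_derivative\<close>; the induction steps below enter through it.\<close>

lemma Ck_on_SucI: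
  assumes "open U" and d: "\<And>x. x \<in> U \<Longrightarrow> (f has_derivative f' x) (at x)"
    and C: "\<And>v. Ck_on k U (\<lambda>x. f' x v)"
  shows "Ck_on (Suc k) U f"
proof -
  have "f' x = frechet_derivative f (at x)" if "x \<in> U" for x
    using d[OF that] by (rule frechet_derivative_at)
  then have "Ck_on k U (\<lambda>x. frechet_derivative f (at x) v)" for v
    by (intro Ck_on_cong[OF \<open>open U\<close> _ C[of v]]) auto
  then show ?thesis
    using d by (auto simp: differentiable_def)
qed

lemma Ck_on_SucD:
  assumes "Ck_on (Suc k) U f" "x \<in> U"
  shows "(f has_derivative frechet_derivative f (at x)) (at x)"
  using assms by (simp add: frechet_derivative_works)

text \<open>The recursion speaks of derivatives only, so lowering the order descends to the base
  case, where differentiability gives continuity.\<close>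

lemma Ck_on_Suc_imp: "Ck_on (Suc k) U f \<Longrightarrow> Ck_on k U f"
proof (induction k arbitrary: f)
  case 0
  then show ?case
    by (auto intro!: continuous_at_imp_continuous_on differentiable_imp_continuous_within)
next
  case (Suc k)
  then have "Ck_on (Suc k) U (\<lambda>x. frechet_derivative f (at x) v)" for v
    unfolding Ck_on.simps(2)[of "Suc k" U f] by blast
  then have "Ck_on k U (\<lambda>x. frechet_derivative f (at x) v)" for v
    by (rule Suc.IH)
  then show ?case
    using Suc.prems unfolding Ck_on.simps(2)[of k U f] Ck_on.simps(2)[of "Suc k" U f] by blast
qed

lemma Ck_on_const: "open U \<Longrightarrow> Ck_on k U (\<lambda>x. c)"
  by (induction k arbitrary: c) (auto intro!: Ck_on_SucI has_derivative_const simp del: Ck_on.simps(2))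

lemma Ck_on_bounded_linear:
  assumes "open U" "bounded_linear L"
  shows "Ck_on k U L"
proof (cases k)
  case 0
  then show ?thesis using assms by (auto intro: linear_continuous_on)
next
  case (Suc n)
  show ?thesis unfolding Suc
    by (rule Ck_on_SucI[where f' = "\<lambda>x. L"])
      (use assms in \<open>auto intro: Ck_on_const bounded_linear_imp_has_derivative\<close>)
qed

lemma Ck_on_add:
  assumes "open U" "Ck_on k U f" "Ck_on k U g"
  shows "Ck_on k U (\<lambda>x. f x + g x)"
  using assms(2,3)
proof (induction k arbitrary: f g)
  case 0
  then show ?case by (auto intro: continuous_intros)
next
  case (Suc k)
  show ?case
    by (rule Ck_on_SucI[OF assms(1) has_derivative_add[OF Ck_on_SucD Ck_on_SucD]])
      (use Suc in auto)
qed

text \<open>Each term of the product rule keeps one factor undifferentiated, whose order is lowered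
  by \<open>Ck_on_Suc_imp\<close>.\<close>

lemma Ck_on_bounded_bilinear:
  assumes "bounded_bilinear B" "open U" "Ck_on k U f" "Ck_on k U g"
  shows "Ck_on k U (\<lambda>x. B (f x) (g x))"
  using assms(3,4)
proof (induction k arbitrary: f g)
  case 0
  then show ?case using bounded_bilinear.continuous_on[OF assms(1)] by auto
next
  case (Suc k)
  show ?case
    by (rule Ck_on_SucI[OF assms(2) bounded_bilinear.FDERIV[OF assms(1) Ck_on_SucD Ck_on_SucD]])
      (use Suc.prems in \<open>auto intro!: Ck_on_add Suc.IH assms(2) Ck_on_Suc_imp[OF Suc.prems(1)] Ck_on_Suc_imp[OF Suc.prems(2)]\<close>)
qed

lemma Ck_on_sum:
  assumes "open U" "\<And>i. i \<in> A \<Longrightarrow> Ck_on k U (f i)"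
  shows "Ck_on k U (\<lambda>x. \<Sum>i\<in>A. f i x)"
  using assms(2)
  by (induction A rule: infinite_finite_induct) (auto intro!: Ck_on_const Ck_on_add assms(1))

lemma Ck_on_linear_compose:
  assumes "open U" "bounded_linear L" "Ck_on k U f"
  shows "Ck_on k U (\<lambda>x. L (f x))"
  using assms(3)
proof (induction k arbitrary: f)
  case 0
  then show ?case using bounded_linear.continuous_on[OF assms(2)] by auto
next
  case (Suc k)
  show ?case
    by (rule Ck_on_SucI[OF assms(1) bounded_linear.has_derivative[OF assms(2) Ck_on_SucD]])
      (use Suc in auto)
qed

text \<open>\<open>Ck_on\<close> differentiates in fixed directions, whereas in the chain rule the
  direction moves with the point. Expanding it in a basis turns the derivative into a sum of
  products covered by the induction hypothesis; this is why \<open>f\<close> maps into a Euclidean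
  space.\<close>

lemma Ck_on_compose:
  fixes f :: "'a::real_normed_vector \<Rightarrow> 'b::euclidean_space"
  assumes "open U" "open V" "f ` U \<subseteq> V" "Ck_on k U f" "Ck_on k V g"
  shows "Ck_on k U (\<lambda>x. g (f x))"
  using assms(4,5)
proof (induction k arbitrary: g)
  case 0
  then show ?case using assms(3) by (auto intro: continuous_on_compose2)
next
  case (Suc k)
  let ?D = "\<lambda>x v. frechet_derivative g (at (f x)) (frechet_derivative f (at x) v)"
  show ?case
  proof (rule Ck_on_SucI[OF assms(1), of _ ?D])
    fix x assume x: "x \<in> U"
    then have "f x \<in> V" using assms(3) by auto
    from diff_chain_at[OF Ck_on_SucD[OF Suc.prems(1) x] Ck_on_SucD[OF Suc.prems(2) this]]
    show "((\<lambda>x. g (f x)) has_derivative ?D x) (at x)"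
      by (simp add: o_def)
  next
    fix v
    have "Ck_on k U (\<lambda>x. \<Sum>i\<in>Basis. (frechet_derivative f (at x) v \<bullet> i) *\<^sub>R frechet_derivative g (at (f x)) i)"
      using Suc.prems
      by (intro Ck_on_sum Ck_on_bounded_bilinear[OF bounded_bilinear_scaleR]
          Ck_on_linear_compose[OF _ bounded_linear_inner_left] Suc.IH assms(1) Ck_on_Suc_imp[OF Suc.prems(1)]) auto
    then show "Ck_on k U (\<lambda>x. ?D x v)"
    proof (rule Ck_on_cong[OF assms(1), rotated])
      fix x assume "x \<in> U"
      then have "f x \<in> V" using assms(3) by auto
      from has_derivative_linear[OF Ck_on_SucD[OF Suc.prems(2) this]]
      have "linear (frechet_derivative g (at (f x)))" .
      then have "frechet_derivative g (at (f x)) (\<Sum>i\<in>Basis. (frechet_derivative f (at x) v \<bullet> i) *\<^sub>R i)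
          = (\<Sum>i\<in>Basis. (frechet_derivative f (at x) v \<bullet> i) *\<^sub>R frechet_derivative g (at (f x)) i)"
        by (simp add: linear_sum linear_cmul)
      then show "(\<Sum>i\<in>Basis. (frechet_derivative f (at x) v \<bullet> i) *\<^sub>R frechet_derivative g (at (f x)) i) = ?D x v"
        by (simp add: euclidean_representation)
    qed
  qed
qed

text \<open>The derivative is a polynomial in \<open>inverse\<close> itself, so the induction closes
  by the product rule.\<close>

lemma Ck_on_inverse: "Ck_on k (- {0::real}) inverse"
proof (induction k)
  case 0
  show ?case by (simp add: continuous_on_inverse)
next
  case (Suc k)
  have o: "open (- {0::real})" by auto
  show ?case
  proof (rule Ck_on_SucI[OF o, of _ "\<lambda>x v. (inverse x * inverse x) * (- v)"])
    show "(inverse has_derivative (\<lambda>v. (inverse x * inverse x) * (- v))) (at x)" if "x \<in> - {0}" for x :: real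
      using that by (auto intro!: derivative_eq_intros simp: field_simps)
    show "Ck_on k (- {0}) (\<lambda>x::real. (inverse x * inverse x) * (- v))" for v
      by (intro Ck_on_bounded_bilinear[OF bounded_bilinear_mult] Ck_on_const o Suc)
  qed
qed

text \<open>For positive \<open>x\<close> the reciprocal of \<open>sqrt x\<close> is
  \<open>sqrt x * inverse x\<close>, so the derivative is built from the function itself and one
  treated already.\<close>

lemma Ck_on_sqrt: "Ck_on k {0<..} sqrt"
proof (induction k)
  case 0
  show ?case by (simp add: continuous_on_real_sqrt)
next
  case (Suc k)
  have o: "open {0::real<..}" by auto
  show ?case
  proof (rule Ck_on_SucI[OF o, of _ "\<lambda>x v. (sqrt x * inverse x) * (v / 2)"])
    show "(sqrt has_derivative (\<lambda>v. (sqrt x * inverse x) * (v / 2))) (at x)" if "x \<in> {0<..}" for x :: real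
      using that by (auto intro!: derivative_eq_intros simp: field_simps real_sqrt_mult_self)
    show "Ck_on k {0<..} (\<lambda>x::real. (sqrt x * inverse x) * (v / 2))" for v
      by (intro Ck_on_bounded_bilinear[OF bounded_bilinear_mult] Ck_on_const o Suc
        Ck_on_subset[OF Ck_on_inverse]) auto
  qed
qed

section \<open>The same calculus for functions of class C-infinity\<close>

lemma smooth_on_subset: "smooth_on U f \<Longrightarrow> V \<subseteq> U \<Longrightarrow> smooth_on V f"
  by (auto simp: smooth_on_def intro: Ck_on_subset)

lemma smooth_on_cong:
  "open U \<Longrightarrow> (\<And>x. x \<in> U \<Longrightarrow> f x = g x) \<Longrightarrow> smooth_on U f \<Longrightarrow> smooth_on U g"
  by (auto simp: smooth_on_def intro: Ck_on_cong)

lemma smooth_on_derivative: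
  assumes "smooth_on U f" "x \<in> U"
  shows "(f has_derivative frechet_derivative f (at x)) (at x)"
  using assms Ck_on_SucD[of 0 U f x] by (auto simp: smooth_on_def)

lemma smooth_on_frechet_derivative:
  assumes "smooth_on U f"
  shows "smooth_on U (\<lambda>x. frechet_derivative f (at x) v)"
  using assms Ck_on.simps(2)[of _ U f] by (auto simp: smooth_on_def)

lemma smooth_on_SucI:
  assumes "open U" and d: "\<And>x. x \<in> U \<Longrightarrow> (f has_derivative f' x) (at x)"
    and C: "\<And>v. smooth_on U (\<lambda>x. f' x v)"
  shows "smooth_on U f"
  unfolding smooth_on_def
proof
  fix k
  show "Ck_on k U f"
    using C Ck_on_SucI[OF assms(1,2), of k] Ck_on_Suc_imp unfolding smooth_on_def by blast
qed

lemma smooth_on_imp_continuous_on: "smooth_on U f \<Longrightarrow> continuous_on U f"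
  by (metis smooth_on_def Ck_on.simps(1))

lemma smooth_on_const: "open U \<Longrightarrow> smooth_on U (\<lambda>x. c)"
  by (simp add: smooth_on_def Ck_on_const)

lemma smooth_on_bounded_linear: "open U \<Longrightarrow> bounded_linear L \<Longrightarrow> smooth_on U L"
  by (simp add: smooth_on_def Ck_on_bounded_linear)

lemma smooth_on_add:
  "open U \<Longrightarrow> smooth_on U f \<Longrightarrow> smooth_on U g \<Longrightarrow> smooth_on U (\<lambda>x. f x + g x)"
  by (simp add: smooth_on_def Ck_on_add)

lemma smooth_on_bounded_bilinear:
  "bounded_bilinear B \<Longrightarrow> open U \<Longrightarrow> smooth_on U f \<Longrightarrow> smooth_on U g \<Longrightarrow> smooth_on U (\<lambda>x. B (f x) (g x))"
  by (simp add: smooth_on_def Ck_on_bounded_bilinear)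

lemmas smooth_on_mult = smooth_on_bounded_bilinear[OF bounded_bilinear_mult]
lemmas smooth_on_scaleR = smooth_on_bounded_bilinear[OF bounded_bilinear_scaleR]

lemma smooth_on_linear_compose:
  "open U \<Longrightarrow> bounded_linear L \<Longrightarrow> smooth_on U f \<Longrightarrow> smooth_on U (\<lambda>x. L (f x))"
  by (simp add: smooth_on_def Ck_on_linear_compose)

lemma smooth_on_sum:
  "open U \<Longrightarrow> (\<And>i. i \<in> A \<Longrightarrow> smooth_on U (f i)) \<Longrightarrow> smooth_on U (\<lambda>x. \<Sum>i\<in>A. f i x)"
  by (simp add: smooth_on_def Ck_on_sum)

lemma smooth_on_diff:
  assumes "open U" "smooth_on U f" "smooth_on U g" shows "smooth_on U (\<lambda>x. f x - g x)"
  using smooth_on_add[OF assms(1,2) smooth_on_linear_compose[OF assms(1) bounded_linear_minus[OF bounded_linear_ident] assms(3)]]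
  by simp

lemma smooth_on_compose:
  fixes f :: "'a::real_normed_vector \<Rightarrow> 'b::euclidean_space"
  shows "open U \<Longrightarrow> open V \<Longrightarrow> f ` U \<subseteq> V \<Longrightarrow> smooth_on U f \<Longrightarrow> smooth_on V g \<Longrightarrow> smooth_on U (\<lambda>x. g (f x))"
  using Ck_on_compose by (fastforce simp: smooth_on_def)

lemma smooth_on_inverse:
  fixes f :: "'a::real_normed_vector \<Rightarrow> real"
  shows "open U \<Longrightarrow> smooth_on U f \<Longrightarrow> (\<And>x. x \<in> U \<Longrightarrow> f x \<noteq> 0) \<Longrightarrow> smooth_on U (\<lambda>x. inverse (f x))"
  by (rule smooth_on_compose[where V = "- {0}"]) (auto simp: smooth_on_def Ck_on_inverse)

lemma smooth_on_divide:
  fixes f :: "'a::real_normed_vector \<Rightarrow> real"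
  shows "open U \<Longrightarrow> smooth_on U f \<Longrightarrow> smooth_on U g \<Longrightarrow> (\<And>x. x \<in> U \<Longrightarrow> g x \<noteq> 0) \<Longrightarrow> smooth_on U (\<lambda>x. f x / g x)"
  unfolding divide_inverse by (intro smooth_on_mult smooth_on_inverse)

lemma smooth_on_sqrt:
  fixes f :: "'a::real_normed_vector \<Rightarrow> real"
  shows "open U \<Longrightarrow> smooth_on U f \<Longrightarrow> (\<And>x. x \<in> U \<Longrightarrow> f x > 0) \<Longrightarrow> smooth_on U (\<lambda>x. sqrt (f x))"
  by (rule smooth_on_compose[where V = "{0<..}"]) (auto simp: smooth_on_def Ck_on_sqrt)

lemma smooth_on_nth: "open U \<Longrightarrow> smooth_on U f \<Longrightarrow> smooth_on U (\<lambda>x. f x $ i)"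
  by (rule smooth_on_linear_compose[OF _ bounded_linear_vec_nth])

lemma smooth_on_vec_lambda:
  fixes f :: "'i::finite \<Rightarrow> 'a::real_normed_vector \<Rightarrow> 'b::real_normed_vector"
  assumes "open U" "\<And>i. smooth_on U (f i)"
  shows "smooth_on U (\<lambda>x. \<chi> i. f i x)"
proof -
  have L: "bounded_linear (\<lambda>y::'b. axis i y :: 'b ^ 'i)" for i
    by (rule bounded_linear_intro[where K = 1])
      (auto simp: vec_eq_iff axis_def norm_vec_def L2_set_def if_distribR if_distrib[of norm] if_distrib[of "\<lambda>x. x\<^sup>2"] cong: if_cong)
  have "smooth_on U (\<lambda>x. \<Sum>i\<in>UNIV. axis i (f i x))"
    by (intro smooth_on_sum smooth_on_linear_compose[OF _ L] assms)
  then show ?thesis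
    by (rule smooth_on_cong[OF assms(1), rotated])
      (auto simp: vec_eq_iff axis_def if_distrib cong: if_cong)
qed

text \<open>Upgrades a differentiable inverse to a smooth one. Differentiating
  \<open>f (g y) = y\<close> gives linear equations for the derivative of \<open>g\<close> whose
  coefficients are the partial derivatives of \<open>f\<close>.\<close>

lemma smooth_on_inverse_function:
  fixes f :: "real ^ 2 \<Rightarrow> real ^ 2"
  assumes U: "open U" "smooth_on U f" and V: "open V" "g ` V \<subseteq> U"
    and fg: "\<And>y. y \<in> V \<Longrightarrow> f (g y) = y"
    and g: "\<And>y. y \<in> V \<Longrightarrow> (g has_derivative g' y) (at y)"
  shows "smooth_on V g"
proof -
  define P where "P i j x = frechet_derivative f (at x) (axis j 1) $ i" for i j x
  define d where "d x = P 1 1 x * P 2 2 x - P 1 2 x * P 2 1 x" for x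
  have sP: "smooth_on U (P i j)" for i j
    unfolding P_def by (intro smooth_on_nth U smooth_on_frechet_derivative)
  have sd: "smooth_on U d"
    unfolding d_def by (intro smooth_on_diff smooth_on_mult sP U)
  have eq: "P i 1 (g y) * g' y v $ 1 + P i 2 (g y) * g' y v $ 2 = v $ i" if "y \<in> V" for i y v
  proof -
    have gy: "g y \<in> U" using that V by auto
    have df: "(f has_derivative frechet_derivative f (at (g y))) (at (g y))"
      by (rule smooth_on_derivative[OF U(2) gy])
    have "((\<lambda>y. f (g y)) has_derivative (\<lambda>v. frechet_derivative f (at (g y)) (g' y v))) (at y)"
      using diff_chain_at[OF g[OF that] df] by (simp add: o_def)
    moreover have "((\<lambda>y. f (g y)) has_derivative (\<lambda>v. v)) (at y)"
      by (rule has_derivative_transform_within_open[OF has_derivative_ident V(1) that]) (simp add: fg)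
    ultimately have "frechet_derivative f (at (g y)) (g' y v) = v"
      using has_derivative_unique by metis
    moreover have "g' y v = (g' y v $ 1) *\<^sub>R axis 1 1 + (g' y v $ 2) *\<^sub>R axis 2 1"
      by (simp add: vec_eq_iff forall_2 axis_def)
    ultimately have "frechet_derivative f (at (g y)) ((g' y v $ 1) *\<^sub>R axis 1 1 + (g' y v $ 2) *\<^sub>R axis 2 1) = v"
      by simp
    then show ?thesis
      using has_derivative_linear[OF df]
      by (simp add: linear_add linear_cmul vec_eq_iff P_def) (metis mult.commute)
  qed
  \<comment> \<open>The images of the two axes under \<open>g' y\<close> solve the system for both
    unit right-hand sides, which a singular matrix does not allow.\<close>
  have dnz: "d (g y) \<noteq> 0" if "y \<in> V" for y
  proof
    assume 0: "d (g y) = 0"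
    note e = eq[OF that]
    define a b where "a = g' y (axis 1 1)" and "b = g' y (axis 2 1)"
    have "P 1 1 (g y) * a$1 + P 1 2 (g y) * a$2 = 1" "P 2 1 (g y) * a$1 + P 2 2 (g y) * a$2 = 0"
      "P 1 1 (g y) * b$1 + P 1 2 (g y) * b$2 = 0" "P 2 1 (g y) * b$1 + P 2 2 (g y) * b$2 = 1"
      unfolding a_def b_def by (subst e; simp add: axis_def)+
    then show False using 0 unfolding d_def by algebra
  qed
  have form: "g' y v = (\<chi> i. if i = 1 then (P 2 2 (g y) * v $ 1 - P 1 2 (g y) * v $ 2) / d (g y)
       else (P 1 1 (g y) * v $ 2 - P 2 1 (g y) * v $ 1) / d (g y))" if "y \<in> V" for y v
    using eq[OF that, of 1 v, symmetric] eq[OF that, of 2 v, symmetric] dnz[OF that]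
    by (simp add: vec_eq_iff forall_2 field_simps) (simp add: d_def algebra_simps)
  \<comment> \<open>By Cramer's rule the derivative of \<open>g\<close> is a smooth function of \<open>g\<close>, so \<open>g\<close> gains one order of
    differentiability at a time.\<close>
  have "Ck_on k V g" for k
  proof (induction k)
    case 0
    show ?case using g by (auto intro!: has_derivative_continuous_on intro: has_derivative_at_withinI)
  next
    case (Suc k)
    have C: "Ck_on k V (\<lambda>y. q (g y))" if "smooth_on U q" for q :: "real^2 \<Rightarrow> real^2"
      using Ck_on_compose[OF V(1) U(1) V(2) Suc] that by (auto simp: smooth_on_def)
    define Q where "Q v x = (\<chi> i. if i = 1 then (P 2 2 x * v $ 1 - P 1 2 x * v $ 2) / d x
       else (P 1 1 x * v $ 2 - P 2 1 x * v $ 1) / d x :: real ^ 2)" for v :: "real^2" and x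
    \<comment> \<open>Cramer's formula is smooth where the determinant is nonzero; this open set
      contains the image of \<open>g\<close>.\<close>
    define U' where "U' = U \<inter> d -` (- {0})"
    have U': "open U'" 
      unfolding U'_def using smooth_on_imp_continuous_on[OF sd] U(1) 
      by (intro continuous_open_preimage) auto
    have sub: "U' \<subseteq> U" "g ` V \<subseteq> U'"
      using V dnz by (auto simp: U'_def)
    have "smooth_on U' (Q v)" for v
    proof -
      have "smooth_on U' (\<lambda>x. if i = 1 then (P 2 2 x * v $ 1 - P 1 2 x * v $ 2) / d x
       else (P 1 1 x * v $ 2 - P 2 1 x * v $ 1) / d x)" for i :: 2
        by (cases "i = 1") (auto intro!: smooth_on_divide smooth_on_diff smooth_on_mult smooth_on_const 
          U' smooth_on_subset[OF sP sub(1)] smooth_on_subset[OF sd sub(1)], auto simp: U'_def)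
      then show ?thesis
        unfolding Q_def[abs_def] by (intro smooth_on_vec_lambda U')
    qed
    then have "Ck_on k V (\<lambda>y. Q v (g y))" for v
      using Ck_on_compose[OF V(1) U' sub(2) Suc] by (auto simp: smooth_on_def)
    then have "Ck_on k V (\<lambda>y. g' y v)" for v
      by (rule Ck_on_cong[OF V(1), rotated]) (simp add: form Q_def)
    with V(1) g show ?case
      by (rule Ck_on_SucI)
  qed
  then show ?thesis by (simp add: smooth_on_def)
qed

text \<open>The left side is the increment over \<open>u\<close> of the increment over
  \<open>v\<close>. The mean value theorem along \<open>u\<close>, then along \<open>v\<close>,
  leaves a second derivative with \<open>u\<close> taken first. As the left side is symmetric in
  \<open>u\<close> and \<open>v\<close>, exchanging them yields the opposite order.\<close>

lemma second_difference_mean_value: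
  fixes f :: "'a::real_normed_vector \<Rightarrow> real"
  assumes f: "\<And>z. z \<in> U \<Longrightarrow> (f has_derivative f' z) (at z)"
    and f'': "\<And>z. z \<in> U \<Longrightarrow> ((\<lambda>z. f' z u) has_derivative f'' z) (at z)"
    and h: "h > 0"
    and sub: "\<And>s t. \<lbrakk>0 \<le> s; s \<le> h; 0 \<le> t; t \<le> h\<rbrakk> \<Longrightarrow> x + s *\<^sub>R u + t *\<^sub>R v \<in> U"
  obtains s t where "0 < s" "s < h" "0 < t" "t < h"
    "f (x + h *\<^sub>R u + h *\<^sub>R v) - f (x + h *\<^sub>R u) - (f (x + h *\<^sub>R v) - f x)
      = h * h * f'' (x + s *\<^sub>R u + t *\<^sub>R v) v"
proof -
  define p where "p s = f (x + s *\<^sub>R u + h *\<^sub>R v) - f (x + s *\<^sub>R u)" for s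
  have dp: "(p has_real_derivative f' (x + s *\<^sub>R u + h *\<^sub>R v) u - f' (x + s *\<^sub>R u) u) (at s)"
    if "0 \<le> s" "s \<le> h" for s
  proof -
    have m: "x + s *\<^sub>R u + h *\<^sub>R v \<in> U" "x + s *\<^sub>R u \<in> U"
      using sub[of s h] sub[of s 0] that h by auto
    have 1: "((\<lambda>s. x + s *\<^sub>R u + h *\<^sub>R v) has_derivative (\<lambda>r. r *\<^sub>R u)) (at s)"
      "((\<lambda>s. x + s *\<^sub>R u) has_derivative (\<lambda>r. r *\<^sub>R u)) (at s)"
      by (auto intro!: derivative_eq_intros)
    have "(p has_derivative (\<lambda>r. f' (x + s *\<^sub>R u + h *\<^sub>R v) (r *\<^sub>R u) - f' (x + s *\<^sub>R u) (r *\<^sub>R u))) (at s)"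
      unfolding p_def
      using diff_chain_at[OF 1(1) f[OF m(1)]] diff_chain_at[OF 1(2) f[OF m(2)]]
      by (intro has_derivative_diff) (simp_all add: o_def)
    moreover have "(\<lambda>r. f' (x + s *\<^sub>R u + h *\<^sub>R v) (r *\<^sub>R u) - f' (x + s *\<^sub>R u) (r *\<^sub>R u))
        = (*) (f' (x + s *\<^sub>R u + h *\<^sub>R v) u - f' (x + s *\<^sub>R u) u)"
      using has_derivative_linear[OF f[OF m(1)]] has_derivative_linear[OF f[OF m(2)]]
      by (simp add: linear_cmul fun_eq_iff algebra_simps)
    ultimately show ?thesis
      by (simp add: has_field_derivative_def)
  qed
  obtain s where s: "0 < s" "s < h"
    "p h - p 0 = (h - 0) * (f' (x + s *\<^sub>R u + h *\<^sub>R v) u - f' (x + s *\<^sub>R u) u)"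
    using MVT2[OF h dp] by auto
  define q where "q t = f' (x + s *\<^sub>R u + t *\<^sub>R v) u" for t
  have dq: "(q has_real_derivative f'' (x + s *\<^sub>R u + t *\<^sub>R v) v) (at t)" if "0 \<le> t" "t \<le> h" for t
  proof -
    have m: "x + s *\<^sub>R u + t *\<^sub>R v \<in> U"
      using sub[of s t] that s by auto
    have 1: "((\<lambda>t. x + s *\<^sub>R u + t *\<^sub>R v) has_derivative (\<lambda>r. r *\<^sub>R v)) (at t)"
      by (auto intro!: derivative_eq_intros)
    have "(q has_derivative (\<lambda>r. f'' (x + s *\<^sub>R u + t *\<^sub>R v) (r *\<^sub>R v))) (at t)"
      unfolding q_def using diff_chain_at[OF 1 f''[OF m]] by (simp add: o_def)
    moreover have "(\<lambda>r. f'' (x + s *\<^sub>R u + t *\<^sub>R v) (r *\<^sub>R v)) = (*) (f'' (x + s *\<^sub>R u + t *\<^sub>R v) v)"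
      using has_derivative_linear[OF f''[OF m]] by (simp add: linear_cmul fun_eq_iff)
    ultimately show ?thesis
      by (simp add: has_field_derivative_def)
  qed
  obtain t where t: "0 < t" "t < h" "q h - q 0 = (h - 0) * f'' (x + s *\<^sub>R u + t *\<^sub>R v) v"
    using MVT2[OF h dq] by auto
  show ?thesis
    by (rule that[OF s(1,2) t(1,2)]) (use s(3) t(3) in \<open>simp add: p_def q_def algebra_simps\<close>)
qed

text \<open>Applying the mean value theorem to the second difference in either order gives the two mixed
  derivatives at points tending to \<open>x\<close>.\<close>

lemma smooth_on_second_derivative_symmetric:
  fixes f :: "'a::real_normed_vector \<Rightarrow> real"
  assumes U: "open U" "x \<in> U" and f: "smooth_on U f"
  shows "frechet_derivative (\<lambda>y. frechet_derivative f (at y) u) (at x) v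
       = frechet_derivative (\<lambda>y. frechet_derivative f (at y) v) (at x) u"
proof (rule ccontr)
  define D where "D u v z = frechet_derivative (\<lambda>y. frechet_derivative f (at y) u) (at z) v" for u v z
  assume "\<not> ?thesis"
  then have ne: "D u v x \<noteq> D v u x" by (simp add: D_def)
  \<comment> \<open>Half the gap, so that values within \<open>e\<close> of the two mixed
    derivatives cannot be equal.\<close>
  define e where "e = \<bar>D u v x - D v u x\<bar> / 2"
  have e: "e > 0" using ne by (simp add: e_def)
  have "smooth_on U (D u v)" for u v
    unfolding D_def[abs_def] by (intro smooth_on_frechet_derivative f)
  then have c: "isCont (D u v) x" for u v
    using smooth_on_imp_continuous_on U by (metis continuous_on_eq_continuous_at)
  have 1: "\<exists>d>0. \<forall>z. dist z x < d \<longrightarrow> dist (D u v z) (D u v x) < e" for u v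
    using c[of u v] e unfolding continuous_at_eps_delta by blast
  obtain d1 where d1: "d1 > 0" "\<And>z. dist z x < d1 \<Longrightarrow> dist (D u v z) (D u v x) < e" 
    using 1 by blast
  obtain d2 where d2: "d2 > 0" "\<And>z. dist z x < d2 \<Longrightarrow> dist (D v u z) (D v u x) < e" 
    using 1 by blast
  obtain d3 where d3: "d3 > 0" "ball x d3 \<subseteq> U" using U open_contains_ball by blast
  define d where "d = min d1 (min d2 d3)"
  have d: "d > 0" using d1 d2 d3 by (simp add: d_def)
  \<comment> \<open>The parallelogram with sides \<open>h *\<^sub>R u\<close> and
    \<open>h *\<^sub>R v\<close> stays within distance \<open>d\<close> of \<open>x\<close>; the
    summand 1 keeps the denominator positive if both vectors vanish.\<close>
  define h where "h = d / (2 * (norm u + norm v + 1))"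
  have h: "h > 0" using d by (simp add: h_def add_nonneg_pos)
  have bound: "norm u + norm v < 2 * (norm u + norm v + 1)"
    using norm_ge_zero[of u] norm_ge_zero[of v] unfolding distrib_left by linarith
  have near: "dist (x + s *\<^sub>R a + t *\<^sub>R b) x < d"
    if "0 \<le> s" "s \<le> h" "0 \<le> t" "t \<le> h" "(a = u \<and> b = v) \<or> (a = v \<and> b = u)" for s t a b
  proof -
    have "norm (s *\<^sub>R a + t *\<^sub>R b) \<le> s * norm a + t * norm b"
      using that by (intro norm_triangle_le) simp
    also have "\<dots> \<le> h * norm a + h * norm b"
      using that by (intro add_mono mult_right_mono) auto
    also have "\<dots> = h * (norm u + norm v)" using that(5) by (auto simp: algebra_simps)
    also have "\<dots> < h * (2 * (norm u + norm v + 1))"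
      by (rule mult_strict_left_mono[OF bound h])
    also have "\<dots> = d" by (simp add: h_def) (smt (verit) norm_ge_zero)
    finally show ?thesis by (simp add: dist_norm add.assoc)
  qed
  have fd: "(f has_derivative frechet_derivative f (at z)) (at z)" if "z \<in> U" for z
    using f that by (rule smooth_on_derivative)
  have fdd: "((\<lambda>z. frechet_derivative f (at z) a) has_derivative (\<lambda>b. D a b z)) (at z)" if "z \<in> U" for z a
    unfolding D_def using smooth_on_frechet_derivative[OF f] that by (rule smooth_on_derivative)
  have ball: "ball x d \<subseteq> U" using d3 by (auto simp: d_def)
  obtain s t where st: "0 < s" "s < h" "0 < t" "t < h"
    "f (x + h *\<^sub>R u + h *\<^sub>R v) - f (x + h *\<^sub>R u) - (f (x + h *\<^sub>R v) - f x)
      = h * h * D u v (x + s *\<^sub>R u + t *\<^sub>R v)"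
    by (rule second_difference_mean_value[where U = U and x = x and u = u and v = v, OF fd fdd h])
      (use near ball in \<open>auto simp: dist_commute mem_ball subset_iff\<close>)
  obtain s' t' where st': "0 < s'" "s' < h" "0 < t'" "t' < h"
    "f (x + h *\<^sub>R v + h *\<^sub>R u) - f (x + h *\<^sub>R v) - (f (x + h *\<^sub>R u) - f x)
      = h * h * D v u (x + s' *\<^sub>R v + t' *\<^sub>R u)"
    by (rule second_difference_mean_value[where U = U and x = x and u = v and v = u, OF fd fdd h])
      (use near ball in \<open>auto simp: dist_commute mem_ball subset_iff\<close>)
  have "h * h * D u v (x + s *\<^sub>R u + t *\<^sub>R v) = h * h * D v u (x + s' *\<^sub>R v + t' *\<^sub>R u)"
    using st(5) st'(5) by (simp add: algebra_simps)
  then have "D u v (x + s *\<^sub>R u + t *\<^sub>R v) = D v u (x + s' *\<^sub>R v + t' *\<^sub>R u)"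
    using h by simp
  moreover have "dist (D u v (x + s *\<^sub>R u + t *\<^sub>R v)) (D u v x) < e"
    by (rule d1) (use near[of s t u v] st in \<open>auto simp: d_def\<close>)
  moreover have "dist (D v u (x + s' *\<^sub>R v + t' *\<^sub>R u)) (D v u x) < e"
    by (rule d2) (use near[of s' t' v u] st' in \<open>auto simp: d_def\<close>)
  ultimately have "dist (D u v x) (D v u x) < e + e"
    by (metis dist_triangle_less_add dist_commute)
  then show False
    by (simp add: e_def dist_real_def)
qed

section \<open>Matrices and Christoffel symbols\<close>

lemma invertible_matrix_inv:
  fixes A :: "'a::semiring_1^'n^'m"
  assumes "invertible A"
  shows "A ** matrix_inv A = mat 1" "matrix_inv A ** A = mat 1"
  using someI_ex[OF assms[unfolded invertible_def]] unfolding matrix_inv_def by auto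

lemma matrix_inv_unique:
  fixes A :: "real^'n^'n"
  assumes "A ** B = mat 1"
  shows "matrix_inv A = B"
proof -
  have "B ** A = mat 1" using assms matrix_left_right_inverse by blast
  then have "invertible A" using assms invertible_def by blast
  from invertible_matrix_inv(2)[OF this] show ?thesis
    using assms by (metis matrix_mul_assoc matrix_mul_lid matrix_mul_rid)
qed

lemma matrix_inv_2:
  fixes A :: "real^2^2"
  assumes "det A \<noteq> 0"
  shows "matrix_inv A $ 1 $ 1 = A $ 2 $ 2 / det A" "matrix_inv A $ 1 $ 2 = - A $ 1 $ 2 / det A"
    "matrix_inv A $ 2 $ 1 = - A $ 2 $ 1 / det A" "matrix_inv A $ 2 $ 2 = A $ 1 $ 1 / det A"
proof -
  define d where "d = det A"
  have d: "d \<noteq> 0" "A $ 1 $ 1 * A $ 2 $ 2 - A $ 1 $ 2 * A $ 2 $ 1 = d"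
    using assms by (simp_all add: d_def det_2)
  have "matrix_inv A = vector [vector [A $ 2 $ 2 / d, - A $ 1 $ 2 / d], vector [- A $ 2 $ 1 / d, A $ 1 $ 1 / d]]"
    by (rule matrix_inv_unique)
      (use d in \<open>simp add: vec_eq_iff forall_2 matrix_matrix_mult_def sum_2 mat_def divide_simps; simp add: mult.commute\<close>)
  then show "matrix_inv A $ 1 $ 1 = A $ 2 $ 2 / det A" "matrix_inv A $ 1 $ 2 = - A $ 1 $ 2 / det A"
    "matrix_inv A $ 2 $ 1 = - A $ 2 $ 1 / det A" "matrix_inv A $ 2 $ 2 = A $ 1 $ 1 / det A"
    by (simp_all add: d_def)
qed

lemma linear_real2:
  fixes L :: "real ^ 2 \<Rightarrow> 'a::real_vector"
  assumes "linear L"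
  shows "L v = v $ 1 *\<^sub>R L (axis 1 1) + v $ 2 *\<^sub>R L (axis 2 1)"
proof -
  have "v = v $ 1 *\<^sub>R axis 1 1 + v $ 2 *\<^sub>R axis 2 1"
    by (simp add: vec_eq_iff forall_2 axis_def)
  then have "L v = L (v $ 1 *\<^sub>R axis 1 1 + v $ 2 *\<^sub>R axis 2 1)" by simp
  then show ?thesis using assms by (simp add: linear_add linear_cmul)
qed

lemma mform_2:
  fixes M :: "real ^ 2 ^ 2"
  shows "mform M v w = M $ 1 $ 1 * v $ 1 * w $ 1 + M $ 1 $ 2 * v $ 1 * w $ 2
     + M $ 2 $ 1 * v $ 2 * w $ 1 + M $ 2 $ 2 * v $ 2 * w $ 2"
  by (simp add: mform_def inner_vec_def matrix_vector_mult_def sum_2 algebra_simps)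

lemma partial_nth:
  assumes "f differentiable (at x)"
  shows "partial i (\<lambda>y. f y $ j) x = partial i f x $ j"
proof -
  have "(f has_derivative frechet_derivative f (at x)) (at x)"
    using assms frechet_derivative_works by blast
  then have "((\<lambda>y. f y $ j) has_derivative (\<lambda>v. frechet_derivative f (at x) v $ j)) (at x)"
    by (rule bounded_linear.has_derivative[OF bounded_linear_vec_nth])
  then show ?thesis
    by (simp add: partial_def frechet_derivative_at[symmetric])
qed

lemma differentiable_nth: "f differentiable (at x) \<Longrightarrow> (\<lambda>y. f y $ j) differentiable (at x)"
  unfolding differentiable_def using bounded_linear.has_derivative[OF bounded_linear_vec_nth] by blast

lemma smooth_on_differentiable: "smooth_on U f \<Longrightarrow> x \<in> U \<Longrightarrow> f differentiable (at x)"
  by (meson smooth_on_derivative differentiable_def)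

lemma smooth_on_partial: "smooth_on U f \<Longrightarrow> smooth_on U (partial i f)"
  unfolding partial_def[abs_def] by (rule smooth_on_frechet_derivative)

lemma partial_commute:
  fixes f :: "real ^ 'n \<Rightarrow> real"
  assumes "open U" "x \<in> U" "smooth_on U f"
  shows "partial i (partial j f) x = partial j (partial i f) x"
  unfolding partial_def[abs_def] by (rule smooth_on_second_derivative_symmetric[OF assms])

text \<open>Multiplying by the metric cancels the inverse matrix in \<open>christoffel\<close>; what
  remains is the Koszul formula for coordinate fields.\<close>

lemma christoffel_lower:
  fixes g :: "real ^ 'n \<Rightarrow> real ^ 'n ^ 'n"
  assumes "invertible (g x)"
  shows "(\<Sum>k\<in>UNIV. g x $ l $ k * christoffel g k i j x)
     = (partial i (\<lambda>y. g y $ j $ l) x + partial j (\<lambda>y. g y $ i $ l) x - partial l (\<lambda>y. g y $ i $ j) x) / 2"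
proof -
  define A where "A = (\<chi> l. (partial i (\<lambda>y. g y $ j $ l) x + partial j (\<lambda>y. g y $ i $ l) x - partial l (\<lambda>y. g y $ i $ j) x) / 2)"
  have "christoffel g k i j x = (matrix_inv (g x) *v A) $ k" for k
    by (simp add: christoffel_def matrix_vector_mult_def A_def sum_divide_distrib)
  then have "(\<Sum>k\<in>UNIV. g x $ l $ k * christoffel g k i j x) = (g x *v (matrix_inv (g x) *v A)) $ l"
    by (simp add: matrix_vector_mult_def[of "g x"])
  also have "g x *v (matrix_inv (g x) *v A) = A"
    by (simp add: matrix_vector_mul_assoc invertible_matrix_inv[OF assms])
  finally show ?thesis by (simp add: A_def)
qed

section \<open>Surface metrics in coordinates\<close>

locale surface_metric =
  fixes U :: "(real ^ 2) set" and g :: "real ^ 2 \<Rightarrow> real ^ 2 ^ 2"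
  assumes open_U: "open U" and smooth_g: "smooth_on U g"
    and sym_g: "\<And>x. x \<in> U \<Longrightarrow> transpose (g x) = g x"
    and pos_g: "\<And>x v. x \<in> U \<Longrightarrow> v \<noteq> 0 \<Longrightarrow> mform (g x) v v > 0"
begin

lemma sym: "x \<in> U \<Longrightarrow> g x $ 2 $ 1 = g x $ 1 $ 2"
  using arg_cong[OF sym_g, of x "\<lambda>A. A $ 1 $ 2"] by (simp add: transpose_def)

lemma det_pos: assumes "x \<in> U" shows "det (g x) > 0"
proof -
  have a: "g x $ 1 $ 1 > 0"
    using pos_g[OF assms, of "axis 1 1"] by (simp add: mform_2 axis_eq_0_iff) (simp add: axis_def)
  \<comment> \<open>This vector is orthogonal to the first axis; its square length is
    \<open>g x $ 1 $ 1\<close> times the determinant.\<close>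
  have "mform (g x) (vector [- g x $ 1 $ 2, g x $ 1 $ 1]) (vector [- g x $ 1 $ 2, g x $ 1 $ 1]) > 0"
    using a by (intro pos_g[OF assms]) (simp add: vec_eq_iff forall_2)
  then have "g x $ 1 $ 1 * det (g x) > 0"
    using sym[OF assms] by (simp add: mform_2 det_2 algebra_simps)
  then show ?thesis using a by (simp add: zero_less_mult_iff)
qed

lemma invertible: "x \<in> U \<Longrightarrow> invertible (g x)"
  using det_pos[of x] by (simp add: invertible_det_nz)

lemma smooth_entry: "smooth_on U (\<lambda>x. g x $ i $ j)"
  by (intro smooth_on_nth open_U smooth_g)

lemma partial_sym:
  assumes "x \<in> U" shows "partial i (\<lambda>y. g y $ 2 $ 1) x = partial i (\<lambda>y. g y $ 1 $ 2) x"
proof -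
  have "((\<lambda>y. g y $ 2 $ 1) has_derivative frechet_derivative (\<lambda>y. g y $ 1 $ 2) (at x)) (at x)"
    by (rule has_derivative_transform_within_open[OF smooth_on_derivative[OF smooth_entry assms] open_U assms])
      (simp add: sym)
  then show ?thesis
    by (simp add: partial_def frechet_derivative_at[symmetric])
qed

lemma smooth_matrix_inv: "smooth_on U (\<lambda>x. matrix_inv (g x) $ i $ j)"
proof -
  have d: "smooth_on U (\<lambda>x. det (g x))"
    unfolding det_2 by (intro smooth_on_diff smooth_on_mult smooth_entry open_U)
  have nz: "\<forall>x\<in>U. det (g x) \<noteq> 0"
    using det_pos by fastforce
  have "smooth_on U (\<lambda>x. if i = 1 then if j = 1 then g x $ 2 $ 2 / det (g x) else (0 - g x $ 1 $ 2) / det (g x)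
      else if j = 1 then (0 - g x $ 2 $ 1) / det (g x) else g x $ 1 $ 1 / det (g x))"
    using nz
    by (cases "i = 1"; cases "j = 1"; simp only: if_True if_False simp_thms)
      (intro smooth_on_divide smooth_on_diff smooth_on_const smooth_entry d open_U; blast)+
  then show ?thesis
    by (rule smooth_on_cong[OF open_U, rotated])
      (use exhaust_2[of i] exhaust_2[of j] det_pos in \<open>fastforce simp: matrix_inv_2\<close>)
qed

lemma smooth_christoffel: "smooth_on U (christoffel g k i j)"
proof -
  have "smooth_on U (\<lambda>x. (\<Sum>l\<in>UNIV. matrix_inv (g x) $ k $ l *
        (partial i (\<lambda>y. g y $ j $ l) x + partial j (\<lambda>y. g y $ i $ l) x
         - partial l (\<lambda>y. g y $ i $ j) x)) * (1 / 2))"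
    by (intro smooth_on_mult smooth_on_sum smooth_on_diff smooth_on_add smooth_on_const smooth_matrix_inv
        smooth_on_partial smooth_entry open_U)
  then show ?thesis unfolding christoffel_def[abs_def] by simp
qed

section \<open>Riemann and Ricci curvature of a surface metric\<close>

lemma metric_compatible:
  assumes "x \<in> U"
  shows "partial j (\<lambda>y. g y $ k $ l) x
      = (\<Sum>m\<in>UNIV. g x $ l $ m * christoffel g m j k x) + (\<Sum>m\<in>UNIV. g x $ k $ m * christoffel g m j l x)"
  unfolding christoffel_lower[where g = g, OF invertible[OF assms]]
  using exhaust_2[of j] exhaust_2[of k] exhaust_2[of l] by (auto simp: partial_sym[OF assms] field_simps)

text \<open>Differentiating \<open>metric_compatible\<close> once more allows mixed second
  derivatives of the metric to be compared through Christoffel symbols.\<close>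

lemma partial_metric_compatible:
  assumes "x \<in> U"
  shows "partial i (partial j (\<lambda>y. g y $ k $ l)) x
      = (\<Sum>m\<in>UNIV. partial i (\<lambda>y. g y $ l $ m) x * christoffel g m j k x + g x $ l $ m * partial i (christoffel g m j k) x)
      + (\<Sum>m\<in>UNIV. partial i (\<lambda>y. g y $ k $ m) x * christoffel g m j l x + g x $ k $ m * partial i (christoffel g m j l) x)"
proof -
  let ?D = "\<lambda>f. frechet_derivative f (at x)"
  let ?E = "\<lambda>y. (\<Sum>m\<in>UNIV. g y $ l $ m * christoffel g m j k y) + (\<Sum>m\<in>UNIV. g y $ k $ m * christoffel g m j l y)"
  note d = smooth_on_derivative[OF smooth_entry assms] smooth_on_derivative[OF smooth_christoffel assms]
  have 1: "(?E has_derivative (\<lambda>v.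
       (\<Sum>m\<in>UNIV. g x $ l $ m * ?D (christoffel g m j k) v + ?D (\<lambda>y. g y $ l $ m) v * christoffel g m j k x)
     + (\<Sum>m\<in>UNIV. g x $ k $ m * ?D (christoffel g m j l) v + ?D (\<lambda>y. g y $ k $ m) v * christoffel g m j l x))) (at x)"
    by (intro has_derivative_add has_derivative_sum has_derivative_mult d)
  have "(partial j (\<lambda>y. g y $ k $ l) has_derivative (\<lambda>v.
       (\<Sum>m\<in>UNIV. g x $ l $ m * ?D (christoffel g m j k) v + ?D (\<lambda>y. g y $ l $ m) v * christoffel g m j k x)
     + (\<Sum>m\<in>UNIV. g x $ k $ m * ?D (christoffel g m j l) v + ?D (\<lambda>y. g y $ k $ m) v * christoffel g m j l x))) (at x)"
    by (rule has_derivative_transform_within_open[OF 1 open_U assms]) (simp add: metric_compatible)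
  from fun_cong[OF frechet_derivative_at[OF this], of "axis i 1"] show ?thesis
    by (simp add: partial_def[of i] add.commute)
qed

text \<open>Commutation of the second derivatives of \<open>g\<close>, once these are expressed
  through Christoffel symbols, is exactly this antisymmetry in \<open>k\<close> and
  \<open>l\<close>.\<close>

lemma riemann_lower_antisym:
  assumes "x \<in> U"
  shows "(\<Sum>m\<in>UNIV. g x $ l $ m * riemann g m k i j x) + (\<Sum>m\<in>UNIV. g x $ k $ m * riemann g m l i j x) = 0"
proof -
  have "partial i (partial j (\<lambda>y. g y $ k $ l)) x = partial j (partial i (\<lambda>y. g y $ k $ l)) x"
    by (rule partial_commute[OF open_U assms smooth_entry])
  then show ?thesis
    unfolding partial_metric_compatible[OF assms] unfolding metric_compatible[OF assms] riemann_def sum_2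
    using exhaust_2[of k] exhaust_2[of l] sym[OF assms]
    by (elim disjE; simp) (simp add: algebra_simps)+
qed

text \<open>In dimension two, antisymmetry in both index pairs leaves a single curvature component,
  so the Ricci form is a multiple of the metric.\<close>

lemma ricci_eq_gauss_curvature:
  assumes "x \<in> U"
  shows "ricci g x v v = gauss_curvature_local g x * mform (g x) v v"
proof -
  have z: "riemann g m k i i x = 0" for m k i
    by (simp add: riemann_def)
  have a: "riemann g m k 2 1 x = - riemann g m k 1 2 x" for m k
    by (simp add: riemann_def sum_2)
  define r where "r m k = riemann g m k 1 2 x" for m k
  have R: "(\<Sum>m\<in>UNIV. g x $ l $ m * r m k) + (\<Sum>m\<in>UNIV. g x $ k $ m * r m l) = 0" for k l
    unfolding r_def by (rule riemann_lower_antisym[OF assms])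
  define p q s where "p = g x $ 1 $ 1" "q = g x $ 1 $ 2" "s = g x $ 2 $ 2"
  note pqs = p_q_s_def
  have 1: "p * r 1 1 + q * r 2 1 = 0" "q * r 1 2 + s * r 2 2 = 0" "p * r 1 2 + q * r 2 2 + q * r 1 1 + s * r 2 1 = 0"
    using R[of 1 1] R[of 2 2] R[of 1 2] sym[OF assms] by (simp_all add: sum_2 pqs mult.commute)
  have D: "p * s - q * q > 0" using det_pos[OF assms] sym[OF assms] by (simp add: det_2 pqs)
  have ric: "ricci g x v v = - r 2 1 * v $ 1 * v $ 1 - r 2 2 * v $ 1 * v $ 2 + r 1 1 * v $ 2 * v $ 1 + r 1 2 * v $ 2 * v $ 2"
    by (simp add: ricci_def sum_2 z a r_def[symmetric] algebra_simps)
  define K where "K = gauss_curvature_local g x"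
  have K: "K * (p * s - q * q) = p * r 1 2 + q * r 2 2"
    using D sym[OF assms] by (simp add: K_def gauss_curvature_local_def det_2 sum_2 pqs r_def)
  \<comment> \<open>Three equations from antisymmetry and the definition of \<open>K\<close>
    determine the four numbers \<open>r m k\<close>; scaling by the determinant avoids
    division.\<close>
  have "(p * s - q * q) * (- r 2 1) = (p * s - q * q) * (K * p)" "(p * s - q * q) * r 1 2 = (p * s - q * q) * (K * s)"
    "(p * s - q * q) * (- r 2 2) = (p * s - q * q) * (K * q)" "(p * s - q * q) * r 1 1 = (p * s - q * q) * (K * q)"
    using 1 K by algebra+
  then have "- r 2 1 = K * p" "r 1 2 = K * s" "- r 2 2 = K * q" "r 1 1 = K * q"
    using D by (simp_all only: mult_cancel_left) auto
  then show ?thesis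
    unfolding ric mform_2 sym[OF assms] K_def[symmetric] pqs[symmetric] by algebra
qed

end

section \<open>Bilinear forms under linear maps, covariant acceleration and orthogonal
  frames\<close>

lemma matrix_apply:
  fixes L :: "real ^ 'n \<Rightarrow> real ^ 'm"
  assumes "linear L"
  shows "matrix L *v v = L v"
  by (rule fun_cong[OF matrix_vector_mul(2)[OF assms]])

lemma mform_pullback:
  assumes "linear L"
  shows "mform (transpose (matrix L) ** M ** matrix L) v w = mform M (L v) (L w)"
proof -
  have L: "matrix L *v v = L v" for v by (rule matrix_apply[OF assms])
  have "v \<bullet> ((M *v L w) v* matrix L) = L v \<bullet> (M *v L w)"
    by (metis L dot_lmul_matrix inner_commute)
  then show ?thesis
    unfolding mform_def matrix_vector_mul_assoc[symmetric] transpose_matrix_vector L .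
qed

lemma has_derivative_nth: "(f has_derivative f') F \<Longrightarrow> ((\<lambda>x. f x $ i) has_derivative (\<lambda>h. f' h $ i)) F"
  by (rule bounded_linear.has_derivative[OF bounded_linear_vec_nth])

lemma has_derivative_mform:
  fixes M :: "'a::real_normed_vector \<Rightarrow> real ^ 2 ^ 2"
  assumes "(M has_derivative M') (at x)" "(v has_derivative v') (at x)" "(w has_derivative w') (at x)"
  shows "((\<lambda>x. mform (M x) (v x) (w x)) has_derivative
     (\<lambda>h. mform (M' h) (v x) (w x) + mform (M x) (v' h) (w x) + mform (M x) (v x) (w' h))) (at x)"
  unfolding mform_2
  by (rule derivative_eq_intros refl has_derivative_nth assms)+ (simp add: fun_eq_iff algebra_simps)

text \<open>Velocity and second derivative are free arguments, so the behaviour under coordinate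
  changes becomes an identity at a point, without reference to a curve.\<close>

definition covariant_acceleration ::
  "(real ^ 'n \<Rightarrow> real ^ 'n ^ 'n) \<Rightarrow> real ^ 'n::finite \<Rightarrow> real ^ 'n \<Rightarrow> real ^ 'n \<Rightarrow> real ^ 'n" where
  "covariant_acceleration g x v a =
     (\<chi> k. a $ k + (\<Sum>i\<in>UNIV. \<Sum>j\<in>UNIV. christoffel g k i j x * v $ i * v $ j))"

context surface_metric
begin

lemma partial_entry:
  assumes "x \<in> U"
  shows "partial i (\<lambda>y. g y $ j $ l) x = frechet_derivative g (at x) (axis i 1) $ j $ l"
proof -
  have "g differentiable (at x)" by (rule smooth_on_differentiable[OF smooth_g assms])
  then show ?thesis
    using partial_nth[of "\<lambda>y. g y $ j"] partial_nth[of g] differentiable_nth[of g]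
    by (simp add: partial_def)
qed

lemma frechet_entry:
  assumes "x \<in> U"
  shows "frechet_derivative g (at x) v $ j $ l = v $ 1 * partial 1 (\<lambda>y. g y $ j $ l) x + v $ 2 * partial 2 (\<lambda>y. g y $ j $ l) x"
  unfolding partial_entry[OF assms]
  by (subst linear_real2[OF has_derivative_linear[OF smooth_on_derivative[OF smooth_g assms]]]) simp

text \<open>Lowering the index with the metric removes the inverse matrix from the Christoffel symbols, and
  what remains is the Euler--Lagrange expression of the energy. Its behaviour under a change of
  coordinates follows from differentiating the pullback relation.\<close>

lemma mform_covariant_acceleration:
  assumes "x \<in> U"
  shows "mform (g x) (covariant_acceleration g x v a) z
     = mform (g x) a z + mform (frechet_derivative g (at x) v) v z - mform (frechet_derivative g (at x) z) v v / 2"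
proof -
  define P where "P i j l = partial i (\<lambda>y. g y $ j $ l) x" for i j l
  define C where "C k i j = christoffel g k i j x" for k i j
  have L: "g x $ l $ 1 * C 1 i j + g x $ l $ 2 * C 2 i j = (P i j l + P j i l - P l i j) / 2" for l i j
    using christoffel_lower[where g = g, OF invertible[OF assms], of l i j] by (simp add: sum_2 P_def C_def)
  have "mform (g x) (covariant_acceleration g x v a) z = mform (g x) a z
     + (\<Sum>l\<in>UNIV. \<Sum>i\<in>UNIV. \<Sum>j\<in>UNIV. z $ l * v $ i * v $ j * (g x $ l $ 1 * C 1 i j + g x $ l $ 2 * C 2 i j))"
    by (simp add: mform_2 covariant_acceleration_def sum_2 C_def[symmetric] sym[OF assms] algebra_simps)
  also have "\<dots> = mform (g x) a z + mform (frechet_derivative g (at x) v) v z - mform (frechet_derivative g (at x) z) v v / 2"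
    unfolding L mform_2 frechet_entry[OF assms] P_def[symmetric] sum_2
    by (simp add: partial_sym[OF assms, folded P_def] field_simps)
  finally show ?thesis .
qed

lemma nondegenerate:
  assumes "x \<in> U" "\<And>z. mform (g x) u z = mform (g x) w z"
  shows "u = w"
proof (rule ccontr)
  assume "u \<noteq> w"
  then have "mform (g x) (u - w) (u - w) > 0" using pos_g[OF assms(1)] by simp
  moreover have "mform (g x) (u - w) z = mform (g x) u z - mform (g x) w z" for z
    by (simp add: mform_2 algebra_simps)
  ultimately show False using assms(2) by simp
qed

lemma rot_orthogonal:
  assumes "x \<in> U"
  shows "mform (g x) (rot (g x) *v v) v = 0" "mform (g x) (rot (g x) *v v) (rot (g x) *v v) = mform (g x) v v"
  using rot_characterization(1,2)[OF sym_g[OF assms] det_pos[OF assms]] by auto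

text \<open>\<open>v\<close> and its rotation are orthonormal and span the plane, so a vector
  orthogonal to \<open>v\<close> equals its projection to the rotated vector.\<close>

lemma orthogonal_eq_rot:
  assumes x: "x \<in> U" and v: "mform (g x) v v = 1" and a: "mform (g x) a v = 0"
  shows "a = mform (g x) a (rot (g x) *v v) *\<^sub>R (rot (g x) *v v)"
proof -
  define n where "n = rot (g x) *v v"
  have n: "mform (g x) n v = 0" "mform (g x) n n = 1"
    using rot_orthogonal[OF x, of v] v by (simp_all add: n_def)
  define D where "D = v $ 1 * n $ 2 - v $ 2 * n $ 1"
  have "D \<noteq> 0"
  proof
    assume "D = 0"
    \<comment> \<open>Gram's identity: the squared determinant of the pair, times
      \<open>det (g x)\<close>, is the determinant of its inner products.\<close>
    moreover have "(v $ 1 * n $ 2 - v $ 2 * n $ 1)\<^sup>2 * det (g x) = mform (g x) v v * mform (g x) n n - (mform (g x) n v)\<^sup>2"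
      by (simp add: mform_2 det_2 sym[OF x] power2_eq_square algebra_simps)
    ultimately show False using v n by (simp add: D_def)
  qed
  have "mform (g x) a z = mform (g x) (mform (g x) a n *\<^sub>R n) z" for z
  proof -
    \<comment> \<open>Coordinates of \<open>z\<close> in the basis \<open>v\<close>,
      \<open>n\<close> by Cramer's rule.\<close>
    define p q where "p = (z $ 1 * n $ 2 - z $ 2 * n $ 1) / D" and "q = (v $ 1 * z $ 2 - v $ 2 * z $ 1) / D"
    have "z $ 1 * D = (z $ 1 * n $ 2 - z $ 2 * n $ 1) * v $ 1 + (v $ 1 * z $ 2 - v $ 2 * z $ 1) * n $ 1"
      "z $ 2 * D = (z $ 1 * n $ 2 - z $ 2 * n $ 1) * v $ 2 + (v $ 1 * z $ 2 - v $ 2 * z $ 1) * n $ 2"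
      by (simp_all add: D_def algebra_simps)
    then have z: "z = p *\<^sub>R v + q *\<^sub>R n"
      using \<open>D \<noteq> 0\<close> by (simp add: vec_eq_iff forall_2 p_def q_def) (simp add: divide_simps)
    have "mform (g x) w z = p * mform (g x) w v + q * mform (g x) w n" for w
      unfolding z by (simp add: mform_2 algebra_simps)
    moreover have "mform (g x) (c *\<^sub>R n) w = c * mform (g x) n w" for c w
      by (simp add: mform_2 algebra_simps)
    ultimately show ?thesis using n a by simp
  qed
  then show ?thesis
    unfolding n_def[symmetric] by (rule nondegenerate[OF x])
qed

end

section \<open>Isometries of surfaces\<close>

text \<open>A local isometry in coordinates, with the pullback written as in
  \<open>riemannian_manifold\<close>, so that transitions between charts are instances.\<close>

locale surface_isometry = src: surface_metric U g + tgt: surface_metric U' g'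
  for U g U' g' +
  fixes T :: "real ^ 2 \<Rightarrow> real ^ 2"
  assumes smooth_T: "smooth_on U T" and T_into: "\<And>x. x \<in> U \<Longrightarrow> T x \<in> U'"
    and pullback: "\<And>x. x \<in> U \<Longrightarrow>
      g x = transpose (matrix (frechet_derivative T (at x))) ** g' (T x) ** matrix (frechet_derivative T (at x))"
begin

lemma has_derivative_T: "x \<in> U \<Longrightarrow> (T has_derivative frechet_derivative T (at x)) (at x)"
  by (rule smooth_on_derivative[OF smooth_T])

lemma linear_T: "x \<in> U \<Longrightarrow> linear (frechet_derivative T (at x))"
  using has_derivative_T has_derivative_linear by blast

lemma mform_T: "x \<in> U \<Longrightarrow> mform (g x) v w = mform (g' (T x)) (frechet_derivative T (at x) v) (frechet_derivative T (at x) w)"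
  by (simp add: pullback mform_pullback linear_T)

lemma det_T: "x \<in> U \<Longrightarrow> det (g x) = (det (matrix (frechet_derivative T (at x))))\<^sup>2 * det (g' (T x))"
  by (simp add: pullback det_mul det_transpose power2_eq_square)

lemma surj_T: assumes "x \<in> U" obtains w where "frechet_derivative T (at x) w = v"
proof -
  have "det (matrix (frechet_derivative T (at x))) \<noteq> 0"
    using det_T[OF assms] src.det_pos[OF assms] by auto
  then obtain A where "matrix (frechet_derivative T (at x)) ** A = mat 1"
    unfolding invertible_det_nz[symmetric] invertible_def by blast
  then have "matrix (frechet_derivative T (at x)) *v (A *v v) = v"
    by (simp add: matrix_vector_mul_assoc)
  then have "frechet_derivative T (at x) (A *v v) = v"
    by (simp only: matrix_apply[OF linear_T[OF assms]])
  then show thesis by (rule that)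
qed

text \<open>Naturality of the Levi-Civita connection; the second derivative of \<open>T\<close> is
  what the chain rule adds to the second derivative of a curve. Both sides are tested against
  vectors \<open>D w\<close>, where \<open>mform_covariant_acceleration\<close> leaves first
  derivatives of the metrics, and differentiating the pullback relation connects these.\<close>

lemma covariant_acceleration_T:
  assumes x: "x \<in> U"
  shows "covariant_acceleration g' (T x) (frechet_derivative T (at x) v)
       (frechet_derivative T (at x) a + frechet_derivative (\<lambda>y. frechet_derivative T (at y) v) (at x) v)
     = frechet_derivative T (at x) (covariant_acceleration g x v a)"
proof (rule tgt.nondegenerate[OF T_into[OF x]])
  fix z
  obtain w where w: "frechet_derivative T (at x) w = z" using surj_T[OF x] by blast
  define D where "D = frechet_derivative T (at x)"
  define B where "B u v = frechet_derivative (\<lambda>y. frechet_derivative T (at y) u) (at x) v" for u v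
  have dB: "((\<lambda>y. frechet_derivative T (at y) u) has_derivative B u) (at x)" for u
    unfolding B_def by (rule smooth_on_derivative[OF smooth_on_frechet_derivative[OF smooth_T] x])
  \<comment> \<open>Taken componentwise, since \<open>smooth_on_second_derivative_symmetric\<close>
    concerns real-valued functions.\<close>
  have Bsym: "B u v = B v u" for u v
  proof -
    have "B u v $ i = B v u $ i" for i
    proof -
      have s: "smooth_on U (\<lambda>y. T y $ i)" by (intro smooth_on_nth src.open_U smooth_T)
      have e: "frechet_derivative (\<lambda>y. T y $ i) (at y) u = frechet_derivative T (at y) u $ i" if "y \<in> U" for y u
        using frechet_derivative_at[OF has_derivative_nth[OF has_derivative_T[OF that], of i]] by metis
      have "frechet_derivative (\<lambda>y. frechet_derivative (\<lambda>y. T y $ i) (at y) u) (at x) v = B u v $ i" for u v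
      proof -
        have "((\<lambda>y. frechet_derivative (\<lambda>y. T y $ i) (at y) u) has_derivative (\<lambda>v. B u v $ i)) (at x)"
          by (rule has_derivative_transform_within_open[OF has_derivative_nth[OF dB] src.open_U x]) (simp add: e)
        from frechet_derivative_at[OF this] show ?thesis by metis
      qed
      with smooth_on_second_derivative_symmetric[OF src.open_U x s, of u v] show ?thesis by simp
    qed
    then show ?thesis by (simp add: vec_eq_iff)
  qed
  define G G' where "G = frechet_derivative g (at x)" and "G' = frechet_derivative g' (at (T x))"
  have dG: "(g has_derivative G) (at x)" "(g' has_derivative G') (at (T x))"
    unfolding G_def G'_def
    using smooth_on_derivative[OF src.smooth_g x] smooth_on_derivative[OF tgt.smooth_g T_into[OF x]] by auto
  have Gp: "mform (G u) p q = mform (G' (D u)) (D p) (D q) + mform (g' (T x)) (B p u) (D q) + mform (g' (T x)) (D p) (B q u)" for u p q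
  proof -
    have 1: "((\<lambda>y. g' (T y)) has_derivative (\<lambda>u. G' (D u))) (at x)"
      using diff_chain_at[OF has_derivative_T[OF x] dG(2)] by (simp add: o_def D_def)
    have 2: "((\<lambda>y. mform (g y) p q) has_derivative (\<lambda>u. mform (G' (D u)) (D p) (D q) + mform (g' (T x)) (B p u) (D q) + mform (g' (T x)) (D p) (B q u))) (at x)"
      by (rule has_derivative_transform_within_open[OF has_derivative_mform[OF 1 dB dB, of p q, folded D_def] src.open_U x])
        (simp add: mform_T)
    have 3: "((\<lambda>y. mform (g y) p q) has_derivative (\<lambda>u. mform (G u) p q)) (at x)"
      using has_derivative_mform[OF dG(1) has_derivative_const has_derivative_const, of p q]
      by (simp add: mform_def)
    show ?thesis
      by (rule fun_cong[OF has_derivative_unique[OF 3 2]])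
  qed
  have msym: "mform (g' (T x)) u v = mform (g' (T x)) v u" for u v
    by (simp add: mform_2 tgt.sym[OF T_into[OF x]])
  have madd: "mform M (p + q) r = mform M p r + mform M q r" for M :: "real^2^2" and p q r
    by (simp add: mform_2 algebra_simps)
  have "mform (g' (T x)) (D (covariant_acceleration g x v a)) (D w) = mform (g x) (covariant_acceleration g x v a) w"
    by (simp add: mform_T[OF x] D_def)
  also have "\<dots> = mform (g x) a w + mform (G v) v w - mform (G w) v v / 2"
    unfolding G_def by (rule src.mform_covariant_acceleration[OF x])
  \<comment> \<open>The terms with \<open>B v w\<close> cancel thanks to the factor one half and the
    symmetry of \<open>B\<close>; only \<open>B v v\<close> survives.\<close>
  also have "\<dots> = mform (g' (T x)) (D a) (D w) + mform (G' (D v)) (D v) (D w) + mform (g' (T x)) (B v v) (D w) - mform (G' (D w)) (D v) (D v) / 2"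
    unfolding Gp mform_T[OF x, folded D_def] Bsym[of w v] msym[of "D v" "B v w"] by (simp add: field_simps)
  also have "\<dots> = mform (g' (T x)) (covariant_acceleration g' (T x) (D v) (D a + B v v)) (D w)"
    unfolding tgt.mform_covariant_acceleration[OF T_into[OF x]] G'_def[symmetric] madd by simp
  finally show "mform (g' (T x)) (covariant_acceleration g' (T x) (frechet_derivative T (at x) v)
       (frechet_derivative T (at x) a + frechet_derivative (\<lambda>y. frechet_derivative T (at y) v) (at x) v)) z
     = mform (g' (T x)) (frechet_derivative T (at x) (covariant_acceleration g x v a)) z"
    unfolding w[symmetric] D_def B_def by simp
qed

text \<open>Up to \<open>1 / sqrt (det M)\<close>, \<open>rot M\<close> is the standard quarter turn
  times \<open>M\<close>. Multiplying the quarter turn by \<open>D\<close> on the left and by its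
  transpose on the right scales it by \<open>det D\<close>, and positivity lets this factor cancel
  against the one in \<open>sqrt (det (g x))\<close>.\<close>

lemma rot_T:
  assumes x: "x \<in> U" and d: "det (matrix (frechet_derivative T (at x))) > 0"
  shows "frechet_derivative T (at x) (rot (g x) *v v) = rot (g' (T x)) *v frechet_derivative T (at x) v"
proof -
  define D where "D = matrix (frechet_derivative T (at x))"
  define M where "M = g' (T x)"
  have D: "frechet_derivative T (at x) u = D *v u" for u
    unfolding D_def by (rule matrix_apply[OF linear_T[OF x], symmetric])
  have s: "sqrt (det (g x)) = det D * sqrt (det M)"
    using d by (simp add: det_T[OF x] real_sqrt_mult D_def M_def)
  have gx: "g x = transpose D ** M ** D" using pullback[OF x] by (simp add: D_def M_def)
  have MM: "M $ 2 $ 1 = M $ 1 $ 2" using tgt.sym[OF T_into[OF x]] by (simp add: M_def)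
  define E where "E N = (vector [vector [- N $ 1 $ 2, - N $ 2 $ 2], vector [N $ 1 $ 1, N $ 1 $ 2]] :: real^2^2)" for N :: "real^2^2"
  have "D *v (E (transpose D ** M ** D) *v v) = det D *\<^sub>R (E M *v (D *v v))"
    by (simp add: vec_eq_iff forall_2 matrix_vector_mult_def sum_2 E_def matrix_matrix_mult_def transpose_def det_2 MM algebra_simps)
  moreover have "det D > 0" "det M > 0" using d tgt.det_pos[OF T_into[OF x]] by (simp_all add: D_def M_def)
  ultimately show ?thesis
    unfolding D M_def[symmetric] rot_def s E_def[symmetric] gx[symmetric]
    by (simp add: scaleR_matrix_vector_assoc[symmetric] matrix_vector_mult_scaleR gx[symmetric])
qed

end

section \<open>Products of surfaces\<close>

lemma sum_UNIV_Plus: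
  fixes f :: "'a::finite + 'b::finite \<Rightarrow> 'c::comm_monoid_add"
  shows "(\<Sum>i\<in>UNIV. f i) = (\<Sum>a\<in>UNIV. f (Inl a)) + (\<Sum>b\<in>UNIV. f (Inr b))"
  unfolding UNIV_Plus_UNIV[symmetric] by (simp add: sum.Plus del: UNIV_Plus_UNIV)

lemma join_nth [simp]: "join v w $ Inl a = v $ a" "join v w $ Inr b = w $ b"
  by (simp_all add: join_def)

lemma left_part_nth [simp]: "left_part v $ a = v $ Inl a"
  by (simp add: left_part_def)

lemma right_part_nth [simp]: "right_part v $ b = v $ Inr b"
  by (simp add: right_part_def)

lemma vec_eq_iff_Plus: "v = w \<longleftrightarrow> (\<forall>a. v $ Inl a = w $ Inl a) \<and> (\<forall>b. v $ Inr b = w $ Inr b)"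
  for v w :: "'a ^ ('m::finite + 'n::finite)"
  by (metis vec_eq_iff sum.exhaust_sel)

lemma left_part_join [simp]: "left_part (join v w) = v"
  by (simp add: vec_eq_iff)

lemma right_part_join [simp]: "right_part (join v w) = w"
  by (simp add: vec_eq_iff)

lemma bounded_linear_left_part: "bounded_linear left_part"
  by (intro linear_conv_bounded_linear[THEN iffD1] linearI) (simp_all add: vec_eq_iff)

lemma bounded_linear_right_part: "bounded_linear right_part"
  by (intro linear_conv_bounded_linear[THEN iffD1] linearI) (simp_all add: vec_eq_iff)

lemma has_derivative_join:
  assumes "(f has_derivative f') (at x)" "(g has_derivative g') (at x)"
  shows "((\<lambda>x. join (f x) (g x)) has_derivative (\<lambda>h. join (f' h) (g' h))) (at x)"
proof -
  have L: "bounded_linear (\<lambda>v::real^'m. join v (0::real^'n))"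
    by (intro linear_conv_bounded_linear[THEN iffD1] linearI) (simp_all add: vec_eq_iff_Plus)
  have R: "bounded_linear (\<lambda>w::real^'n. join (0::real^'m) w)"
    by (intro linear_conv_bounded_linear[THEN iffD1] linearI) (simp_all add: vec_eq_iff_Plus)
  have e: "join v w = join v 0 + join 0 w" for v :: "real^'m" and w :: "real^'n"
    by (simp add: vec_eq_iff_Plus)
  have "((\<lambda>x. join (f x) 0 + join 0 (g x)) has_derivative (\<lambda>h. join (f' h) 0 + join 0 (g' h))) (at x)"
    by (intro has_derivative_add bounded_linear.has_derivative[OF L assms(1)] bounded_linear.has_derivative[OF R assms(2)])
  then show ?thesis by (simp only: e[symmetric])
qed

lemma product_metric_nth [simp]:
  "product_metric e g1 g2 y $ Inl a $ Inl b = g1 (left_part y) $ a $ b"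
  "product_metric e g1 g2 y $ Inr c $ Inr d = e * g2 (right_part y) $ c $ d"
  "product_metric e g1 g2 y $ Inl a $ Inr d = 0"
  "product_metric e g1 g2 y $ Inr c $ Inl b = 0"
  by (simp_all add: product_metric_def)

lemma mform_product_metric:
  "mform (product_metric e g1 g2 y) v w
     = mform (g1 (left_part y)) (left_part v) (left_part w) + e * mform (g2 (right_part y)) (right_part v) (right_part w)"
  by (simp add: mform_def inner_vec_def matrix_vector_mult_def sum_UNIV_Plus sum_distrib_left algebra_simps)

lemma left_part_axis [simp]: "left_part (axis (Inl a) 1) = axis a 1" "left_part (axis (Inr b) 1) = 0"
  by (simp_all add: vec_eq_iff axis_def)

lemma right_part_axis [simp]: "right_part (axis (Inr a) 1) = axis a 1" "right_part (axis (Inl b) 1) = 0"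
  by (simp_all add: vec_eq_iff axis_def)

lemma partial_left_part:
  assumes "f differentiable (at (left_part y))"
  shows "partial (Inl a) (\<lambda>y. f (left_part y)) y = partial a f (left_part y)"
    and "partial (Inr b) (\<lambda>y. f (left_part y)) y = 0"
proof -
  have f: "(f has_derivative frechet_derivative f (at (left_part y))) (at (left_part y))"
    using assms frechet_derivative_works by blast
  have "((\<lambda>y. f (left_part y)) has_derivative (\<lambda>h. frechet_derivative f (at (left_part y)) (left_part h))) (at y)"
    using diff_chain_at[OF bounded_linear_imp_has_derivative[OF bounded_linear_left_part] f]
    by (simp add: o_def)
  note frechet_derivative_at[OF this, symmetric]
  then show "partial (Inl a) (\<lambda>y. f (left_part y)) y = partial a f (left_part y)"
    and "partial (Inr b) (\<lambda>y. f (left_part y)) y = 0"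
    using linear_0[OF has_derivative_linear[OF f]] by (simp_all add: partial_def)
qed

lemma partial_right_part:
  assumes "f differentiable (at (right_part y))"
  shows "partial (Inr a) (\<lambda>y. f (right_part y)) y = partial a f (right_part y)"
    and "partial (Inl b) (\<lambda>y. f (right_part y)) y = 0"
proof -
  have f: "(f has_derivative frechet_derivative f (at (right_part y))) (at (right_part y))"
    using assms frechet_derivative_works by blast
  have "((\<lambda>y. f (right_part y)) has_derivative (\<lambda>h. frechet_derivative f (at (right_part y)) (right_part h))) (at y)"
    using diff_chain_at[OF bounded_linear_imp_has_derivative[OF bounded_linear_right_part] f]
    by (simp add: o_def)
  note frechet_derivative_at[OF this, symmetric]
  then show "partial (Inr a) (\<lambda>y. f (right_part y)) y = partial a f (right_part y)"
    and "partial (Inl b) (\<lambda>y. f (right_part y)) y = 0"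
    using linear_0[OF has_derivative_linear[OF f]] by (simp_all add: partial_def)
qed

lemma partial_const [simp]: "partial i (\<lambda>x. c) y = 0"
  using frechet_derivative_at[OF has_derivative_const[of c "at y"], symmetric] by (simp add: partial_def)

lemma partial_cmult:
  fixes f :: "real ^ 'n \<Rightarrow> real"
  assumes "f differentiable (at x)"
  shows "partial i (\<lambda>y. c * f y) x = c * partial i f x"
proof -
  have "((\<lambda>y. c * f y) has_derivative (\<lambda>h. c * frechet_derivative f (at x) h)) (at x)"
    using assms frechet_derivative_works by (blast intro: has_derivative_mult_right)
  from frechet_derivative_at[OF this, symmetric] show ?thesis by (simp add: partial_def)
qed

lemma partial_cong:
  assumes "open U" "x \<in> U" "\<And>y. y \<in> U \<Longrightarrow> f y = g y"
  shows "partial i f x = partial i g x"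
proof (cases "f differentiable (at x)")
  case True
  then have "(g has_derivative frechet_derivative f (at x)) (at x)"
    using has_derivative_transform_within_open[of f _ x UNIV U g] assms by (auto simp: frechet_derivative_works)
  from frechet_derivative_at[OF this] show ?thesis by (simp add: partial_def)
next
  case False
  \<comment> \<open>\<open>frechet_derivative\<close> is a choice from the derivatives at
    \<open>x\<close>; both functions have the same ones, even if there are none.\<close>
  have "(f has_derivative D) (at x) \<longleftrightarrow> (g has_derivative D) (at x)" for D
    using has_derivative_transform_within_open[of f D x UNIV U g] has_derivative_transform_within_open[of g D x UNIV U f] assms by auto
  then show ?thesis by (simp add: partial_def frechet_derivative_def)
qed

text \<open>The sign enters as an equation saying that \<epsilon> is its own inverse, the form in
  which algebra cancels it.\<close>

locale surface_product = left: surface_metric U1 g1 + right: surface_metric U2 g2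
  for U1 g1 U2 g2 +
  fixes \<epsilon> :: real
  assumes eps: "\<epsilon> * \<epsilon> = 1"
begin

abbreviation "G \<equiv> product_metric \<epsilon> g1 g2"

definition W :: "(real ^ (2 + 2)) set" where
  "W = {y. left_part y \<in> U1 \<and> right_part y \<in> U2}"

lemma open_W: "open W"
proof -
  have "W = left_part -` U1 \<inter> right_part -` U2" by (auto simp: W_def)
  then show ?thesis
    by (simp add: open_Int open_vimage left.open_U right.open_U linear_continuous_on bounded_linear_left_part bounded_linear_right_part)
qed

lemma W_D: "y \<in> W \<Longrightarrow> left_part y \<in> U1" "y \<in> W \<Longrightarrow> right_part y \<in> U2"
  by (auto simp: W_def)

lemma matrix_inv_nth:
  assumes "y \<in> W"
  shows "matrix_inv (G y) $ Inl a $ Inl b = matrix_inv (g1 (left_part y)) $ a $ b"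
    "matrix_inv (G y) $ Inr c $ Inr d = \<epsilon> * matrix_inv (g2 (right_part y)) $ c $ d"
    "matrix_inv (G y) $ Inl a $ Inr d = 0"
    "matrix_inv (G y) $ Inr c $ Inl b = 0"
proof -
  define N :: "real ^ (2 + 2) ^ (2 + 2)" where "N = (\<chi> i j. case (i, j) of
        (Inl a, Inl b) \<Rightarrow> matrix_inv (g1 (left_part y)) $ a $ b
      | (Inr a, Inr b) \<Rightarrow> \<epsilon> * matrix_inv (g2 (right_part y)) $ a $ b
      | _ \<Rightarrow> 0)"
  have N: "N $ Inl a $ Inl b = matrix_inv (g1 (left_part y)) $ a $ b"
    "N $ Inr c $ Inr d = \<epsilon> * matrix_inv (g2 (right_part y)) $ c $ d"
    "N $ Inl a $ Inr d = 0" "N $ Inr c $ Inl b = 0" for a b c d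
    by (simp_all add: N_def)
  have 1: "(\<Sum>k\<in>UNIV. g1 (left_part y) $ i $ k * matrix_inv (g1 (left_part y)) $ k $ j) = (if i = j then 1 else 0)"
    "(\<Sum>k\<in>UNIV. g2 (right_part y) $ i $ k * matrix_inv (g2 (right_part y)) $ k $ j) = (if i = j then 1 else 0)" for i j
    using arg_cong[OF invertible_matrix_inv(1)[OF left.invertible[OF W_D(1)[OF assms]]], of "\<lambda>M. M $ i $ j"]
      arg_cong[OF invertible_matrix_inv(1)[OF right.invertible[OF W_D(2)[OF assms]]], of "\<lambda>M. M $ i $ j"]
    by (simp_all add: matrix_matrix_mult_def mat_def)
  have e: "\<epsilon> * a * (\<epsilon> * b) = a * b" for a b
    using eps by algebra
  have "matrix_inv (G y) = N"
    by (rule matrix_inv_unique)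
      (simp add: vec_eq_iff_Plus matrix_matrix_mult_def mat_def sum_UNIV_Plus N e 1)
  with N show "matrix_inv (G y) $ Inl a $ Inl b = matrix_inv (g1 (left_part y)) $ a $ b"
    "matrix_inv (G y) $ Inr c $ Inr d = \<epsilon> * matrix_inv (g2 (right_part y)) $ c $ d"
    "matrix_inv (G y) $ Inl a $ Inr d = 0"
    "matrix_inv (G y) $ Inr c $ Inl b = 0" by simp_all
qed

lemma partial_G:
  assumes "y \<in> W"
  shows "partial (Inl i) (\<lambda>y. G y $ Inl a $ Inl b) y = partial i (\<lambda>x. g1 x $ a $ b) (left_part y)"
    "partial (Inr j) (\<lambda>y. G y $ Inl a $ Inl b) y = 0"
    "partial (Inr j) (\<lambda>y. G y $ Inr c $ Inr d) y = \<epsilon> * partial j (\<lambda>x. g2 x $ c $ d) (right_part y)"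
    "partial (Inl i) (\<lambda>y. G y $ Inr c $ Inr d) y = 0"
    "partial k (\<lambda>y. G y $ Inl a $ Inr d) y = 0" "partial k (\<lambda>y. G y $ Inr c $ Inl b) y = 0"
proof -
  have 1: "(\<lambda>x. g1 x $ a $ b) differentiable (at (left_part y))"
    by (rule smooth_on_differentiable[OF left.smooth_entry W_D(1)[OF assms]])
  have 2: "(\<lambda>x. \<epsilon> * g2 x $ c $ d) differentiable (at (right_part y))" "(\<lambda>x. g2 x $ c $ d) differentiable (at (right_part y))"
    using smooth_on_differentiable[OF right.smooth_entry W_D(2)[OF assms]] by auto
  show "partial (Inl i) (\<lambda>y. G y $ Inl a $ Inl b) y = partial i (\<lambda>x. g1 x $ a $ b) (left_part y)"
    "partial (Inr j) (\<lambda>y. G y $ Inl a $ Inl b) y = 0"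
    "partial (Inr j) (\<lambda>y. G y $ Inr c $ Inr d) y = \<epsilon> * partial j (\<lambda>x. g2 x $ c $ d) (right_part y)"
    "partial (Inl i) (\<lambda>y. G y $ Inr c $ Inr d) y = 0"
    "partial k (\<lambda>y. G y $ Inl a $ Inr d) y = 0" "partial k (\<lambda>y. G y $ Inr c $ Inl b) y = 0"
    unfolding product_metric_nth
    by (simp_all add: partial_left_part[OF 1] partial_right_part[OF 2(1)] partial_cmult[OF 2(2)])
qed

text \<open>Rescaling a metric by a constant leaves its connection unchanged: the factor in the
  inverse matrix cancels the one in the derivatives. Mixed symbols vanish because each block depends
  on its own variables only.\<close>

lemma christoffel_G:
  assumes "y \<in> W"
  shows "christoffel G (Inl k) (Inl i) (Inl j) y = christoffel g1 k i j (left_part y)"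
    "christoffel G (Inr k') (Inr i') (Inr j') y = christoffel g2 k' i' j' (right_part y)"
    "christoffel G (Inl k) (Inr i') m y = 0" "christoffel G (Inl k) m (Inr j') y = 0"
    "christoffel G (Inr k') (Inl i) m y = 0" "christoffel G (Inr k') m (Inl j) y = 0"
proof -
  have e: "\<epsilon> * a * (\<epsilon> * b + \<epsilon> * c - \<epsilon> * d) = a * (b + c - d)" for a b c d
    using eps by algebra
  show "christoffel G (Inl k) (Inl i) (Inl j) y = christoffel g1 k i j (left_part y)"
    "christoffel G (Inr k') (Inr i') (Inr j') y = christoffel g2 k' i' j' (right_part y)"
    unfolding christoffel_def sum_UNIV_Plus
    by (simp_all only: matrix_inv_nth[OF assms] partial_G[OF assms] e) simp_all
  show "christoffel G (Inl k) (Inr i') m y = 0" "christoffel G (Inl k) m (Inr j') y = 0"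
    "christoffel G (Inr k') (Inl i) m y = 0" "christoffel G (Inr k') m (Inl j) y = 0"
    unfolding christoffel_def sum_UNIV_Plus
    by (cases m; simp only: matrix_inv_nth[OF assms] partial_G[OF assms]; simp)+
qed

text \<open>The formulas for the symbols are available on the open set \<open>W\<close>, so
  derivatives are compared through \<open>partial_cong\<close>.\<close>

lemma partial_christoffel_G:
  assumes y: "y \<in> W"
  shows "partial (Inl l) (christoffel G (Inl k) (Inl i) (Inl j)) y = partial l (christoffel g1 k i j) (left_part y)"
    "partial (Inr l') (christoffel G (Inl k) (Inl i) (Inl j)) y = 0"
    "partial (Inr l') (christoffel G (Inr k') (Inr i') (Inr j')) y = partial l' (christoffel g2 k' i' j') (right_part y)"
    "partial (Inl l) (christoffel G (Inr k') (Inr i') (Inr j')) y = 0"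
    "partial n (christoffel G (Inl k) (Inr i') m) y = 0" "partial n (christoffel G (Inl k) m (Inr j')) y = 0"
    "partial n (christoffel G (Inr k') (Inl i) m) y = 0" "partial n (christoffel G (Inr k') m (Inl j)) y = 0"
proof -
  note d = smooth_on_differentiable[OF left.smooth_christoffel W_D(1)[OF y]]
    smooth_on_differentiable[OF right.smooth_christoffel W_D(2)[OF y]]
  have z: "partial n f y = 0" if "\<And>y. y \<in> W \<Longrightarrow> f y = 0" for n and f :: "real ^ (2 + 2) \<Rightarrow> real"
    using partial_cong[OF open_W y, of f "\<lambda>_. 0"] that by simp
  have "partial n (christoffel G (Inl k) (Inl i) (Inl j)) y = partial n (\<lambda>y. christoffel g1 k i j (left_part y)) y" for n
    by (rule partial_cong[OF open_W y]) (rule christoffel_G)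
  then show "partial (Inl l) (christoffel G (Inl k) (Inl i) (Inl j)) y = partial l (christoffel g1 k i j) (left_part y)"
    "partial (Inr l') (christoffel G (Inl k) (Inl i) (Inl j)) y = 0"
    by (simp_all add: partial_left_part d)
  have "partial n (christoffel G (Inr k') (Inr i') (Inr j')) y = partial n (\<lambda>y. christoffel g2 k' i' j' (right_part y)) y" for n
    by (rule partial_cong[OF open_W y]) (rule christoffel_G)
  then show "partial (Inr l') (christoffel G (Inr k') (Inr i') (Inr j')) y = partial l' (christoffel g2 k' i' j') (right_part y)"
    "partial (Inl l) (christoffel G (Inr k') (Inr i') (Inr j')) y = 0"
    by (simp_all add: partial_right_part d)
  show "partial n (christoffel G (Inl k) (Inr i') m) y = 0" "partial n (christoffel G (Inl k) m (Inr j')) y = 0"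
    "partial n (christoffel G (Inr k') (Inl i) m) y = 0" "partial n (christoffel G (Inr k') m (Inl j)) y = 0"
    by (rule z; erule christoffel_G)+
qed

text \<open>The Ricci tensor depends on the connection alone, so the second term carries no
  \<epsilon>, in contrast to \<open>mform_product_metric\<close>.\<close>

lemma ricci_G:
  assumes "y \<in> W"
  shows "ricci G y v v = gauss_curvature_local g1 (left_part y) * mform (g1 (left_part y)) (left_part v) (left_part v)
     + gauss_curvature_local g2 (right_part y) * mform (g2 (right_part y)) (right_part v) (right_part v)"
proof -
  have "ricci G y v v = ricci g1 (left_part y) (left_part v) (left_part v) + ricci g2 (right_part y) (right_part v) (right_part v)"
    unfolding ricci_def riemann_def sum_UNIV_Plus
    by (simp add: christoffel_G[OF assms] partial_christoffel_G[OF assms])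
  then show ?thesis
    using left.ricci_eq_gauss_curvature[OF W_D(1)[OF assms]] right.ricci_eq_gauss_curvature[OF W_D(2)[OF assms]]
    by simp
qed

end

section \<open>Immersions split into two curves\<close>

lemma smooth_on_has_vector_derivative:
  assumes "smooth_on I f" "t \<in> I"
  shows "(f has_vector_derivative vector_derivative f (at t)) (at t)"
  using smooth_on_differentiable[OF assms] by (simp add: vector_derivative_works differentiable_def)

lemma smooth_on_vector_derivative:
  assumes "open I" "smooth_on I f"
  shows "smooth_on I (\<lambda>t. vector_derivative f (at t))"
proof (rule smooth_on_cong[OF assms(1) _ smooth_on_frechet_derivative[OF assms(2), of 1]])
  fix t assume "t \<in> I"
  from smooth_on_has_vector_derivative[OF assms(2) this]
  have "(f has_derivative (\<lambda>r. r *\<^sub>R vector_derivative f (at t))) (at t)"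
    by (simp add: has_vector_derivative_def)
  from frechet_derivative_at[OF this, symmetric] show "frechet_derivative f (at t) 1 = vector_derivative f (at t)"
    by simp
qed

lemma has_derivative_compose_curve:
  assumes "(p has_derivative p') (at x)" "(X has_vector_derivative X') (at (p x))"
  shows "((\<lambda>z. X (p z)) has_derivative (\<lambda>h. p' h *\<^sub>R X')) (at x)"
  using diff_chain_at[OF assms(1) assms(2)[unfolded has_vector_derivative_def]] by (simp add: o_def)

lemma join_simps:
  "join v w + join v' w' = join (v + v') (w + w')"
  "c *\<^sub>R join v w = join (c *\<^sub>R v) (c *\<^sub>R w)"
  "join v w - join v' w' = join (v - v') (w - w')"
  by (simp_all add: vec_eq_iff_Plus)

lemma mform_simps:
  fixes M :: "real ^ 2 ^ 2"
  shows "mform M (u + v) w = mform M u w + mform M v w" "mform M w (u + v) = mform M w u + mform M w v"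
    "mform M (c *\<^sub>R u) w = c * mform M u w" "mform M w (c *\<^sub>R u) = c * mform M w u"
    "mform M 0 w = 0" "mform M w 0 = 0"
  by (simp_all add: mform_2 algebra_simps)

text \<open>The product form is required on a neighbourhood, so that it can be differentiated twice;
  unit speed and curvature are imposed only at \<open>p x\<close> and \<open>q x\<close>, where the
  integrand is evaluated.\<close>

locale split_immersion = surface_product +
  fixes N :: "(real ^ 2) set" and p q :: "real ^ 2 \<Rightarrow> real" and P Q :: "real set"
    and X Y :: "real \<Rightarrow> real ^ 2" and F :: "real ^ 2 \<Rightarrow> real ^ (2 + 2)" and x :: "real ^ 2"
    and k1 k2 :: real
  assumes N: "open N" "x \<in> N" and p: "smooth_on N p" "p ` N \<subseteq> P" and q: "smooth_on N q" "q ` N \<subseteq> Q"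
    and P: "open P" and Q: "open Q" and X: "smooth_on P X" and Y: "smooth_on Q Y"
    and F: "\<And>z. z \<in> N \<Longrightarrow> F z = join (X (p z)) (Y (q z))"
    and X_mem: "X (p x) \<in> U1" and Y_mem: "Y (q x) \<in> U2"
    and inj: "inj (frechet_derivative F (at x))"
    and unit_X: "mform (g1 (X (p x))) (vector_derivative X (at (p x))) (vector_derivative X (at (p x))) = 1"
    and unit_Y: "mform (g2 (Y (q x))) (vector_derivative Y (at (q x))) (vector_derivative Y (at (q x))) = 1"
    and curv_X: "covariant_acceleration g1 (X (p x)) (vector_derivative X (at (p x)))
        (vector_derivative (\<lambda>s. vector_derivative X (at s)) (at (p x)))
      = k1 *\<^sub>R (rot (g1 (X (p x))) *v vector_derivative X (at (p x)))"
    and curv_Y: "covariant_acceleration g2 (Y (q x)) (vector_derivative Y (at (q x)))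
        (vector_derivative (\<lambda>s. vector_derivative Y (at s)) (at (q x)))
      = k2 *\<^sub>R (rot (g2 (Y (q x))) *v vector_derivative Y (at (q x)))"
begin

section \<open>The adapted frame and the derivatives of the immersion in it\<close>

definition "e1 = vector_derivative X (at (p x))"
definition "e2 = vector_derivative Y (at (q x))"
definition "a1 = vector_derivative (\<lambda>s. vector_derivative X (at s)) (at (p x))"
definition "a2 = vector_derivative (\<lambda>s. vector_derivative Y (at s)) (at (q x))"
definition "n1 = rot (g1 (X (p x))) *v e1"
definition "n2 = rot (g2 (Y (q x))) *v e2"
abbreviation "M1 \<equiv> g1 (X (p x))"
abbreviation "M2 \<equiv> g2 (Y (q x))"
definition "dp v = frechet_derivative p (at x) v"
definition "dq v = frechet_derivative q (at x) v"

lemma F_x: "left_part (F x) = X (p x)" "right_part (F x) = Y (q x)" "F x \<in> W"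
  using X_mem Y_mem by (simp_all add: F[OF N(2)] W_def)

lemma frame:
  "mform M1 e1 e1 = 1" "mform M1 n1 e1 = 0" "mform M1 e1 n1 = 0" "mform M1 n1 n1 = 1"
  "mform M2 e2 e2 = 1" "mform M2 n2 e2 = 0" "mform M2 e2 n2 = 0" "mform M2 n2 n2 = 1"
  using left.rot_orthogonal[OF X_mem, of e1] right.rot_orthogonal[OF Y_mem, of e2] unit_X unit_Y
    left.sym[OF X_mem] right.sym[OF Y_mem]
  by (simp_all add: n1_def n2_def e1_def e2_def mform_2 algebra_simps)

lemma has_derivative_F:
  assumes "z \<in> N"
  shows "(F has_derivative (\<lambda>h. join (frechet_derivative p (at z) h *\<^sub>R vector_derivative X (at (p z)))
    (frechet_derivative q (at z) h *\<^sub>R vector_derivative Y (at (q z))))) (at z)"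
proof (rule has_derivative_transform_within_open[OF _ N(1) assms F[symmetric]])
  have "p z \<in> P" "q z \<in> Q" using p(2) q(2) assms by auto
  then show "((\<lambda>z. join (X (p z)) (Y (q z))) has_derivative
     (\<lambda>h. join (frechet_derivative p (at z) h *\<^sub>R vector_derivative X (at (p z)))
    (frechet_derivative q (at z) h *\<^sub>R vector_derivative Y (at (q z))))) (at z)"
    by (intro has_derivative_join has_derivative_compose_curve smooth_on_derivative[OF p(1) assms] smooth_on_derivative[OF q(1) assms]
      smooth_on_has_vector_derivative[OF X] smooth_on_has_vector_derivative[OF Y])
qed

lemma frechet_F: "frechet_derivative F (at x) v = join (dp v *\<^sub>R e1) (dq v *\<^sub>R e2)"
  using fun_cong[OF frechet_derivative_at[OF has_derivative_F[OF N(2)]]] by (simp add: dp_def dq_def e1_def e2_def)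

lemma partial_F: "partial i F x = join (dp (axis i 1) *\<^sub>R e1) (dq (axis i 1) *\<^sub>R e2)"
  by (simp add: partial_def frechet_F)

lemma partial_partial_F:
  "partial i (partial j F) x = join (partial i (partial j p) x *\<^sub>R e1 + (dp (axis i 1) * dp (axis j 1)) *\<^sub>R a1)
     (partial i (partial j q) x *\<^sub>R e2 + (dq (axis i 1) * dq (axis j 1)) *\<^sub>R a2)"
proof -
  have 1: "partial j F z = join (partial j p z *\<^sub>R vector_derivative X (at (p z))) (partial j q z *\<^sub>R vector_derivative Y (at (q z)))"
    if "z \<in> N" for z
    using fun_cong[OF frechet_derivative_at[OF has_derivative_F[OF that]]] by (simp add: partial_def)
  have px: "p x \<in> P" "q x \<in> Q" using p(2) q(2) N by auto
  have "((\<lambda>z. join (partial j p z *\<^sub>R vector_derivative X (at (p z))) (partial j q z *\<^sub>R vector_derivative Y (at (q z))))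
    has_derivative (\<lambda>h. join (partial j p x *\<^sub>R (dp h *\<^sub>R a1) + frechet_derivative (partial j p) (at x) h *\<^sub>R e1)
       (partial j q x *\<^sub>R (dq h *\<^sub>R a2) + frechet_derivative (partial j q) (at x) h *\<^sub>R e2))) (at x)"
    unfolding dp_def dq_def a1_def a2_def e1_def e2_def
    by (intro has_derivative_join has_derivative_scaleR has_derivative_compose_curve
        smooth_on_derivative[OF p(1) N(2)] smooth_on_derivative[OF q(1) N(2)]
        smooth_on_derivative[OF smooth_on_partial[OF p(1)] N(2)] smooth_on_derivative[OF smooth_on_partial[OF q(1)] N(2)]
        smooth_on_has_vector_derivative[OF smooth_on_vector_derivative[OF P X] px(1)]
        smooth_on_has_vector_derivative[OF smooth_on_vector_derivative[OF Q Y] px(2)])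
  from has_derivative_transform_within_open[OF this N(1,2) 1[symmetric]]
  have "(partial j F has_derivative (\<lambda>h. join (partial j p x *\<^sub>R (dp h *\<^sub>R a1) + frechet_derivative (partial j p) (at x) h *\<^sub>R e1)
       (partial j q x *\<^sub>R (dq h *\<^sub>R a2) + frechet_derivative (partial j q) (at x) h *\<^sub>R e2))) (at x)" .
  from frechet_derivative_at[OF this, symmetric] show ?thesis
    by (simp add: partial_def[of i] partial_def[of j p] partial_def[of j q] dp_def[symmetric] dq_def[symmetric] ac_simps)
qed

text \<open>The Christoffel terms complete the second derivatives \<open>a1\<close> and
  \<open>a2\<close> to covariant accelerations, that is, to curvature times normal, while the
  Hessians of \<open>p\<close> and \<open>q\<close> multiply tangent vectors.\<close>

lemma ambient_derivative_F:
  "ambient_derivative G F i j x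
     = join (partial i (partial j p) x *\<^sub>R e1 + (dp (axis i 1) * dp (axis j 1) * k1) *\<^sub>R n1)
         (partial i (partial j q) x *\<^sub>R e2 + (dq (axis i 1) * dq (axis j 1) * k2) *\<^sub>R n2)"
proof -
  have c1: "(\<Sum>b\<in>UNIV. \<Sum>d\<in>UNIV. christoffel g1 a b d (X (p x)) * e1 $ b * e1 $ d) = k1 * n1 $ a - a1 $ a" for a
    using arg_cong[OF curv_X, of "\<lambda>v. v $ a"] by (simp add: covariant_acceleration_def a1_def e1_def n1_def)
  have c2: "(\<Sum>b\<in>UNIV. \<Sum>d\<in>UNIV. christoffel g2 a b d (Y (q x)) * e2 $ b * e2 $ d) = k2 * n2 $ a - a2 $ a" for a
    using arg_cong[OF curv_Y, of "\<lambda>v. v $ a"] by (simp add: covariant_acceleration_def a2_def e2_def n2_def)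
  have s1: "(\<Sum>b\<in>UNIV. \<Sum>d\<in>UNIV. christoffel g1 a b d (X (p x)) * (r * e1 $ b) * (s * e1 $ d))
      = r * s * (k1 * n1 $ a - a1 $ a)" for a r s
    unfolding c1[symmetric] sum_distrib_left by (simp add: ac_simps)
  have s2: "(\<Sum>b\<in>UNIV. \<Sum>d\<in>UNIV. christoffel g2 a b d (Y (q x)) * (r * e2 $ b) * (s * e2 $ d))
      = r * s * (k2 * n2 $ a - a2 $ a)" for a r s
    unfolding c2[symmetric] sum_distrib_left by (simp add: ac_simps)
  show ?thesis
    unfolding vec_eq_iff_Plus ambient_derivative_def
    by (simp add: sum_UNIV_Plus christoffel_G[OF F_x(3)] F_x(1,2) partial_partial_F partial_F s1 s2)
       (simp add: algebra_simps)
qed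

lemma dp_linear: "dp v = dp (axis 1 1) * v $ 1 + dp (axis 2 1) * v $ 2"
  "dq v = dq (axis 1 1) * v $ 1 + dq (axis 2 1) * v $ 2"
  using linear_real2[OF has_derivative_linear[OF smooth_on_derivative[OF p(1) N(2)]], of v]
    linear_real2[OF has_derivative_linear[OF smooth_on_derivative[OF q(1) N(2)]], of v]
  by (simp_all add: dp_def dq_def mult.commute)

lemma independent: "dp (axis 1 1) * dq (axis 2 1) - dp (axis 2 1) * dq (axis 1 1) \<noteq> 0"
proof
  assume 0: "dp (axis 1 1) * dq (axis 2 1) - dp (axis 2 1) * dq (axis 1 1) = 0"
  have z: "v = 0" if "dp v = 0" "dq v = 0" for v
  proof -
    have "frechet_derivative F (at x) v = frechet_derivative F (at x) 0"
      using that dp_linear[of 0] by (simp add: frechet_F)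
    then show ?thesis using inj by (simp add: inj_eq)
  qed
  \<comment> \<open>The standard kernel vector of each form; the vanishing determinant makes it a
    kernel vector of the other form too.\<close>
  have "vector [dp (axis 2 1), - dp (axis 1 1)] = (0 :: real ^ 2)"
    by (rule z; subst dp_linear; use 0 in \<open>simp add: algebra_simps\<close>)
  moreover have "vector [dq (axis 2 1), - dq (axis 1 1)] = (0 :: real ^ 2)"
    by (rule z; subst dp_linear; use 0 in \<open>simp add: algebra_simps\<close>)
  ultimately have "dp (axis i 1) = 0" "dq (axis i 1) = 0" for i :: 2
    using exhaust_2[of i] by (auto simp: vec_eq_iff forall_2)
  then have "axis 1 1 = (0 :: real ^ 2)" by (intro z)
  then show False by (simp add: axis_eq_0_iff)
qed

section \<open>Induced metric, second fundamental form and integrand\<close>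

abbreviation "h i j \<equiv> matrix_inv (pullback_metric G F x) $ i $ j"

text \<open>The induced metric is \<open>dp\<^sup>2 + \<epsilon> dq\<^sup>2\<close>, so the
  covectors \<open>dp\<close> and \<open>dq\<close> are orthogonal for the inverse metric. These
  pairings replace the entries \<open>h i j\<close> from here on.\<close>

lemma inverse_metric:
  "(\<Sum>i\<in>UNIV. \<Sum>j\<in>UNIV. h i j * dp (axis i 1) * dp (axis j 1)) = 1"
  "(\<Sum>i\<in>UNIV. \<Sum>j\<in>UNIV. h i j * dp (axis i 1) * dq (axis j 1)) = 0"
  "(\<Sum>i\<in>UNIV. \<Sum>j\<in>UNIV. h i j * dq (axis i 1) * dp (axis j 1)) = 0"
  "(\<Sum>i\<in>UNIV. \<Sum>j\<in>UNIV. h i j * dq (axis i 1) * dq (axis j 1)) = \<epsilon>"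
proof -
  define u v r s where "u = dp (axis 1 1)" and "v = dp (axis 2 1)" and "r = dq (axis 1 1)" and "s = dq (axis 2 1)"
  have g: "pullback_metric G F x $ i $ j = dp (axis i 1) * dp (axis j 1) + \<epsilon> * (dq (axis i 1) * dq (axis j 1))" for i j
    by (simp add: pullback_metric_def partial_F mform_product_metric F_x mform_simps frame)
  \<comment> \<open>The Jacobian determinant of \<open>p\<close> and \<open>q\<close>; the metric
    determinant is \<epsilon> times its square.\<close>
  define d where "d = u * s - v * r"
  have d: "d \<noteq> 0" using independent by (simp add: u_def v_def r_def s_def d_def)
  have ez: "\<epsilon> \<noteq> 0" using eps by auto
  have e: "\<epsilon> * (\<epsilon> * d * d) = d * d" using eps by algebra
  have det: "det (pullback_metric G F x) = \<epsilon> * d * d"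
    unfolding det_2 g u_def[symmetric] v_def[symmetric] r_def[symmetric] s_def[symmetric] d_def by algebra
  then have "det (pullback_metric G F x) \<noteq> 0" using d ez by simp
  note inv = matrix_inv_2[OF this, unfolded det g, folded u_def v_def r_def s_def]
  show "(\<Sum>i\<in>UNIV. \<Sum>j\<in>UNIV. h i j * dp (axis i 1) * dp (axis j 1)) = 1"
    "(\<Sum>i\<in>UNIV. \<Sum>j\<in>UNIV. h i j * dp (axis i 1) * dq (axis j 1)) = 0"
    "(\<Sum>i\<in>UNIV. \<Sum>j\<in>UNIV. h i j * dq (axis i 1) * dp (axis j 1)) = 0"
    "(\<Sum>i\<in>UNIV. \<Sum>j\<in>UNIV. h i j * dq (axis i 1) * dq (axis j 1)) = \<epsilon>"
    unfolding sum_2 inv u_def[symmetric] v_def[symmetric] r_def[symmetric] s_def[symmetric]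
    using d ez by (simp_all add: divide_simps e) (simp_all add: d_def algebra_simps)
qed

text \<open>The frame splits into tangent vectors \<open>e1\<close>, \<open>e2\<close> and normal
  vectors \<open>n1\<close>, \<open>n2\<close>. The tangential coefficients are arbitrary, so
  Hessian terms need not be evaluated.\<close>

lemma normal_part_F:
  "normal_part G F x (join (c *\<^sub>R e1 + d *\<^sub>R n1) (c' *\<^sub>R e2 + d' *\<^sub>R n2)) = join (d *\<^sub>R n1) (d' *\<^sub>R n2)"
proof -
  have m: "mform (G (F x)) (join (c *\<^sub>R e1 + d *\<^sub>R n1) (c' *\<^sub>R e2 + d' *\<^sub>R n2)) (partial j F x)
     = c * dp (axis j 1) + \<epsilon> * c' * dq (axis j 1)" for j
    by (simp add: partial_F mform_product_metric F_x mform_simps frame algebra_simps)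
  have e: "\<epsilon> * c' * \<epsilon> = c'" using eps by algebra
  have "(\<Sum>i\<in>UNIV. \<Sum>j\<in>UNIV. (h i j * (c * dp (axis j 1) + \<epsilon> * c' * dq (axis j 1))) *\<^sub>R partial i F x)
     = join ((c * (\<Sum>i\<in>UNIV. \<Sum>j\<in>UNIV. h i j * dp (axis i 1) * dp (axis j 1)) + \<epsilon> * c' * (\<Sum>i\<in>UNIV. \<Sum>j\<in>UNIV. h i j * dp (axis i 1) * dq (axis j 1))) *\<^sub>R e1)
       ((c * (\<Sum>i\<in>UNIV. \<Sum>j\<in>UNIV. h i j * dq (axis i 1) * dp (axis j 1)) + \<epsilon> * c' * (\<Sum>i\<in>UNIV. \<Sum>j\<in>UNIV. h i j * dq (axis i 1) * dq (axis j 1))) *\<^sub>R e2)"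
    by (simp add: vec_eq_iff_Plus partial_F sum_2 algebra_simps)
  also have "\<dots> = join (c *\<^sub>R e1) (c' *\<^sub>R e2)"
    unfolding inverse_metric by (simp add: e)
  finally show ?thesis
    unfolding normal_part_def m by (simp add: join_simps)
qed

lemma second_fundamental_form_F:
  "second_fundamental_form G F x v w = join ((dp v * dp w * k1) *\<^sub>R n1) ((dq v * dq w * k2) *\<^sub>R n2)"
proof -
  \<comment> \<open>Collects the Hessian terms, which \<open>normal_part_F\<close> discards.\<close>
  define c where "c r = (\<Sum>i\<in>UNIV. \<Sum>j\<in>UNIV. v $ i * w $ j * partial i (partial j r) x)" for r
  have "(\<Sum>i\<in>UNIV. \<Sum>j\<in>UNIV. (v $ i * w $ j) *\<^sub>R ambient_derivative G F i j x)
     = join (c p *\<^sub>R e1 + (dp v * dp w * k1) *\<^sub>R n1) (c q *\<^sub>R e2 + (dq v * dq w * k2) *\<^sub>R n2)"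
    unfolding ambient_derivative_F dp_linear[of v] dp_linear[of w] c_def
    by (simp add: vec_eq_iff_Plus sum_2 algebra_simps)
  then show ?thesis
    by (simp add: second_fundamental_form_def normal_part_F)
qed

text \<open>The sign in the second component comes from the inverse metric, for which
  \<open>dq\<close> has square length \<epsilon>.\<close>

lemma trace_sff_F: "trace_sff G F x = join (k1 *\<^sub>R n1) ((\<epsilon> * k2) *\<^sub>R n2)"
proof -
  have "trace_sff G F x
     = join (((\<Sum>i\<in>UNIV. \<Sum>j\<in>UNIV. h i j * dp (axis i 1) * dp (axis j 1)) * k1) *\<^sub>R n1)
         (((\<Sum>i\<in>UNIV. \<Sum>j\<in>UNIV. h i j * dq (axis i 1) * dq (axis j 1)) * k2) *\<^sub>R n2)"
    unfolding trace_sff_def second_fundamental_form_F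
    by (simp add: vec_eq_iff_Plus sum_2 algebra_simps)
  then show ?thesis by (simp add: inverse_metric)
qed

text \<open>Only squares remain on the right-hand side once the curvature bounds are imposed. The gradient
  enters through \<open>v\<close> alone, so nothing needs to be known about \<open>v\<close>.\<close>

lemma integrand_eq:
  fixes v defines "V \<equiv> frechet_derivative F (at x) v"
  shows "- ricci G (F x) V V - 2 * mform (G (F x)) (second_fundamental_form G F x v v) (trace_sff G F x)
      + (mform (G (F x)) (trace_sff G F x) (product_J g1 g2 (F x) V))\<^sup>2
    = (- gauss_curvature_local g1 (X (p x)) - 2 * k1\<^sup>2) * (dp v)\<^sup>2
      + (- gauss_curvature_local g2 (Y (q x)) - 2 * k2\<^sup>2) * (dq v)\<^sup>2 + (k1 * dp v + k2 * dq v)\<^sup>2"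
proof -
  have "product_J g1 g2 (F x) V = join (dp v *\<^sub>R n1) (dq v *\<^sub>R n2)"
    by (simp add: product_J_def V_def frechet_F F_x n1_def n2_def matrix_vector_mult_scaleR)
  \<comment> \<open>Here the \<epsilon> of the product metric meets the \<epsilon> of the
    trace.\<close>
  moreover have e: "\<epsilon> * (\<epsilon> * r) = r" for r using eps by algebra
  ultimately show ?thesis
    unfolding V_def second_fundamental_form_F trace_sff_F ricci_G[OF F_x(3)] frechet_F
    by (simp only: mform_product_metric F_x mform_simps frame left_part_join right_part_join mult.assoc mult_1_right e)
      (simp add: power2_eq_square algebra_simps e)
qed

lemma integrand_nonneg:
  assumes "gauss_curvature_local g1 (X (p x)) \<le> - 2 * k1\<^sup>2" "gauss_curvature_local g2 (Y (q x)) \<le> - 2 * k2\<^sup>2"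
  shows "- ricci G (F x) (frechet_derivative F (at x) v) (frechet_derivative F (at x) v)
      - 2 * mform (G (F x)) (second_fundamental_form G F x v v) (trace_sff G F x)
      + (mform (G (F x)) (trace_sff G F x) (product_J g1 g2 (F x) (frechet_derivative F (at x) v)))\<^sup>2 \<ge> 0"
  unfolding integrand_eq by (intro add_nonneg_nonneg mult_nonneg_nonneg zero_le_power2) (use assms in simp_all)

end

section \<open>Charts\<close>

lemma is_chartD:
  assumes "is_chart c"
  shows "open (cdom c)" "open (cimg c)" "homeomorphism (cdom c) (cimg c) (coord c) (cinv c)"
    "p \<in> cdom c \<Longrightarrow> coord c p \<in> cimg c" "p \<in> cdom c \<Longrightarrow> cinv c (coord c p) = p"
    "x \<in> cimg c \<Longrightarrow> cinv c x \<in> cdom c" "x \<in> cimg c \<Longrightarrow> coord c (cinv c x) = x"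
  using assms by (auto simp: is_chart_def homeomorphism_def)

lemma open_coord_image:
  assumes "is_chart c" "open O'" "O' \<subseteq> cdom c"
  shows "open (coord c ` O')"
proof -
  have "openin (top_of_set (cimg c)) (coord c ` O')"
    using homeomorphism_imp_open_map[OF is_chartD(3)[OF assms(1)]] assms
    by (simp add: openin_open_eq is_chartD(1)[OF assms(1)])
  then show ?thesis using is_chartD(2)[OF assms(1)] by (simp add: openin_open_eq)
qed

lemma overlap_iff:
  assumes "is_chart c"
  shows "x \<in> overlap c d \<longleftrightarrow> x \<in> cimg c \<and> cinv c x \<in> cdom d"
  using is_chartD(4-7)[OF assms] by (auto simp: overlap_def cimg_def)

lemma transition_coord:
  "is_chart c \<Longrightarrow> p \<in> cdom c \<Longrightarrow> transition c d (coord c p) = coord d p"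
  by (simp add: transition_def is_chartD(5))

lemma open_overlap: "is_chart c \<Longrightarrow> is_chart d \<Longrightarrow> open (overlap c d)"
  unfolding overlap_def by (intro open_coord_image open_Int is_chartD(1)) auto

lemma smooth_atlasD:
  assumes "smooth_atlas A" "c \<in> A" "d \<in> A"
  shows "is_chart c" "smooth_on (overlap c d) (transition c d)"
  using assms by (auto simp: smooth_atlas_def)

lemma chart_at:
  assumes "smooth_atlas A"
  shows "chart_at A p \<in> A" "p \<in> cdom (chart_at A p)"
proof -
  have "\<exists>c. c \<in> A \<and> p \<in> cdom c"
    using assms unfolding smooth_atlas_def by (metis UNIV_I UN_E)
  from someI_ex[OF this] show "chart_at A p \<in> A" "p \<in> cdom (chart_at A p)"
    by (simp_all add: chart_at_def)
qed

lemma riemannian_manifold_atlas: "riemannian_manifold M \<Longrightarrow> smooth_atlas (charts M)"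
  by (simp add: riemannian_manifold_def)

lemma surface_metric_chart:
  fixes M :: "('a::topological_space, 2) manifold"
  assumes "riemannian_manifold M" "c \<in> charts M"
  shows "surface_metric (cimg c) (metric M c)"
  using assms is_chartD(2)[OF smooth_atlasD(1)[OF riemannian_manifold_atlas[OF assms(1)] assms(2,2)]]
  by (simp add: surface_metric_def riemannian_manifold_def)

lemma surface_isometry_transition:
  fixes M :: "('a::topological_space, 2) manifold"
  assumes "riemannian_manifold M" "c \<in> charts M" "d \<in> charts M"
  shows "surface_isometry (overlap c d) (metric M c) (cimg d) (metric M d) (transition c d)"
proof -
  note at = riemannian_manifold_atlas[OF assms(1)]
  have c: "is_chart c" "is_chart d" using smooth_atlasD(1)[OF at] assms by auto
  interpret c: surface_metric "cimg c" "metric M c" by (rule surface_metric_chart) fact+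
  interpret d: surface_metric "cimg d" "metric M d" by (rule surface_metric_chart) fact+
  have sub: "overlap c d \<subseteq> cimg c" using overlap_iff[OF c(1), of _ d] by blast
  show ?thesis
  proof
    show "open (overlap c d)" by (rule open_overlap[OF c])
    show "smooth_on (overlap c d) (metric M c)" by (rule smooth_on_subset[OF c.smooth_g sub])
    show "transpose (metric M c x) = metric M c x" if "x \<in> overlap c d" for x
      using c.sym_g sub that by auto
    show "0 < mform (metric M c x) v v" if "x \<in> overlap c d" "v \<noteq> 0" for x v
      using c.pos_g sub that by auto
    show "smooth_on (overlap c d) (transition c d)" by (rule smooth_atlasD(2)[OF at assms(2,3)])
    show "transition c d x \<in> cimg d" if "x \<in> overlap c d" for x
      using that unfolding overlap_iff[OF c(1)] transition_def by (simp add: is_chartD(4)[OF c(2)])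
    show "metric M c x = transpose (matrix (frechet_derivative (transition c d) (at x))) ** metric M d (transition c d x) **
         matrix (frechet_derivative (transition c d) (at x))" if "x \<in> overlap c d" for x
      using assms that unfolding riemannian_manifold_def Let_def by blast
  qed
qed

section \<open>Curvature of curves\<close>

lemma velocity_eq: "velocity c \<gamma> = (\<lambda>t. vector_derivative (coord c \<circ> \<gamma>) (at t))"
  by (simp add: velocity_def[abs_def])

lemma acceleration_eq:
  "acceleration M c \<gamma> t = covariant_acceleration (metric M c) (coord c (\<gamma> t)) (velocity c \<gamma> t)
     (vector_derivative (velocity c \<gamma>) (at t))"
  by (simp add: acceleration_def covariant_acceleration_def)

locale curve_in_two_charts =
  fixes c d :: "('a::topological_space, 2) chart" and K :: "real set" and \<gamma> :: "real \<Rightarrow> 'a"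
  assumes c: "is_chart c" and d: "is_chart d" and T: "smooth_on (overlap c d) (transition c d)"
    and K: "open K" "\<And>s. s \<in> K \<Longrightarrow> \<gamma> s \<in> cdom c" "\<And>s. s \<in> K \<Longrightarrow> \<gamma> s \<in> cdom d"
    and X: "smooth_on K (coord c \<circ> \<gamma>)"
begin

abbreviation "DT x \<equiv> frechet_derivative (transition c d) (at x)"

lemma coord_in_overlap: "s \<in> K \<Longrightarrow> coord c (\<gamma> s) \<in> overlap c d"
  using K by (auto simp: overlap_def)

lemma velocity:
  assumes "t \<in> K"
  shows "((coord c \<circ> \<gamma>) has_vector_derivative velocity c \<gamma> t) (at t)"
  unfolding velocity_eq by (rule smooth_on_has_vector_derivative[OF X assms])

lemma velocity_transition:
  assumes t: "t \<in> K"
  shows "velocity d \<gamma> t = DT (coord c (\<gamma> t)) (velocity c \<gamma> t)"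
proof -
  note ov = coord_in_overlap[OF t]
  have "((\<lambda>s. transition c d ((coord c \<circ> \<gamma>) s)) has_derivative (\<lambda>h. DT (coord c (\<gamma> t)) (h *\<^sub>R velocity c \<gamma> t))) (at t)"
    using diff_chain_at[OF velocity[OF t, unfolded has_vector_derivative_def], of "transition c d"] smooth_on_derivative[OF T ov]
    by (simp add: o_def)
  then have "((\<lambda>s. transition c d ((coord c \<circ> \<gamma>) s)) has_vector_derivative DT (coord c (\<gamma> t)) (velocity c \<gamma> t)) (at t)"
    by (simp add: has_vector_derivative_def linear_cmul[OF has_derivative_linear[OF smooth_on_derivative[OF T ov]]])
  then have "((coord d \<circ> \<gamma>) has_vector_derivative DT (coord c (\<gamma> t)) (velocity c \<gamma> t)) (at t)"
    by (rule has_vector_derivative_transform_within_open[OF _ K(1) t]) (simp add: transition_coord[OF c] K(2))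
  then show ?thesis
    unfolding velocity_def by (rule vector_derivative_at)
qed

text \<open>Along the curve the base point of \<open>DT\<close> moves together with the velocity,
  which produces the second derivative of the transition map. The result has the shape expected by
  \<open>covariant_acceleration_T\<close>.\<close>

lemma derivative_velocity_transition:
  assumes t: "t \<in> K"
  shows "vector_derivative (velocity d \<gamma>) (at t)
      = DT (coord c (\<gamma> t)) (vector_derivative (velocity c \<gamma>) (at t))
      + frechet_derivative (\<lambda>y. DT y (velocity c \<gamma> t)) (at (coord c (\<gamma> t))) (velocity c \<gamma> t)"
proof -
  define x where "x = coord c (\<gamma> t)"
  define v where "v = velocity c \<gamma> t"
  define a where "a = vector_derivative (velocity c \<gamma>) (at t)"
  \<comment> \<open>Base point and direction vary simultaneously; expanding in the columns
    \<open>E i\<close> separates them for the product rule.\<close>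
  define E where "E i y = DT y (axis i 1)" for i y
  note ov = coord_in_overlap[OF t, folded x_def]
  define B where "B i = frechet_derivative (E i) (at x)" for i
  have sE: "smooth_on (overlap c d) (E i)" for i
    unfolding E_def[abs_def] by (rule smooth_on_frechet_derivative[OF T])
  have dE: "(E i has_derivative B i) (at x)" for i
    unfolding B_def by (rule smooth_on_derivative[OF sE ov])
  have DT: "DT y u = u $ 1 *\<^sub>R E 1 y + u $ 2 *\<^sub>R E 2 y" if "y \<in> overlap c d" for y u
    unfolding E_def by (rule linear_real2[OF has_derivative_linear[OF smooth_on_derivative[OF T that]]])
  have "((\<lambda>y. v $ 1 *\<^sub>R E 1 y + v $ 2 *\<^sub>R E 2 y) has_derivative (\<lambda>h. v $ 1 *\<^sub>R B 1 h + v $ 2 *\<^sub>R B 2 h)) (at x)"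
    by (intro derivative_intros dE)
  then have "((\<lambda>y. DT y v) has_derivative (\<lambda>h. v $ 1 *\<^sub>R B 1 h + v $ 2 *\<^sub>R B 2 h)) (at x)"
    by (rule has_derivative_transform_within_open[OF _ open_overlap[OF c d] ov]) (simp add: DT)
  from frechet_derivative_at[OF this] have B: "frechet_derivative (\<lambda>y. DT y v) (at x) h = v $ 1 *\<^sub>R B 1 h + v $ 2 *\<^sub>R B 2 h" for h
    by (simp add: fun_eq_iff)
  have sv: "smooth_on K (velocity c \<gamma>)"
    unfolding velocity_eq by (rule smooth_on_vector_derivative[OF K(1) X])
  have dv: "(velocity c \<gamma> has_derivative (\<lambda>h. h *\<^sub>R a)) (at t)"
    using smooth_on_has_vector_derivative[OF sv t] by (simp add: a_def has_vector_derivative_def)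
  have dEX: "((\<lambda>s. E i (coord c (\<gamma> s))) has_derivative (\<lambda>h. h *\<^sub>R B i v)) (at t)" for i
    using diff_chain_at[OF velocity[OF t, unfolded has_vector_derivative_def], of "E i" "B i"] dE[of i]
    by (simp add: o_def x_def v_def linear_cmul[OF has_derivative_linear[OF dE]])
  have "((\<lambda>s. velocity c \<gamma> s $ 1 *\<^sub>R E 1 (coord c (\<gamma> s)) + velocity c \<gamma> s $ 2 *\<^sub>R E 2 (coord c (\<gamma> s)))
     has_derivative (\<lambda>h. (v $ 1 *\<^sub>R (h *\<^sub>R B 1 v) + (h *\<^sub>R a) $ 1 *\<^sub>R E 1 x) + (v $ 2 *\<^sub>R (h *\<^sub>R B 2 v) + (h *\<^sub>R a) $ 2 *\<^sub>R E 2 x))) (at t)"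
    unfolding v_def x_def
    by (intro has_derivative_add has_derivative_scaleR has_derivative_nth dv dEX[unfolded v_def])
  then have "((\<lambda>s. velocity c \<gamma> s $ 1 *\<^sub>R E 1 (coord c (\<gamma> s)) + velocity c \<gamma> s $ 2 *\<^sub>R E 2 (coord c (\<gamma> s)))
     has_vector_derivative (DT x a + (v $ 1 *\<^sub>R B 1 v + v $ 2 *\<^sub>R B 2 v))) (at t)"
    unfolding has_vector_derivative_def by (rule has_derivative_eq_rhs) (simp add: fun_eq_iff DT[OF ov] algebra_simps)
  then have "(velocity d \<gamma> has_vector_derivative (DT x a + (v $ 1 *\<^sub>R B 1 v + v $ 2 *\<^sub>R B 2 v))) (at t)"
    by (rule has_vector_derivative_transform_within_open[OF _ K(1) t])
      (simp add: velocity_transition DT[OF coord_in_overlap])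
  then show ?thesis
    unfolding x_def[symmetric] v_def[symmetric] a_def[symmetric] B by (rule vector_derivative_at)
qed

end

lemma smooth_curve_chart:
  assumes "smooth_curve M I \<gamma>" "open I" "riemannian_manifold M" "c \<in> charts M" 
  shows "open {t \<in> I. \<gamma> t \<in> cdom c}" "smooth_on {t \<in> I. \<gamma> t \<in> cdom c} (coord c \<circ> \<gamma>)"
proof -
  have "open (cdom c)"
    by (rule is_chartD(1)[OF smooth_atlasD(1)[OF riemannian_manifold_atlas[OF assms(3)] assms(4,4)]])
  then have "open (I \<inter> \<gamma> -` cdom c)"
    using assms(1,2) by (intro continuous_open_preimage) (auto simp: smooth_curve_def)
  moreover have "I \<inter> \<gamma> -` cdom c = {t \<in> I. \<gamma> t \<in> cdom c}" by auto
  ultimately show "open {t \<in> I. \<gamma> t \<in> cdom c}" by simp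
  show "smooth_on {t \<in> I. \<gamma> t \<in> cdom c} (coord c \<circ> \<gamma>)" using assms by (simp add: smooth_curve_def)
qed

text \<open>Differentiating the constant square of the speed, and reading the result through
  \<open>mform_covariant_acceleration\<close> with the velocity as test vector, shows that the
  acceleration is orthogonal to the velocity.\<close>

lemma acceleration_normal:
  fixes M :: "('a::topological_space, 2) manifold"
  assumes M: "riemannian_manifold M" and I: "open I" and \<gamma>: "smooth_curve M I \<gamma>" "unit_speed M I \<gamma>"
    and t: "t \<in> I" and c: "c \<in> charts M" "\<gamma> t \<in> cdom c"
  shows "acceleration M c \<gamma> t = mform (metric M c (coord c (\<gamma> t))) (acceleration M c \<gamma> t)
      (rot (metric M c (coord c (\<gamma> t))) *v velocity c \<gamma> t) *\<^sub>R (rot (metric M c (coord c (\<gamma> t))) *v velocity c \<gamma> t)"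
proof -
  note at = riemannian_manifold_atlas[OF M]
  have ch: "is_chart c" using smooth_atlasD(1)[OF at] c by auto
  interpret surface_metric "cimg c" "metric M c" by (rule surface_metric_chart) fact+
  define x where "x = coord c (\<gamma> t)"
  define v where "v = velocity c \<gamma> t"
  define a where "a = vector_derivative (velocity c \<gamma>) (at t)"
  define K where "K = {t \<in> I. \<gamma> t \<in> cdom c}"
  have K: "open K" "smooth_on K (coord c \<circ> \<gamma>)" "t \<in> K"
    using smooth_curve_chart[OF \<gamma>(1) I M c(1)] t c by (simp_all add: K_def)
  have x: "x \<in> cimg c" by (simp add: x_def is_chartD(4)[OF ch c(2)])
  have unit: "mform (metric M c (coord c (\<gamma> s))) (velocity c \<gamma> s) (velocity c \<gamma> s) = 1" if "s \<in> K" for s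
    using \<gamma>(2) c that by (auto simp: unit_speed_def K_def)
  have dx: "((\<lambda>s. coord c (\<gamma> s)) has_derivative (\<lambda>h. h *\<^sub>R v)) (at t)"
    using smooth_on_has_vector_derivative[OF K(2,3)] by (simp add: v_def velocity_def has_vector_derivative_def o_def)
  have "smooth_on K (velocity c \<gamma>)"
    unfolding velocity_eq by (rule smooth_on_vector_derivative[OF K(1,2)])
  from smooth_on_has_vector_derivative[OF this K(3)]
  have dv: "(velocity c \<gamma> has_derivative (\<lambda>h. h *\<^sub>R a)) (at t)"
    by (simp add: a_def has_vector_derivative_def)
  define G where "G = frechet_derivative (metric M c) (at x)"
  have G: "(metric M c has_derivative G) (at x)"
    unfolding G_def by (rule smooth_on_derivative[OF smooth_g x])
  have "((\<lambda>s. metric M c (coord c (\<gamma> s))) has_derivative (\<lambda>h. G (h *\<^sub>R v))) (at t)"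
    using diff_chain_at[OF dx, of "metric M c" G] G by (simp add: o_def x_def)
  from has_derivative_mform[OF this dv dv]
  have 1: "((\<lambda>s. mform (metric M c (coord c (\<gamma> s))) (velocity c \<gamma> s) (velocity c \<gamma> s)) has_derivative
     (\<lambda>h. mform (G (h *\<^sub>R v)) v v + mform (metric M c x) (h *\<^sub>R a) v + mform (metric M c x) v (h *\<^sub>R a))) (at t)"
    by (simp add: v_def x_def)
  have 2: "((\<lambda>s. mform (metric M c (coord c (\<gamma> s))) (velocity c \<gamma> s) (velocity c \<gamma> s)) has_derivative (\<lambda>h. 0)) (at t)"
    by (rule has_derivative_transform_within_open[OF has_derivative_const[of 1] K(1,3)]) (simp add: unit)
  have "mform (metric M c x) v a = mform (metric M c x) a v"
    by (simp add: mform_2 sym[OF x])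
  with fun_cong[OF has_derivative_unique[OF 1 2], of 1]
  have "mform (G v) v v + 2 * mform (metric M c x) a v = 0" by simp
  then have "mform (metric M c x) (acceleration M c \<gamma> t) v = 0"
    unfolding acceleration_eq x_def[symmetric] v_def[symmetric] a_def[symmetric] mform_covariant_acceleration[OF x] G_def
    by simp
  then show ?thesis
    using orthogonal_eq_rot[OF x, of v "acceleration M c \<gamma> t"] unit[OF K(3)] unfolding x_def v_def by simp
qed

text \<open>Supplies the functions that the curvature bound speaks of. They must serve all charts at
  once: acceleration transforms like a vector, and so does the rotated velocity because transitions
  preserve orientation.\<close>

lemma exists_curvature:
  fixes M :: "('a::topological_space, 2) manifold"
  assumes M: "riemannian_manifold M" "oriented_atlas (charts M)"
    and I: "open I" and \<gamma>: "smooth_curve M I \<gamma>" "unit_speed M I \<gamma>"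
  shows "\<exists>k. has_curvature M I \<gamma> k"
proof -
  note at = riemannian_manifold_atlas[OF M(1)]
  \<comment> \<open>The component along the unit normal in chart \<open>c\<close>; the function
    sought uses the chart chosen at \<open>\<gamma> t\<close>.\<close>
  define \<kappa> where "\<kappa> c t = mform (metric M c (coord c (\<gamma> t))) (acceleration M c \<gamma> t)
      (rot (metric M c (coord c (\<gamma> t))) *v velocity c \<gamma> t)" for c t
  have "acceleration M d \<gamma> t = \<kappa> (chart_at (charts M) (\<gamma> t)) t *\<^sub>R (rot (metric M d (coord d (\<gamma> t))) *v velocity d \<gamma> t)"
    if t: "t \<in> I" and d: "d \<in> charts M" "\<gamma> t \<in> cdom d" for t d
  proof -
    define c where "c = chart_at (charts M) (\<gamma> t)"
    have c: "c \<in> charts M" "\<gamma> t \<in> cdom c" using chart_at[OF at] by (simp_all add: c_def)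
    interpret T: surface_isometry "overlap c d" "metric M c" "cimg d" "metric M d" "transition c d"
      by (rule surface_isometry_transition[OF M(1) c(1) d(1)])
    define K where "K = {t \<in> I. \<gamma> t \<in> cdom c} \<inter> {t \<in> I. \<gamma> t \<in> cdom d}"
    interpret C: curve_in_two_charts c d K \<gamma>
    proof
      show "is_chart c" "is_chart d" "smooth_on (overlap c d) (transition c d)"
        using smooth_atlasD[OF at] c d by auto
      show "open K" unfolding K_def
        by (intro open_Int smooth_curve_chart(1)[OF \<gamma>(1) I M(1)] c d)
      show "smooth_on K (coord c \<circ> \<gamma>)"
        by (rule smooth_on_subset[OF smooth_curve_chart(2)[OF \<gamma>(1) I M(1) c(1)]]) (auto simp: K_def)
    qed (auto simp: K_def)
    have tK: "t \<in> K" using t c d by (simp add: K_def)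
    note ov = C.coord_in_overlap[OF tK]
    have pos: "det (matrix (frechet_derivative (transition c d) (at (coord c (\<gamma> t))))) > 0"
      using M(2) c d ov by (auto simp: oriented_atlas_def)
    have e: "transition c d (coord c (\<gamma> t)) = coord d (\<gamma> t)"
      by (rule transition_coord[OF C.c c(2)])
    have "acceleration M d \<gamma> t = frechet_derivative (transition c d) (at (coord c (\<gamma> t))) (acceleration M c \<gamma> t)"
      unfolding acceleration_eq C.velocity_transition[OF tK] C.derivative_velocity_transition[OF tK] e[symmetric]
      by (rule T.covariant_acceleration_T[OF ov])
    also have "acceleration M c \<gamma> t = \<kappa> c t *\<^sub>R (rot (metric M c (coord c (\<gamma> t))) *v velocity c \<gamma> t)"
      unfolding \<kappa>_def by (rule acceleration_normal[OF M(1) I \<gamma> t c])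
    finally show ?thesis
      by (simp add: linear_cmul[OF T.linear_T[OF ov]] T.rot_T[OF ov pos] e C.velocity_transition[OF tK] c_def[symmetric])
  qed
  then have "has_curvature M I \<gamma> (\<lambda>t. \<kappa> (chart_at (charts M) (\<gamma> t)) t)"
    by (simp add: has_curvature_def)
  then show ?thesis by blast
qed

section \<open>Splitting coordinates\<close>

lemma has_derivative_vector2:
  assumes "(\<sigma> has_derivative \<sigma>') F" "(\<tau> has_derivative \<tau>') F"
  shows "((\<lambda>x. vector [\<sigma> x, \<tau> x] :: real ^ 2) has_derivative (\<lambda>h. vector [\<sigma>' h, \<tau>' h])) F"
proof -
  have e: "vector [a, b] = a *\<^sub>R axis 1 1 + b *\<^sub>R (axis 2 1 :: real ^ 2)" for a b
    by (simp add: vec_eq_iff forall_2 axis_def)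
  show ?thesis
    unfolding e by (intro has_derivative_add has_derivative_scaleR_left assms)
qed

lemma smooth_on_vector2:
  assumes "open U" "smooth_on U \<sigma>" "smooth_on U \<tau>"
  shows "smooth_on U (\<lambda>x. vector [\<sigma> x, \<tau> x] :: real ^ 2)"
proof -
  have e: "vector [a, b] = a *\<^sub>R axis 1 1 + b *\<^sub>R (axis 2 1 :: real ^ 2)" for a b
    by (simp add: vec_eq_iff forall_2 axis_def)
  show ?thesis
    unfolding e by (intro smooth_on_add smooth_on_scaleR smooth_on_const assms)
qed

text \<open>The inverse function theorem, with the image cut down to a box so that one coordinate
  can vary over an interval while the other is fixed.\<close>

lemma local_diffeomorphism_2:
  fixes \<sigma> \<tau> :: "real ^ 2 \<Rightarrow> real"
  assumes W: "open W" "x0 \<in> W" and \<sigma>: "smooth_on W \<sigma>" and \<tau>: "smooth_on W \<tau>"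
    and det: "partial 1 \<sigma> x0 * partial 2 \<tau> x0 - partial 2 \<sigma> x0 * partial 1 \<tau> x0 \<noteq> 0"
  obtains U \<delta> N where "open U" "x0 \<in> U" "U \<subseteq> W" "\<delta> > 0"
    "homeomorphism U {z :: real ^ 2. z $ 1 \<in> {\<sigma> x0 - \<delta><..<\<sigma> x0 + \<delta>} \<and> z $ 2 \<in> {\<tau> x0 - \<delta><..<\<tau> x0 + \<delta>}} (\<lambda>x. vector [\<sigma> x, \<tau> x] :: real ^ 2) N"
    "smooth_on {z :: real ^ 2. z $ 1 \<in> {\<sigma> x0 - \<delta><..<\<sigma> x0 + \<delta>} \<and> z $ 2 \<in> {\<tau> x0 - \<delta><..<\<tau> x0 + \<delta>}} N"
proof -
  define T where "T x = (vector [\<sigma> x, \<tau> x] :: real ^ 2)" for x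
  have T: "smooth_on W T" unfolding T_def by (rule smooth_on_vector2[OF W(1) \<sigma> \<tau>])
  \<comment> \<open>\<open>inverse_function_theorem\<close> expects the derivative as a continuous
    family of bounded linear maps.\<close>
  define D where "D x = Blinfun (frechet_derivative T (at x))" for x
  have dT: "(T has_derivative frechet_derivative T (at x)) (at x)" if "x \<in> W" for x
    by (rule smooth_on_derivative[OF T that])
  have D: "blinfun_apply (D x) = frechet_derivative T (at x)" if "x \<in> W" for x
    unfolding D_def using has_derivative_bounded_linear[OF dT[OF that]] by (rule bounded_linear_Blinfun_apply)
  have DT: "frechet_derivative T (at x) v = vector [frechet_derivative \<sigma> (at x) v, frechet_derivative \<tau> (at x) v]" if "x \<in> W" for x v
    using fun_cong[OF frechet_derivative_at[OF has_derivative_vector2[OF smooth_on_derivative[OF \<sigma> that] smooth_on_derivative[OF \<tau> that]], folded T_def], of v]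
    by simp
  have dT': "(T has_derivative blinfun_apply (D x)) (at x)" if "x \<in> W" for x
    using dT[OF that] D[OF that] by simp
  have cont: "continuous_on W D"
  proof (rule continuous_on_blinfun_componentwise)
    fix i :: "real ^ 2"
    have "continuous_on W (\<lambda>x. frechet_derivative T (at x) i)"
      by (rule smooth_on_imp_continuous_on[OF smooth_on_frechet_derivative[OF T]])
    then show "continuous_on W (\<lambda>x. blinfun_apply (D x) i)"
      by (rule continuous_on_eq) (simp add: D)
  qed
  define s1 s2 t1 t2 where st: "s1 = partial 1 \<sigma> x0" "s2 = partial 2 \<sigma> x0" "t1 = partial 1 \<tau> x0" "t2 = partial 2 \<tau> x0"
  define \<Delta> where "\<Delta> = s1 * t2 - s2 * t1"
  have \<Delta>: "\<Delta> \<noteq> 0" using det by (simp add: \<Delta>_def st)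
  have lin: "frechet_derivative \<sigma> (at x0) v = v $ 1 * s1 + v $ 2 * s2" "frechet_derivative \<tau> (at x0) v = v $ 1 * t1 + v $ 2 * t2" for v
    using linear_real2[OF has_derivative_linear[OF smooth_on_derivative[OF \<sigma> W(2)]], of v]
      linear_real2[OF has_derivative_linear[OF smooth_on_derivative[OF \<tau> W(2)]], of v]
    by (simp_all add: st partial_def)
  \<comment> \<open>The adjugate of the Jacobian matrix at \<open>x0\<close> divided by its
    determinant, giving a left inverse of \<open>D x0\<close>.\<close>
  define M :: "real ^ 2 ^ 2" where "M = vector [vector [t2 / \<Delta>, - s2 / \<Delta>], vector [- t1 / \<Delta>, s1 / \<Delta>]]"
  define inv where "inv = Blinfun ((*v) M)"
  have inv: "blinfun_apply inv = (*v) M"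
    unfolding inv_def by (rule bounded_linear_Blinfun_apply) simp
  have invD: "inv o\<^sub>L D x0 = id_blinfun"
  proof (rule blinfun_eqI)
    fix v :: "real ^ 2"
    have "(t2 / \<Delta>) * (v $ 1 * s1 + v $ 2 * s2) + (- s2 / \<Delta>) * (v $ 1 * t1 + v $ 2 * t2) = v $ 1"
      "(- t1 / \<Delta>) * (v $ 1 * s1 + v $ 2 * s2) + (s1 / \<Delta>) * (v $ 1 * t1 + v $ 2 * t2) = v $ 2"
      using \<Delta> by (simp_all add: divide_simps) (simp_all add: \<Delta>_def algebra_simps)
    then show "blinfun_apply (inv o\<^sub>L D x0) v = blinfun_apply id_blinfun v"
      by (simp add: inv D[OF W(2)] DT[OF W(2)] lin vec_eq_iff forall_2 matrix_vector_mult_def sum_2 M_def)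
  qed
  obtain U0 V0 N N' where IFT: "open U0" "U0 \<subseteq> W" "x0 \<in> U0" "open V0" "T x0 \<in> V0" "homeomorphism U0 V0 T N"
    "\<And>y. y \<in> V0 \<Longrightarrow> (N has_derivative N' y) (at y)"
    by (rule inverse_function_theorem[OF W(1) dT' cont W(2) invD]) (assumption, rule that, assumption+)
  define B where "B \<delta> = {z :: real ^ 2. z $ 1 \<in> {\<sigma> x0 - \<delta><..<\<sigma> x0 + \<delta>} \<and> z $ 2 \<in> {\<tau> x0 - \<delta><..<\<tau> x0 + \<delta>}}" for \<delta>
  obtain e where e: "e > 0" "ball (T x0) e \<subseteq> V0" using IFT(4,5) open_contains_ball by blast
  \<comment> \<open>Two coordinates deviate by less than \<open>e / 2\<close> each, and the norm is
    at most the sum of the deviations.\<close>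
  define \<delta> where "\<delta> = e / 2"
  have sub: "B \<delta> \<subseteq> V0"
  proof
    fix z assume z: "z \<in> B \<delta>"
    have "norm (z - T x0) \<le> (\<Sum>i\<in>UNIV. \<bar>(z - T x0) $ i\<bar>)" by (rule norm_le_l1_cart)
    also have "\<dots> < e" using z by (simp add: sum_2 B_def T_def \<delta>_def abs_if field_simps)
    finally show "z \<in> V0" using e by (auto simp: dist_norm norm_minus_commute)
  qed
  have oB: "open (B \<delta>)"
  proof -
    have "B \<delta> = (\<lambda>z. z $ 1) -` {\<sigma> x0 - \<delta><..<\<sigma> x0 + \<delta>} \<inter> (\<lambda>z. z $ 2) -` {\<tau> x0 - \<delta><..<\<tau> x0 + \<delta>}"
      by (auto simp: B_def)
    then show ?thesis by (auto intro!: open_Int open_vimage continuous_intros)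
  qed
  define U where "U = U0 \<inter> T -` B \<delta>"
  have TN: "T (N y) = y" "N y \<in> U0" if "y \<in> V0" for y
    using IFT(6) that by (auto simp: homeomorphism_def)
  have img: "T ` U = B \<delta>"
    using TN sub by (force simp: U_def image_iff)
  have "homeomorphism U (B \<delta>) T N"
    by (rule homeomorphism_of_subsets[OF IFT(6) _ _ img]) (use sub in \<open>auto simp: U_def\<close>)
  moreover have "open U" unfolding U_def
    by (rule continuous_open_preimage[OF _ IFT(1) oB])
      (use IFT(2) smooth_on_imp_continuous_on[OF T] continuous_on_subset in blast)
  moreover have "x0 \<in> U" using IFT(3) e by (simp add: U_def B_def T_def \<delta>_def)
  moreover have "smooth_on V0 N"
    by (rule smooth_on_inverse_function[OF W(1) T IFT(4)]) (use TN IFT in auto)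
  then have "smooth_on (B \<delta>) N" using sub by (rule smooth_on_subset)
  moreover have "\<delta> > 0" using e by (simp add: \<delta>_def)
  ultimately show thesis
    using that[of U \<delta> N] IFT(2) unfolding T_def B_def U_def by auto
qed

text \<open>Moving along the second coordinate keeps \<open>\<sigma> (N z) = z $ 1\<close> fixed, so
  the velocity lies in the kernel of the derivative of \<sigma>, hence of that of \<open>f\<close>.
  A vanishing derivative on an interval forces constancy.\<close>

lemma constant_along_second:
  fixes f :: "real ^ 2 \<Rightarrow> 'b::euclidean_space" and N :: "real ^ 2 \<Rightarrow> real ^ 2"
  assumes W: "smooth_on W f" "smooth_on W \<sigma>" and N: "smooth_on B N" "N ` B \<subseteq> W"
    and B: "open B" "B = {z :: real ^ 2. z $ 1 \<in> I \<and> z $ 2 \<in> J}" "is_interval J"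
    and \<sigma>: "\<And>z. z \<in> B \<Longrightarrow> \<sigma> (N z) = z $ 1"
    and ker: "\<And>x v. x \<in> W \<Longrightarrow> frechet_derivative \<sigma> (at x) v = 0 \<Longrightarrow> frechet_derivative f (at x) v = 0"
    and st: "s \<in> I" "t \<in> J" "t' \<in> J"
  shows "f (N (vector [s, t])) = f (N (vector [s, t']))"
proof -
  let ?z = "\<lambda>t. vector [s, t] :: real ^ 2"
  have "((\<lambda>t. f (N (?z t))) has_derivative (\<lambda>h. 0)) (at t within J)" if t: "t \<in> J" for t
  proof -
    have z: "?z t \<in> B" using st t by (simp add: B)
    then have x: "N (?z t) \<in> W" using N by auto
    have dz: "(?z has_derivative (\<lambda>h. vector [0, h])) (at t)"
      by (rule has_derivative_vector2) (auto intro!: derivative_intros)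
    note dN = smooth_on_derivative[OF N(1) z]
    note df = smooth_on_derivative[OF W(1) x]
    note ds = smooth_on_derivative[OF W(2) x]
    define dN' where "dN' = frechet_derivative N (at (?z t))"
    have "((\<lambda>z. \<sigma> (N z)) has_derivative (\<lambda>h. frechet_derivative \<sigma> (at (N (?z t))) (dN' h))) (at (?z t))"
      using diff_chain_at[OF dN ds] by (simp add: o_def dN'_def)
    then have 1: "((\<lambda>z. z $ 1) has_derivative (\<lambda>h. frechet_derivative \<sigma> (at (N (?z t))) (dN' h))) (at (?z t))"
      by (rule has_derivative_transform_within_open[OF _ B(1) z]) (simp add: \<sigma>)
    have "frechet_derivative \<sigma> (at (N (?z t))) (dN' h) = h $ 1" for h
      by (rule fun_cong[OF has_derivative_unique[OF 1 has_derivative_nth[OF has_derivative_ident]]])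
    then have 0: "frechet_derivative f (at (N (?z t))) (dN' (vector [0, h])) = 0" for h
      by (intro ker x) simp
    have dNz: "((\<lambda>t. N (?z t)) has_derivative (\<lambda>h. dN' (vector [0, h]))) (at t)"
      using diff_chain_at[OF dz dN] by (simp add: o_def dN'_def)
    have "((\<lambda>t. f (N (?z t))) has_derivative (\<lambda>h. frechet_derivative f (at (N (?z t))) (dN' (vector [0, h])))) (at t)"
      using diff_chain_at[OF dNz df] by (simp add: o_def)
    then show ?thesis
      by (simp add: 0 has_derivative_at_withinI)
  qed
  from has_derivative_zero_unique[OF is_interval_convex[OF B(3)] this st(2,3)]
  show ?thesis by simp
qed

text \<open>In the coordinates \<open>(\<sigma>, \<tau>)\<close> the map \<open>f\<close> has no derivative in the second direction, hence on a
  box it depends on the first coordinate only; likewise \<open>h\<close> and the second coordinate.\<close>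

lemma split_coordinates:
  fixes f h :: "real ^ 2 \<Rightarrow> 'b::euclidean_space" and \<sigma> \<tau> :: "real ^ 2 \<Rightarrow> real"
  assumes W: "open W" "x0 \<in> W" and \<sigma>: "smooth_on W \<sigma>" and \<tau>: "smooth_on W \<tau>"
    and f: "smooth_on W f" and h: "smooth_on W h"
    and det: "partial 1 \<sigma> x0 * partial 2 \<tau> x0 - partial 2 \<sigma> x0 * partial 1 \<tau> x0 \<noteq> 0"
    and ker_f: "\<And>x v. x \<in> W \<Longrightarrow> frechet_derivative \<sigma> (at x) v = 0 \<Longrightarrow> frechet_derivative f (at x) v = 0"
    and ker_h: "\<And>x v. x \<in> W \<Longrightarrow> frechet_derivative \<tau> (at x) v = 0 \<Longrightarrow> frechet_derivative h (at x) v = 0"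
  obtains U I J N A B where "open U" "x0 \<in> U" "U \<subseteq> W" "open I" "is_interval I" "\<sigma> x0 \<in> I" "open J" "is_interval J" "\<tau> x0 \<in> J"
    "homeomorphism U {z :: real ^ 2. z $ 1 \<in> I \<and> z $ 2 \<in> J} (\<lambda>x. vector [\<sigma> x, \<tau> x] :: real ^ 2) N"
    "smooth_on {z :: real ^ 2. z $ 1 \<in> I \<and> z $ 2 \<in> J} N"
    "smooth_on I A" "smooth_on J B" "\<And>x. x \<in> U \<Longrightarrow> f x = A (\<sigma> x)" "\<And>x. x \<in> U \<Longrightarrow> h x = B (\<tau> x)"
proof -
  obtain U \<delta> N where U: "open U" "x0 \<in> U" "U \<subseteq> W" "\<delta> > 0"
    "homeomorphism U {z :: real ^ 2. z $ 1 \<in> {\<sigma> x0 - \<delta><..<\<sigma> x0 + \<delta>} \<and> z $ 2 \<in> {\<tau> x0 - \<delta><..<\<tau> x0 + \<delta>}} (\<lambda>x. vector [\<sigma> x, \<tau> x] :: real ^ 2) N"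
    "smooth_on {z :: real ^ 2. z $ 1 \<in> {\<sigma> x0 - \<delta><..<\<sigma> x0 + \<delta>} \<and> z $ 2 \<in> {\<tau> x0 - \<delta><..<\<tau> x0 + \<delta>}} N"
    by (rule local_diffeomorphism_2[OF W \<sigma> \<tau> det])
  define I where "I = {\<sigma> x0 - \<delta><..<\<sigma> x0 + \<delta>}"
  define J where "J = {\<tau> x0 - \<delta><..<\<tau> x0 + \<delta>}"
  define Box where "Box = {z :: real ^ 2. z $ 1 \<in> I \<and> z $ 2 \<in> J}"
  have hom: "homeomorphism U Box (\<lambda>x. vector [\<sigma> x, \<tau> x] :: real ^ 2) N" and sN: "smooth_on Box N"
    using U(5,6) by (simp_all add: I_def J_def Box_def)
  have IJ: "open I" "open J" "is_interval I" "is_interval J" "\<sigma> x0 \<in> I" "\<tau> x0 \<in> J"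
    using U(4) by (simp_all add: I_def J_def is_interval_convex_1)
  have oB: "open Box"
  proof -
    have "Box = (\<lambda>z. z $ 1) -` I \<inter> (\<lambda>z. z $ 2) -` J"
      by (auto simp: Box_def)
    then show ?thesis using IJ by (auto intro!: open_Int open_vimage continuous_intros)
  qed
  have N: "N ` Box = U" and NT: "\<And>x. x \<in> U \<Longrightarrow> N (vector [\<sigma> x, \<tau> x]) = x"
    and TN: "\<And>z. z \<in> Box \<Longrightarrow> vector [\<sigma> (N z), \<tau> (N z)] = z"
    and TU: "\<And>x. x \<in> U \<Longrightarrow> vector [\<sigma> x, \<tau> x] \<in> Box"
    using hom by (auto simp: homeomorphism_def)
  have \<sigma>N: "\<sigma> (N z) = z $ 1" and \<tau>N: "\<tau> (N z) = z $ 2" if "z \<in> Box" for z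
    using arg_cong[OF TN[OF that], of "\<lambda>v. v $ 1"] arg_cong[OF TN[OF that], of "\<lambda>v. v $ 2"] by simp_all
  define A where "A s = f (N (vector [s, \<tau> x0]))" for s
  define B where "B t = h (N (vector [\<sigma> x0, t]))" for t
  have sm: "smooth_on W' (\<lambda>x. q (N x))" if "smooth_on W q" "W' = Box" for q :: "real ^ 2 \<Rightarrow> 'b" and W'
    unfolding that(2) by (rule smooth_on_compose[OF oB W(1) _ sN that(1)]) (use N U(3) in auto)
  have A: "smooth_on I A"
    unfolding A_def[abs_def]
    by (rule smooth_on_compose[OF IJ(1) oB _ smooth_on_vector2[OF IJ(1) smooth_on_bounded_linear[OF IJ(1) bounded_linear_ident] smooth_on_const[OF IJ(1)]] sm[OF f refl]])
      (use IJ in \<open>auto simp: Box_def\<close>)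
  have B: "smooth_on J B"
    unfolding B_def[abs_def]
    by (rule smooth_on_compose[OF IJ(2) oB _ smooth_on_vector2[OF IJ(2) smooth_on_const[OF IJ(2)] smooth_on_bounded_linear[OF IJ(2) bounded_linear_ident]] sm[OF h refl]])
      (use IJ in \<open>auto simp: Box_def\<close>)
  have fA: "f x = A (\<sigma> x)" if "x \<in> U" for x
  proof -
    have m: "\<sigma> x \<in> I" "\<tau> x \<in> J" using TU[OF that] by (simp_all add: Box_def)
    have "f (N (vector [\<sigma> x, \<tau> x])) = f (N (vector [\<sigma> x, \<tau> x0]))"
      by (rule constant_along_second[OF f \<sigma> sN _ oB Box_def IJ(4) \<sigma>N ker_f m IJ(6)]) (use N U(3) in auto)
    then show ?thesis by (simp add: NT[OF that] A_def)
  qed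
  have hB: "h x = B (\<tau> x)" if "x \<in> U" for x
  proof -
    have m: "\<sigma> x \<in> I" "\<tau> x \<in> J" using TU[OF that] by (simp_all add: Box_def)
    \<comment> \<open>Exchanging the coordinates reduces the second map to
      \<open>constant_along_second\<close>.\<close>
    define swap :: "real ^ 2 \<Rightarrow> real ^ 2" where "swap z = vector [z $ 2, z $ 1]" for z
    define Box' where "Box' = {z :: real ^ 2. z $ 1 \<in> J \<and> z $ 2 \<in> I}"
    have "Box' = (\<lambda>z. z $ 1) -` J \<inter> (\<lambda>z. z $ 2) -` I" by (auto simp: Box'_def)
    then have oB': "open Box'" using IJ by (auto intro!: open_Int open_vimage continuous_intros)
    have ss: "smooth_on Box' swap"
      unfolding swap_def[abs_def]
      by (intro smooth_on_vector2 oB' smooth_on_nth smooth_on_bounded_linear[OF oB' bounded_linear_ident])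
    have sB: "swap ` Box' \<subseteq> Box" by (auto simp: swap_def Box_def Box'_def)
    have "h (N (swap (vector [\<tau> x, \<sigma> x]))) = h (N (swap (vector [\<tau> x, \<sigma> x0])))"
    proof (rule constant_along_second[OF h \<tau> _ _ oB' Box'_def IJ(3) _ ker_h m(2) m(1) IJ(5)])
      show "smooth_on Box' (\<lambda>z. N (swap z))"
        by (rule smooth_on_compose[OF oB' oB sB ss sN])
      show "(\<lambda>z. N (swap z)) ` Box' \<subseteq> W" using sB N U(3) by auto
      show "\<tau> (N (swap z)) = z $ 1" if "z \<in> Box'" for z
        using \<tau>N[of "swap z"] sB that by (auto simp: swap_def)
    qed
    then show ?thesis by (simp add: NT[OF that] B_def swap_def)
  qed
  show thesis
    by (rule that[OF U(1-3) IJ(1,3,5,2,4,6) hom[unfolded Box_def] sN[unfolded Box_def] A B fA hB])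
qed

text \<open>Applied to the speed of a curve, this yields its arclength function. The set
  \<open>I\<close> is merely open, so the integral is taken on an interval around
  \<open>s0\<close>.\<close>

lemma smooth_antiderivative:
  fixes q :: "real \<Rightarrow> real"
  assumes I: "open I" "s0 \<in> I" and q: "smooth_on I q"
  obtains I1 L where "open I1" "s0 \<in> I1" "I1 \<subseteq> I" "smooth_on I1 L" "\<And>s. s \<in> I1 \<Longrightarrow> (L has_real_derivative q s) (at s)"
proof -
  obtain e where e: "e > 0" "cball s0 e \<subseteq> I" using I open_contains_cball by blast
  define a b where "a = s0 - e" and "b = s0 + e"
  have ab: "{a..b} \<subseteq> I" using e by (auto simp: a_def b_def cball_eq_atLeastAtMost)
  define L where "L s = integral {a..s} q" for s
  have cont: "continuous_on {a..b} q"
    using smooth_on_imp_continuous_on[OF q] ab continuous_on_subset by blast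
  have d: "(L has_real_derivative q s) (at s)" if "s \<in> {a<..<b}" for s
  proof -
    have "(L has_real_derivative q s) (at s within {a..b})"
      unfolding L_def using that by (intro integral_has_real_derivative cont) auto
    then show ?thesis using that by (simp add: at_within_Icc_at)
  qed
  have "smooth_on {a<..<b} L"
  proof (rule smooth_on_SucI)
    show "(L has_derivative (\<lambda>h. q s * h)) (at s)" if "s \<in> {a<..<b}" for s
      using d[OF that] by (simp add: has_field_derivative_def)
    have "smooth_on {a<..<b} q"
      by (rule smooth_on_subset[OF q]) (use ab in auto)
    then show "smooth_on {a<..<b} (\<lambda>s. q s * v)" for v
      by (intro smooth_on_mult smooth_on_const open_greaterThanLessThan)
  qed simp
  then show thesis
    using that[of "{a<..<b}" L] d e ab by (force simp: a_def b_def)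
qed

section \<open>Charts adapted to a splitting\<close>

text \<open>Transitions between the new chart and an atlas chart \<open>d\<close> factor through
  those between \<open>c\<close> and \<open>d\<close>, composed with \<open>N\<close> or with
  \<open>\<Theta>\<close>, and so inherit smoothness in both directions.\<close>

lemma compatible_chart_compose:
  fixes c :: "('s::topological_space, 'n::finite) chart"
  assumes S: "smooth_atlas S" "c \<in> S" and U: "open U" "U \<subseteq> cimg c" and V: "open V"
    and hom: "homeomorphism U V \<Theta> N" and \<Theta>: "smooth_on U \<Theta>" and N: "smooth_on V N"
  defines "c' \<equiv> (cinv c ` U, \<Theta> \<circ> coord c)"
  shows "compatible_chart S c'" "cimg c' = V"
proof -
  note c = smooth_atlasD(1)[OF S(1,2,2)]
  have dom: "cdom c' = cdom c \<inter> coord c -` U"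
  proof -
    have "cinv c ` U = cdom c \<inter> coord c -` U"
    proof
      show "cinv c ` U \<subseteq> cdom c \<inter> coord c -` U"
        using is_chartD(6,7)[OF c] U(2) by auto
      show "cdom c \<inter> coord c -` U \<subseteq> cinv c ` U"
      proof
        fix p assume "p \<in> cdom c \<inter> coord c -` U"
        then show "p \<in> cinv c ` U"
          by (intro image_eqI[of _ _ "coord c p"]) (simp_all add: is_chartD(5)[OF c])
      qed
    qed
    then show ?thesis by (simp add: c'_def)
  qed
  have coord: "coord c' p = \<Theta> (coord c p)" for p by (simp add: c'_def)
  have hom1: "homeomorphism (cdom c') U (coord c) (cinv c)"
  proof (rule homeomorphism_of_subsets[OF is_chartD(3)[OF c] _ U(2)])
    show "coord c ` cdom c' = U"
      using U(2) is_chartD(7)[OF c] by (force simp: c'_def image_image)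
  qed (simp add: dom)
  have hom2: "homeomorphism (cdom c') V (coord c') (cinv c \<circ> N)"
    using homeomorphism_compose[OF hom1 hom] by (simp add: c'_def)
  show img: "cimg c' = V"
    using hom2 by (simp add: cimg_def homeomorphism_def)
  have "inj_on (coord c') (cdom c')"
    using hom2 by (metis homeomorphism_def inj_on_inverseI)
  \<comment> \<open>\<open>cinv\<close> is an \<open>inv_into\<close>; injectivity identifies it
    with the explicit inverse on \<open>V\<close>.\<close>
  have inv: "cinv c' z = cinv c (N z)" if "z \<in> V" for z
  proof -
    have "coord c' (cinv c (N z)) = z" "cinv c (N z) \<in> cdom c'"
      using hom2 that by (auto simp: homeomorphism_def)
    then show ?thesis
      unfolding cinv_def[of c'] using inv_into_f_f[OF \<open>inj_on (coord c') (cdom c')\<close>] by metis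
  qed
  have "open (cdom c')"
    unfolding dom using homeomorphism_cont1[OF is_chartD(3)[OF c]] is_chartD(1)[OF c] U(1)
    by (intro continuous_open_preimage)
  moreover have "homeomorphism (cdom c') V (coord c') (cinv c')"
    by (rule homeomorphism_cong[OF hom2]) (simp_all add: inv)
  ultimately have ch: "is_chart c'"
    using V by (simp add: is_chart_def img)
  have NU: "N z \<in> U" "\<Theta> (N z) = z" if "z \<in> V" for z
    using hom that by (auto simp: homeomorphism_def)
  have "smooth_on (overlap c' d) (transition c' d)" if d: "d \<in> S" for d
  proof -
    note dc = smooth_atlasD[OF S(1,2) d]
    have chd: "is_chart d" using smooth_atlasD(1)[OF S(1) d d] .
    have "z \<in> overlap c' d \<longleftrightarrow> z \<in> V \<and> N z \<in> overlap c d" for z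
      unfolding overlap_iff[OF ch] overlap_iff[OF c] img using inv NU U(2) by auto
    then have o: "overlap c' d \<subseteq> V" "N ` overlap c' d \<subseteq> overlap c d" by auto
    show ?thesis
    proof (rule smooth_on_cong[OF open_overlap[OF ch chd] _ smooth_on_compose[OF open_overlap[OF ch chd] open_overlap[OF c chd] o(2) smooth_on_subset[OF N o(1)] dc(2)]])
      show "transition c d (N z) = transition c' d z" if "z \<in> overlap c' d" for z
        using o that inv by (auto simp: transition_def)
    qed
  qed
  moreover have "smooth_on (overlap d c') (transition d c')" if d: "d \<in> S" for d
  proof -
    note dc = smooth_atlasD[OF S(1) d S(2)]
    have o: "overlap d c' \<subseteq> overlap d c" "transition d c ` overlap d c' \<subseteq> U"
      by (auto simp: overlap_iff[OF dc(1)] transition_def dom)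
    show ?thesis
    proof (rule smooth_on_cong[OF open_overlap[OF dc(1) ch] _ smooth_on_compose[OF open_overlap[OF dc(1) ch] U(1) o(2) smooth_on_subset[OF dc(2) o(1)] \<Theta>]])
      show "\<Theta> (transition d c z) = transition d c' z" for z
        by (simp add: transition_def coord)
    qed
  qed
  ultimately show "compatible_chart S c'"
    using ch by (simp add: compatible_chart_def)
qed

lemma smooth_curve_cinv:
  fixes M :: "('a::topological_space, 'n::finite) manifold"
  assumes at: "smooth_atlas (charts M)" and c: "c \<in> charts M" and I: "open I" and A: "smooth_on I A" "A ` I \<subseteq> cimg c"
  shows "smooth_curve M I (cinv c \<circ> A)"
  unfolding smooth_curve_def
proof (intro conjI ballI)
  note ch = smooth_atlasD(1)[OF at c c]
  show cont: "continuous_on I (cinv c \<circ> A)"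
    by (rule continuous_on_compose[OF smooth_on_imp_continuous_on[OF A(1)] continuous_on_subset[OF homeomorphism_cont2[OF is_chartD(3)[OF ch]] A(2)]])
  fix d assume d: "d \<in> charts M"
  note chd = smooth_atlasD(1)[OF at d d]
  let ?K = "{t \<in> I. (cinv c \<circ> A) t \<in> cdom d}"
  have "?K = I \<inter> (cinv c \<circ> A) -` cdom d" by auto
  then have K: "open ?K" using continuous_open_preimage[OF cont I is_chartD(1)[OF chd]] by simp
  have "smooth_on ?K (\<lambda>t. transition c d (A t))"
    by (rule smooth_on_compose[OF K open_overlap[OF ch chd] _ smooth_on_subset[OF A(1)] smooth_atlasD(2)[OF at c d]])
      (use A(2) in \<open>auto simp: overlap_iff[OF ch]\<close>)
  then show "smooth_on ?K (coord d \<circ> (cinv c \<circ> A))"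
    by (simp add: transition_def o_def)
qed

text \<open>\<open>unit_speed\<close> quantifies over all charts while the speed is known in
  \<open>c\<close>; transitions are isometries and carry it over.\<close>

lemma unit_speed_cinv:
  fixes M :: "('a::topological_space, 2) manifold"
  assumes M: "riemannian_manifold M" and c: "c \<in> charts M" and I: "open I" and A: "smooth_on I A" "A ` I \<subseteq> cimg c"
    and unit: "\<And>t. t \<in> I \<Longrightarrow> mform (metric M c (A t)) (vector_derivative A (at t)) (vector_derivative A (at t)) = 1"
  shows "unit_speed M I (cinv c \<circ> A)"
  unfolding unit_speed_def
proof (intro ballI impI)
  note at = riemannian_manifold_atlas[OF M]
  note ch = smooth_atlasD(1)[OF at c c]
  fix t d assume t: "t \<in> I" and d: "d \<in> charts M" "(cinv c \<circ> A) t \<in> cdom d"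
  have cA: "coord c (cinv c (A s)) = A s" "cinv c (A s) \<in> cdom c" if "s \<in> I" for s
    using is_chartD(6,7)[OF ch] A(2) that by auto
  define K where "K = {t \<in> I. (cinv c \<circ> A) t \<in> cdom d}"
  interpret T: surface_isometry "overlap c d" "metric M c" "cimg d" "metric M d" "transition c d"
    by (rule surface_isometry_transition[OF M c d(1)])
  have K: "open K"
    unfolding K_def by (rule smooth_curve_chart(1)[OF smooth_curve_cinv[OF at c I A] I M d(1)])
  interpret C: curve_in_two_charts c d K "cinv c \<circ> A"
  proof
    show "is_chart c" "is_chart d" "smooth_on (overlap c d) (transition c d)"
      using smooth_atlasD[OF at] c d by auto
    show "smooth_on K (coord c \<circ> (cinv c \<circ> A))"
      by (rule smooth_on_cong[OF K _ smooth_on_subset[OF A(1)]]) (auto simp: K_def cA)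
  qed (use K cA in \<open>auto simp: K_def\<close>)
  have tK: "t \<in> K" using t d by (simp add: K_def)
  note ov = C.coord_in_overlap[OF tK]
  have "(A has_vector_derivative velocity c (cinv c \<circ> A) t) (at t)"
    by (rule has_vector_derivative_transform_within_open[OF C.velocity[OF tK] I t]) (simp add: cA)
  then have v: "velocity c (cinv c \<circ> A) t = vector_derivative A (at t)"
    by (rule vector_derivative_at[symmetric])
  have e: "transition c d (coord c ((cinv c \<circ> A) t)) = coord d ((cinv c \<circ> A) t)"
    by (rule transition_coord[OF ch]) (simp add: cA t)
  show "mform (metric M d (coord d ((cinv c \<circ> A) t))) (velocity d (cinv c \<circ> A) t) (velocity d (cinv c \<circ> A) t) = 1"
    using T.mform_T[OF ov, of "velocity c (cinv c \<circ> A) t" "velocity c (cinv c \<circ> A) t"] unit[OF t]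
    unfolding C.velocity_transition[OF tK] e by (simp add: cA t v)
qed

text \<open>The speed is the square root of a positive smooth function; its antiderivative will be
  the arclength.\<close>

lemma (in surface_metric) smooth_speed:
  assumes I: "open I" and A: "smooth_on I A" "A ` I \<subseteq> U" and nz: "\<And>t. t \<in> I \<Longrightarrow> vector_derivative A (at t) \<noteq> 0"
  obtains q where "smooth_on I q" "\<And>t. t \<in> I \<Longrightarrow> q t > 0"
    "\<And>t. t \<in> I \<Longrightarrow> mform (g (A t)) (vector_derivative A (at t)) (vector_derivative A (at t)) = q t * q t"
proof -
  have pos: "mform (g (A t)) (vector_derivative A (at t)) (vector_derivative A (at t)) > 0" if "t \<in> I" for t
    using A(2) that nz by (intro pos_g) auto
  have gA: "smooth_on I (\<lambda>t. g (A t))"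
    by (rule smooth_on_compose[OF I open_U A(2,1) smooth_g])
  define q where "q t = sqrt (mform (g (A t)) (vector_derivative A (at t)) (vector_derivative A (at t)))" for t
  have "smooth_on I q"
    unfolding q_def[abs_def] using pos unfolding mform_2
    by (intro smooth_on_sqrt smooth_on_add smooth_on_mult smooth_on_nth smooth_on_vector_derivative gA I A(1)) auto
  moreover have "q t > 0" "mform (g (A t)) (vector_derivative A (at t)) (vector_derivative A (at t)) = q t * q t" if "t \<in> I" for t
    using pos[OF that] by (simp_all add: q_def)
  ultimately show thesis by (rule that)
qed

text \<open>Makes the Lagrangian condition a relation between Jacobian determinants.\<close>

lemma (in surface_metric) area_form_eq:
  assumes "x \<in> U"
  shows "area_form (g x) v w = sqrt (det (g x)) * (v $ 1 * w $ 2 - v $ 2 * w $ 1)"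
proof -
  define r where "r = sqrt (det (g x))"
  have r: "r > 0" "r * r = g x $ 1 $ 1 * g x $ 2 $ 2 - g x $ 1 $ 2 * g x $ 1 $ 2"
    using det_pos[OF assms] sym[OF assms] by (simp_all add: r_def det_2)
  have "r * area_form (g x) v w = (r * r) * (v $ 1 * w $ 2 - v $ 2 * w $ 1)"
    using r(1) unfolding r(2) area_form_def rot_def r_def[symmetric]
    by (simp add: mform_2 matrix_vector_mult_def sum_2 sym[OF assms] field_simps)
  then have "r * area_form (g x) v w = r * (r * (v $ 1 * w $ 2 - v $ 2 * w $ 1))"
    by (simp only: mult.assoc)
  with r(1) show ?thesis unfolding r_def[symmetric] by simp
qed

section \<open>Lagrangian immersions of projected rank one\<close>

lemma det_matrix_2:
  fixes L :: "real ^ 2 \<Rightarrow> real ^ 2"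
  shows "det (matrix L) = L (axis 1 1) $ 1 * L (axis 2 1) $ 2 - L (axis 2 1) $ 1 * L (axis 1 1) $ 2"
  by (simp add: det_2 matrix_def)

lemma rep_smooth:
  assumes "smooth_map A B f" "smooth_atlas A" "smooth_atlas B" "c \<in> A" "d \<in> B"
  shows "open (coord c ` (cdom c \<inter> f -` cdom d))" "smooth_on (coord c ` (cdom c \<inter> f -` cdom d)) (rep c d f)"
proof -
  have "open (f -` cdom d)"
    using assms(1) is_chartD(1)[OF smooth_atlasD(1)[OF assms(3,5,5)]] by (auto simp: smooth_map_def intro: open_vimage)
  then show "open (coord c ` (cdom c \<inter> f -` cdom d))"
    by (intro open_coord_image[OF smooth_atlasD(1)[OF assms(2,4,4)]] open_Int is_chartD(1)[OF smooth_atlasD(1)[OF assms(2,4,4)]]) auto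
  show "smooth_on (coord c ` (cdom c \<inter> f -` cdom d)) (rep c d f)"
    using assms by (simp add: smooth_map_def)
qed

text \<open>\<open>rank_at\<close> refers to charts picked by \<open>chart_at\<close>, but
  degeneracy is wanted in given charts. The two coordinate expressions differ by composition with
  transition maps, so one determinant is a multiple of the other.\<close>

lemma det_rep_chart_change:
  fixes f :: "'s::topological_space \<Rightarrow> 'a::topological_space" and A :: "('s, 2) chart set" and B :: "('a, 2) chart set"
  assumes f: "smooth_map A B f" "smooth_atlas A" "smooth_atlas B" and c: "c \<in> A" "c' \<in> A" and d: "d \<in> B" "d' \<in> B"
    and p: "p \<in> cdom c" "p \<in> cdom c'" "f p \<in> cdom d" "f p \<in> cdom d'"
    and 0: "det (matrix (frechet_derivative (rep c' d' f) (at (coord c' p)))) = 0"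
  shows "det (matrix (frechet_derivative (rep c d f) (at (coord c p)))) = 0"
proof -
  have ch: "is_chart c" "is_chart c'" "is_chart d" "is_chart d'"
    using smooth_atlasD(1)[OF f(2)] smooth_atlasD(1)[OF f(3)] c d by blast+
  define Z where "Z = coord c ` (cdom c \<inter> (cdom c' \<inter> f -` (cdom d \<inter> cdom d')))"
  have "open (f -` (cdom d \<inter> cdom d'))"
    using f(1) is_chartD(1)[OF ch(3)] is_chartD(1)[OF ch(4)] by (auto simp: smooth_map_def intro!: open_vimage)
  then have Z: "open Z"
    unfolding Z_def by (intro open_coord_image[OF ch(1)] open_Int is_chartD(1)[OF ch(1)] is_chartD(1)[OF ch(2)]) auto
  have z: "coord c p \<in> Z" using p by (auto simp: Z_def)
  have t: "transition c c' (coord c p) = coord c' p" by (rule transition_coord[OF ch(1) p(1)])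
  have r: "rep c' d' f (coord c' p) = coord d' (f p)"
    by (simp add: rep_def is_chartD(5)[OF ch(2) p(2)])
  have ov: "coord c p \<in> overlap c c'" "coord d' (f p) \<in> overlap d' d"
    using p by (auto simp: overlap_def)
  have 1: "(transition c c' has_derivative frechet_derivative (transition c c') (at (coord c p))) (at (coord c p))"
    by (rule smooth_on_derivative[OF smooth_atlasD(2)[OF f(2) c] ov(1)])
  have 2: "(rep c' d' f has_derivative frechet_derivative (rep c' d' f) (at (coord c' p))) (at (coord c' p))"
    by (rule smooth_on_derivative[OF rep_smooth(2)[OF f c(2) d(2)]]) (use p in auto)
  have 3: "(transition d' d has_derivative frechet_derivative (transition d' d) (at (coord d' (f p)))) (at (coord d' (f p)))"
    by (rule smooth_on_derivative[OF smooth_atlasD(2)[OF f(3) d(2,1)] ov(2)])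
  define D1 D2 D3 where "D1 = frechet_derivative (transition c c') (at (coord c p))"
    and "D2 = frechet_derivative (rep c' d' f) (at (coord c' p))"
    and "D3 = frechet_derivative (transition d' d) (at (coord d' (f p)))"
  have "(rep c' d' f \<circ> transition c c' has_derivative D2 \<circ> D1) (at (coord c p))"
    unfolding D1_def D2_def by (rule diff_chain_at[OF 1]) (simp add: t 2)
  then have "(transition d' d \<circ> (rep c' d' f \<circ> transition c c') has_derivative D3 \<circ> (D2 \<circ> D1)) (at (coord c p))"
    unfolding D3_def by (rule diff_chain_at) (simp add: t r 3)
  then have "(rep c d f has_derivative D3 \<circ> (D2 \<circ> D1)) (at (coord c p))"
  proof (rule has_derivative_transform_within_open[OF _ Z z])
    fix y assume "y \<in> Z"
    then obtain q where q: "y = coord c q" "q \<in> cdom c" "q \<in> cdom c'" "f q \<in> cdom d" "f q \<in> cdom d'"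
      by (auto simp: Z_def)
    then show "(transition d' d \<circ> (rep c' d' f \<circ> transition c c')) y = rep c d f y"
      using transition_coord[OF ch(1) q(2)] transition_coord[OF ch(4) q(5)] is_chartD(5)[OF ch(1) q(2)] is_chartD(5)[OF ch(2) q(3)]
      by (simp add: rep_def)
  qed
  from frechet_derivative_at[OF this, symmetric]
  have "frechet_derivative (rep c d f) (at (coord c p)) = D3 \<circ> (D2 \<circ> D1)" .
  moreover have "linear D1" "linear D2" "linear D3"
    using 1 2 3 has_derivative_linear unfolding D1_def D2_def D3_def by blast+
  ultimately show ?thesis
    using 0 by (simp add: matrix_compose linear_compose det_mul D2_def[symmetric])
qed

lemma has_derivative_prep:
  fixes \<Phi> :: "'s::topological_space \<Rightarrow> 'a::topological_space \<times> 'b::topological_space"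
    and A :: "('s, 2) chart set" and B1 :: "('a, 2) chart set" and B2 :: "('b, 2) chart set"
  assumes "smooth_atlas A" "smooth_atlas B1" "smooth_atlas B2"
    and "smooth_map A B1 (fst \<circ> \<Phi>)" "smooth_map A B2 (snd \<circ> \<Phi>)"
    and "c \<in> A" "c1 \<in> B1" "c2 \<in> B2" and p: "p \<in> cdom c" "\<Phi> p \<in> cdom c1 \<times> cdom c2"
  shows "frechet_derivative (prep c c1 c2 \<Phi>) (at (coord c p)) v
    = join (frechet_derivative (rep c c1 (fst \<circ> \<Phi>)) (at (coord c p)) v) (frechet_derivative (rep c c2 (snd \<circ> \<Phi>)) (at (coord c p)) v)"
proof -
  have "(rep c c1 (fst \<circ> \<Phi>) has_derivative frechet_derivative (rep c c1 (fst \<circ> \<Phi>)) (at (coord c p))) (at (coord c p))"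
    by (rule smooth_on_derivative[OF rep_smooth(2)[OF assms(4,1,2,6,7)]]) (use p in \<open>auto simp: mem_Times_iff\<close>)
  moreover have "(rep c c2 (snd \<circ> \<Phi>) has_derivative frechet_derivative (rep c c2 (snd \<circ> \<Phi>)) (at (coord c p))) (at (coord c p))"
    by (rule smooth_on_derivative[OF rep_smooth(2)[OF assms(5,1,3,6,8)]]) (use p in \<open>auto simp: mem_Times_iff\<close>)
  ultimately have "(prep c c1 c2 \<Phi> has_derivative (\<lambda>v. join (frechet_derivative (rep c c1 (fst \<circ> \<Phi>)) (at (coord c p)) v)
     (frechet_derivative (rep c c2 (snd \<circ> \<Phi>)) (at (coord c p)) v))) (at (coord c p))"
    unfolding prep_def[abs_def] by (rule has_derivative_join)
  from fun_cong[OF frechet_derivative_at[OF this, symmetric]] show ?thesis .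
qed

lemma det_zero_of_rank_one:
  fixes L :: "real ^ 2 ^ 2" assumes "rank L = 1" shows "det L = 0"
  using assms by (simp add: det_eq_0_rank)

locale rank_one_lagrangian =
  fixes \<Sigma>1 :: "('a::topological_space, 2) manifold"
    and \<Sigma>2 :: "('b::topological_space, 2) manifold"
    and S :: "('s::topological_space, 2) chart set"
    and \<Phi> :: "'s \<Rightarrow> 'a \<times> 'b"
    and \<epsilon> :: real
  assumes \<Sigma>1: "riemannian_manifold \<Sigma>1" and \<Sigma>2: "riemannian_manifold \<Sigma>2"
    and eps: "\<epsilon> \<in> {1, -1}" and S: "smooth_atlas S"
    and rank: "projected_rank_one \<Sigma>1 \<Sigma>2 S \<Phi>" and lag: "lagrangian_immersion \<epsilon> \<Sigma>1 \<Sigma>2 S \<Phi>"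
begin

lemmas at1 = riemannian_manifold_atlas[OF \<Sigma>1]
lemmas at2 = riemannian_manifold_atlas[OF \<Sigma>2]

lemma smooth_components: "smooth_map S (charts \<Sigma>1) (fst \<circ> \<Phi>)" "smooth_map S (charts \<Sigma>2) (snd \<circ> \<Phi>)"
  using lag by (auto simp: lagrangian_immersion_def immersion_def)

lemma inj_prep:
  assumes "c \<in> S" "c1 \<in> charts \<Sigma>1" "c2 \<in> charts \<Sigma>2" "p \<in> cdom c" "\<Phi> p \<in> cdom c1 \<times> cdom c2"
  shows "inj (frechet_derivative (prep c c1 c2 \<Phi>) (at (coord c p)))"
  using lag[unfolded lagrangian_immersion_def immersion_def, THEN conjunct1, THEN conjunct2, THEN conjunct2, rule_format, OF assms] .

text \<open>The Lagrangian condition says \<open>\<phi>\<^sup>*\<omega>\<^sub>1 = - \<epsilon> \<psi>\<^sup>*\<omega>\<^sub>2\<close>, so if one projection is degenerate at a point then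
  so is the other.\<close>

lemma det_components_zero:
  assumes c: "c \<in> S" "c1 \<in> charts \<Sigma>1" "c2 \<in> charts \<Sigma>2" and p: "p \<in> cdom c" "\<Phi> p \<in> cdom c1 \<times> cdom c2"
  shows "det (matrix (frechet_derivative (rep c c1 (fst \<circ> \<Phi>)) (at (coord c p)))) = 0"
    and "det (matrix (frechet_derivative (rep c c2 (snd \<circ> \<Phi>)) (at (coord c p)))) = 0"
proof -
  interpret g1: surface_metric "cimg c1" "metric \<Sigma>1 c1" by (rule surface_metric_chart[OF \<Sigma>1 c(2)])
  interpret g2: surface_metric "cimg c2" "metric \<Sigma>2 c2" by (rule surface_metric_chart[OF \<Sigma>2 c(3)])
  define D1 where "D1 = frechet_derivative (rep c c1 (fst \<circ> \<Phi>)) (at (coord c p))"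
  define D2 where "D2 = frechet_derivative (rep c c2 (snd \<circ> \<Phi>)) (at (coord c p))"
  have p12: "fst (\<Phi> p) \<in> cdom c1" "snd (\<Phi> p) \<in> cdom c2" using p(2) by (auto simp: mem_Times_iff)
  note ch = smooth_atlasD(1)[OF S c(1,1)] smooth_atlasD(1)[OF at1 c(2,2)] smooth_atlasD(1)[OF at2 c(3,3)]
  have F: "left_part (prep c c1 c2 \<Phi> (coord c p)) = coord c1 (fst (\<Phi> p))" "right_part (prep c c1 c2 \<Phi> (coord c p)) = coord c2 (snd (\<Phi> p))"
    by (simp_all add: prep_def rep_def is_chartD(5)[OF ch(1) p(1)])
  have x: "coord c1 (fst (\<Phi> p)) \<in> cimg c1" "coord c2 (snd (\<Phi> p)) \<in> cimg c2"
    using is_chartD(4)[OF ch(2)] is_chartD(4)[OF ch(3)] p12 by auto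
  have "product_symplectic \<epsilon> (metric \<Sigma>1 c1) (metric \<Sigma>2 c2) (prep c c1 c2 \<Phi> (coord c p))
     (frechet_derivative (prep c c1 c2 \<Phi>) (at (coord c p)) (axis 1 1)) (frechet_derivative (prep c c1 c2 \<Phi>) (at (coord c p)) (axis 2 1)) = 0"
    using lag[unfolded lagrangian_immersion_def Let_def, THEN conjunct2, rule_format, OF c p] .
  then have "sqrt (det (metric \<Sigma>1 c1 (coord c1 (fst (\<Phi> p))))) * det (matrix D1)
     + \<epsilon> * (sqrt (det (metric \<Sigma>2 c2 (coord c2 (snd (\<Phi> p))))) * det (matrix D2)) = 0"
    unfolding product_symplectic_def has_derivative_prep[OF S at1 at2 smooth_components c p] F
    by (simp add: g1.area_form_eq[OF x(1)] g2.area_form_eq[OF x(2)] det_matrix_2 D1_def D2_def mult.commute)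
  moreover have "det (metric \<Sigma>1 c1 (coord c1 (fst (\<Phi> p)))) > 0" "det (metric \<Sigma>2 c2 (coord c2 (snd (\<Phi> p)))) > 0"
    using g1.det_pos[OF x(1)] g2.det_pos[OF x(2)] by auto
  ultimately have iff: "det (matrix D1) = 0 \<longleftrightarrow> det (matrix D2) = 0"
    using eps by auto
  have "rank_at S (charts \<Sigma>1) (fst \<circ> \<Phi>) p = 1 \<or> rank_at S (charts \<Sigma>2) (snd \<circ> \<Phi>) p = 1"
    using rank by (simp add: projected_rank_one_def)
  then have "det (matrix D1) = 0 \<or> det (matrix D2) = 0"
  proof
    assume "rank_at S (charts \<Sigma>1) (fst \<circ> \<Phi>) p = 1"
    then have "det (matrix D1) = 0"
      unfolding D1_def rank_at_def Let_def
      by (intro det_rep_chart_change[OF smooth_components(1) S at1 c(1) chart_at(1)[OF S] c(2) chart_at(1)[OF at1] p(1) chart_at(2)[OF S] _ chart_at(2)[OF at1]]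
        det_zero_of_rank_one) (simp_all add: p12)
    then show ?thesis ..
  next
    assume "rank_at S (charts \<Sigma>2) (snd \<circ> \<Phi>) p = 1"
    then have "det (matrix D2) = 0"
      unfolding D2_def rank_at_def Let_def
      by (intro det_rep_chart_change[OF smooth_components(2) S at2 c(1) chart_at(1)[OF S] c(3) chart_at(1)[OF at2] p(1) chart_at(2)[OF S] _ chart_at(2)[OF at2]]
        det_zero_of_rank_one) (simp_all add: p12)
    then show ?thesis ..
  qed
  with iff show "det (matrix (frechet_derivative (rep c c1 (fst \<circ> \<Phi>)) (at (coord c p)))) = 0"
    and "det (matrix (frechet_derivative (rep c c2 (snd \<circ> \<Phi>)) (at (coord c p)))) = 0"
    by (simp_all add: D1_def D2_def)
qed

end

text \<open>Together \<open>D1\<close> and \<open>D2\<close> form a 4 by 2 matrix of rank two, so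
  some 2 by 2 minor is nonzero; the vanishing determinants exclude minors within one of the two
  maps.\<close>

lemma exists_transversal_components:
  fixes D1 D2 :: "real ^ 2 \<Rightarrow> real ^ 2"
  assumes lin: "linear D1" "linear D2" and det: "det (matrix D1) = 0" "det (matrix D2) = 0"
    and inj: "inj (\<lambda>v. join (D1 v) (D2 v))"
  obtains a b where "D1 (axis 1 1) $ a * D2 (axis 2 1) $ b - D1 (axis 2 1) $ a * D2 (axis 1 1) $ b \<noteq> 0"
proof (rule ccontr)
  assume "\<not> thesis"
  then have "D1 (axis 1 1) $ a * D2 (axis 2 1) $ b - D1 (axis 2 1) $ a * D2 (axis 1 1) $ b = 0" for a b
    using that by blast
  note minors = this[of 1 1] this[of 1 2] this[of 2 1] this[of 2 2] det[unfolded det_matrix_2]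
  have D: "D1 v $ i = v $ 1 * D1 (axis 1 1) $ i + v $ 2 * D1 (axis 2 1) $ i"
    "D2 v $ i = v $ 1 * D2 (axis 1 1) $ i + v $ 2 * D2 (axis 2 1) $ i" for v i
    using arg_cong[OF linear_real2[OF lin(1), of v], of "\<lambda>w. w $ i"] arg_cong[OF linear_real2[OF lin(2), of v], of "\<lambda>w. w $ i"]
    by simp_all
  have Dv: "D1 (vector [r, s]) $ i = r * D1 (axis 1 1) $ i + s * D1 (axis 2 1) $ i"
    "D2 (vector [r, s]) $ i = r * D2 (axis 1 1) $ i + s * D2 (axis 2 1) $ i" for r s i
    using D[of "vector [r, s]" i] by simp_all
  have z: "v = 0" if "\<And>i. D1 v $ i = 0" "\<And>i. D2 v $ i = 0" for v
  proof -
    have "join (D1 v) (D2 v) = join (D1 0) (D2 0)"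
      using that by (simp add: linear_0 lin vec_eq_iff_Plus)
    then show ?thesis using inj by (simp add: inj_def)
  qed
  \<comment> \<open>Row \<open>i\<close> annihilates this vector, and so do all other rows since
    every minor vanishes. Injectivity then makes the row itself zero.\<close>
  have "vector [- D1 (axis 2 1) $ i, D1 (axis 1 1) $ i] = (0 :: real ^ 2)" for i
  proof (rule z)
    fix k
    show "D1 (vector [- D1 (axis 2 1) $ i, D1 (axis 1 1) $ i]) $ k = 0"
      "D2 (vector [- D1 (axis 2 1) $ i, D1 (axis 1 1) $ i]) $ k = 0"
      unfolding Dv using minors exhaust_2[of i] exhaust_2[of k] by (elim disjE; simp add: algebra_simps)+
  qed
  moreover have "vector [- D2 (axis 2 1) $ i, D2 (axis 1 1) $ i] = (0 :: real ^ 2)" for i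
  proof (rule z)
    fix k
    show "D1 (vector [- D2 (axis 2 1) $ i, D2 (axis 1 1) $ i]) $ k = 0"
      "D2 (vector [- D2 (axis 2 1) $ i, D2 (axis 1 1) $ i]) $ k = 0"
      unfolding Dv using minors exhaust_2[of i] exhaust_2[of k] by (elim disjE; simp add: algebra_simps)+
  qed
  ultimately have "axis 1 1 = (0 :: real ^ 2)"
    by (intro z) (auto simp: vec_eq_iff[of "vector _"] forall_2)
  then show False by (simp add: axis_eq_0_iff)
qed

text \<open>Row \<open>a\<close> is nonzero and the determinant vanishes, so the other row is a
  multiple of it.\<close>

lemma kernel_of_component:
  fixes L :: "real ^ 2 \<Rightarrow> real ^ 2"
  assumes lin: "linear L" and det: "det (matrix L) = 0"
    and nz: "L (axis 1 1) $ a \<noteq> 0 \<or> L (axis 2 1) $ a \<noteq> 0" and v: "L v $ a = 0"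
  shows "L v = 0"
proof -
  have D: "L v $ i = v $ 1 * L (axis 1 1) $ i + v $ 2 * L (axis 2 1) $ i" for i
    using arg_cong[OF linear_real2[OF lin, of v], of "\<lambda>w. w $ i"] by simp
  have m: "L (axis 1 1) $ i * L (axis 2 1) $ a = L (axis 2 1) $ i * L (axis 1 1) $ a" for i
    using det exhaust_2[of i] exhaust_2[of a] unfolding det_matrix_2 by (elim disjE; simp add: algebra_simps)
  have "L (axis 1 1) $ a * L v $ i = 0" "L (axis 2 1) $ a * L v $ i = 0" for i
    using m[of i] v unfolding D by algebra+
  then have "L v $ i = 0" for i using nz by (metis mult_eq_0_iff)
  then show ?thesis by (simp add: vec_eq_iff)
qed

text \<open>That \<open>A\<close> is \<open>B\<close> after \<open>L\<close> is known only at values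
  of \<sigma>, so the chain rule is applied to functions of \<open>y\<close> and the factor
  \<open>\<sigma>' v\<close> is cancelled.\<close>

lemma reparametrized_velocity:
  fixes f :: "'n::real_normed_vector \<Rightarrow> 'b::real_normed_vector"
  assumes W: "open W" "x \<in> W" and eq: "\<And>y. y \<in> W \<Longrightarrow> A (\<sigma> y) = B (L (\<sigma> y))"
    and \<sigma>: "(\<sigma> has_derivative \<sigma>') (at x)" "\<sigma>' v \<noteq> 0"
    and A: "(A has_vector_derivative A') (at (\<sigma> x))"
    and L: "(L has_real_derivative r) (at (\<sigma> x))"
    and B: "(B has_vector_derivative B') (at (L (\<sigma> x)))"
  shows "A' = r *\<^sub>R B'"
proof -
  have "((\<lambda>y. L (\<sigma> y)) has_derivative (\<lambda>h. r * \<sigma>' h)) (at x)"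
    using diff_chain_at[OF \<sigma>(1) L[unfolded has_field_derivative_def]] by (simp add: o_def)
  from has_derivative_compose_curve[OF this B]
  have "((\<lambda>y. A (\<sigma> y)) has_derivative (\<lambda>h. (r * \<sigma>' h) *\<^sub>R B')) (at x)"
    by (rule has_derivative_transform_within_open[OF _ W]) (simp add: eq)
  from fun_cong[OF has_derivative_unique[OF this has_derivative_compose_curve[OF \<sigma>(1) A]], of v]
  have "\<sigma>' v *\<^sub>R A' = \<sigma>' v *\<^sub>R (r *\<^sub>R B')" by (simp add: mult.commute)
  then show ?thesis using \<sigma>(2) by (simp only: scaleR_cancel_left) simp
qed

text \<open>Every pair of parameters is attained, so properties of the two curves can be read off at
  points of \<open>U\<close>.\<close>

lemma inner_curve_mem:
  assumes hom: "homeomorphism U {z :: real ^ 2. z $ 1 \<in> I \<and> z $ 2 \<in> J} (\<lambda>x. vector [\<sigma> x, \<tau> x]) N"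
    and "s \<in> I" "t \<in> J"
  obtains x where "x \<in> U" "\<sigma> x = s" "\<tau> x = t"
proof -
  have m: "vector [s, t] \<in> {z :: real ^ 2. z $ 1 \<in> I \<and> z $ 2 \<in> J}" using assms by simp
  then have "N (vector [s, t]) \<in> U" "vector [\<sigma> (N (vector [s, t])), \<tau> (N (vector [s, t]))] = (vector [s, t] :: real ^ 2)"
    using hom unfolding homeomorphism_def by blast+
  then show thesis using that by (metis vector_2)
qed

section \<open>Construction of the splitting chart and the pointwise estimate\<close>

context rank_one_lagrangian
begin

lemma exists_splitting:
  obtains c I J \<alpha> \<beta> where "arclength_splitting \<Sigma>1 \<Sigma>2 S \<Phi> c I J \<alpha> \<beta>" "p \<in> cdom c"
proof -
  define c where "c = chart_at S p"
  define c1 where "c1 = chart_at (charts \<Sigma>1) (fst (\<Phi> p))"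
  define c2 where "c2 = chart_at (charts \<Sigma>2) (snd (\<Phi> p))"
  have c: "c \<in> S" "c1 \<in> charts \<Sigma>1" "c2 \<in> charts \<Sigma>2" "p \<in> cdom c" "\<Phi> p \<in> cdom c1 \<times> cdom c2"
    using chart_at[OF S] chart_at[OF at1] chart_at[OF at2] by (simp_all add: c_def c1_def c2_def mem_Times_iff)
  note ch = smooth_atlasD(1)[OF S c(1,1)] smooth_atlasD(1)[OF at1 c(2,2)] smooth_atlasD(1)[OF at2 c(3,3)]
  interpret g1: surface_metric "cimg c1" "metric \<Sigma>1 c1" by (rule surface_metric_chart[OF \<Sigma>1 c(2)])
  interpret g2: surface_metric "cimg c2" "metric \<Sigma>2 c2" by (rule surface_metric_chart[OF \<Sigma>2 c(3)])
  define f where "f = rep c c1 (fst \<circ> \<Phi>)"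
  define h where "h = rep c c2 (snd \<circ> \<Phi>)"
  define x0 where "x0 = coord c p"
  define W0 where "W0 = coord c ` (cdom c \<inter> (fst \<circ> \<Phi>) -` cdom c1) \<inter> coord c ` (cdom c \<inter> (snd \<circ> \<Phi>) -` cdom c2)"
  note repf = rep_smooth[OF smooth_components(1) S at1 c(1,2)]
  note reph = rep_smooth[OF smooth_components(2) S at2 c(1,3)]
  have W0: "open W0" unfolding W0_def by (intro open_Int repf reph)
  have x0: "x0 \<in> W0" using c by (auto simp: W0_def x0_def mem_Times_iff)
  have sf: "smooth_on W0 f" and sh: "smooth_on W0 h"
    unfolding f_def h_def by (rule smooth_on_subset[OF repf(2)] smooth_on_subset[OF reph(2)], auto simp: W0_def)+
  have W0D: "x \<in> cimg c" "cinv c x \<in> cdom c" "coord c (cinv c x) = x" "\<Phi> (cinv c x) \<in> cdom c1 \<times> cdom c2"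
    "f x \<in> cimg c1" "h x \<in> cimg c2" "cinv c1 (f x) = fst (\<Phi> (cinv c x))" "cinv c2 (h x) = snd (\<Phi> (cinv c x))"
    if "x \<in> W0" for x
  proof -
    from that obtain q q' where q: "x = coord c q" "q \<in> cdom c" "fst (\<Phi> q) \<in> cdom c1" and q': "x = coord c q'" "q' \<in> cdom c" "snd (\<Phi> q') \<in> cdom c2"
      unfolding W0_def by fastforce
    have "cinv c x = q'" unfolding q'(1) by (rule is_chartD(5)[OF ch(1) q'(2)])
    moreover have "cinv c x = q" unfolding q(1) by (rule is_chartD(5)[OF ch(1) q(2)])
    ultimately have q: "coord c (cinv c x) = x" "cinv c x \<in> cdom c" "fst (\<Phi> (cinv c x)) \<in> cdom c1" "snd (\<Phi> (cinv c x)) \<in> cdom c2"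
      using q(2,3) q'(3) q(1)[symmetric] by (simp_all only:)
    then show "x \<in> cimg c" "cinv c x \<in> cdom c" "coord c (cinv c x) = x" "\<Phi> (cinv c x) \<in> cdom c1 \<times> cdom c2"
      "f x \<in> cimg c1" "h x \<in> cimg c2" "cinv c1 (f x) = fst (\<Phi> (cinv c x))" "cinv c2 (h x) = snd (\<Phi> (cinv c x))"
      using is_chartD(4)[OF ch(1) q(2)] is_chartD(4,5)[OF ch(2) q(3)] is_chartD(4,5)[OF ch(3) q(4)]
      by (simp_all add: mem_Times_iff f_def h_def rep_def)
  qed
  have detf: "det (matrix (frechet_derivative f (at x))) = 0" and deth: "det (matrix (frechet_derivative h (at x))) = 0" if "x \<in> W0" for x
    using det_components_zero[OF c(1-3) W0D(2,4)[OF that]] W0D(3)[OF that] by (simp_all add: f_def h_def)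
  have linf: "linear (frechet_derivative f (at x))" and linh: "linear (frechet_derivative h (at x))" if "x \<in> W0" for x
    using has_derivative_linear[OF smooth_on_derivative[OF sf that]] has_derivative_linear[OF smooth_on_derivative[OF sh that]] .
  have "frechet_derivative (prep c c1 c2 \<Phi>) (at x0) = (\<lambda>v. join (frechet_derivative f (at x0) v) (frechet_derivative h (at x0) v))"
    unfolding x0_def f_def h_def by (rule ext, rule has_derivative_prep[OF S at1 at2 smooth_components c])
  then have "inj (\<lambda>v. join (frechet_derivative f (at x0) v) (frechet_derivative h (at x0) v))"
    using inj_prep[OF c] by (simp add: x0_def)
  from exists_transversal_components[OF linf[OF x0] linh[OF x0] detf[OF x0] deth[OF x0] this]
  obtain a b where ab: "frechet_derivative f (at x0) (axis 1 1) $ a * frechet_derivative h (at x0) (axis 2 1) $ b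
      - frechet_derivative f (at x0) (axis 2 1) $ a * frechet_derivative h (at x0) (axis 1 1) $ b \<noteq> 0"
    by blast
  \<comment> \<open>First split with components of \<open>f\<close> and \<open>h\<close> as coordinates; the arclength functions of the two
    curves so obtained are then composed with these components and the splitting is repeated.\<close>
  define \<sigma> where "\<sigma> x = f x $ a" for x
  define \<tau> where "\<tau> x = h x $ b" for x
  have \<sigma>: "smooth_on W0 \<sigma>" and \<tau>: "smooth_on W0 \<tau>"
    unfolding \<sigma>_def[abs_def] \<tau>_def[abs_def] by (intro smooth_on_nth W0 sf sh)+
  have d\<sigma>: "frechet_derivative \<sigma> (at x) v = frechet_derivative f (at x) v $ a"
    and d\<tau>: "frechet_derivative \<tau> (at x) v = frechet_derivative h (at x) v $ b" if "x \<in> W0" for x v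
    using fun_cong[OF frechet_derivative_at[OF has_derivative_nth[OF smooth_on_derivative[OF sf that]]], of v a]
      fun_cong[OF frechet_derivative_at[OF has_derivative_nth[OF smooth_on_derivative[OF sh that]]], of v b]
    by (simp_all add: \<sigma>_def[abs_def] \<tau>_def[abs_def])
  define \<Delta> where "\<Delta> x = partial 1 \<sigma> x * partial 2 \<tau> x - partial 2 \<sigma> x * partial 1 \<tau> x" for x
  have s\<Delta>: "smooth_on W0 \<Delta>"
    unfolding \<Delta>_def[abs_def] by (intro smooth_on_diff smooth_on_mult smooth_on_partial \<sigma> \<tau> W0)
  \<comment> \<open>On this neighbourhood row \<open>a\<close> of the derivative of \<open>f\<close>
    and row \<open>b\<close> of that of \<open>h\<close> stay nonzero, as
    \<open>kernel_of_component\<close> demands.\<close>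
  define W where "W = W0 \<inter> \<Delta> -` (- {0})"
  have W: "open W" unfolding W_def
    by (rule continuous_open_preimage[OF smooth_on_imp_continuous_on[OF s\<Delta>] W0]) auto
  have WW: "W \<subseteq> W0" and \<Delta>: "\<And>x. x \<in> W \<Longrightarrow> \<Delta> x \<noteq> 0" by (auto simp: W_def)
  have xW: "x0 \<in> W" using x0 ab by (simp add: W_def \<Delta>_def partial_def d\<sigma> d\<tau>)
  have ker_f: "frechet_derivative f (at x) v = 0" if "x \<in> W" "frechet_derivative \<sigma> (at x) v = 0" for x v
  proof -
    have x: "x \<in> W0" using that WW by auto
    show ?thesis
      by (rule kernel_of_component[OF linf[OF x] detf[OF x], of a])
        (use \<Delta>[OF that(1)] that(2) in \<open>auto simp: \<Delta>_def partial_def d\<sigma>[OF x]\<close>)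
  qed
  have ker_h: "frechet_derivative h (at x) v = 0" if "x \<in> W" "frechet_derivative \<tau> (at x) v = 0" for x v
  proof -
    have x: "x \<in> W0" using that WW by auto
    show ?thesis
      by (rule kernel_of_component[OF linh[OF x] deth[OF x], of b])
        (use \<Delta>[OF that(1)] that(2) in \<open>auto simp: \<Delta>_def partial_def d\<tau>[OF x]\<close>)
  qed
  note subW = smooth_on_subset[OF _ WW]
  obtain U0 I0 J0 N0 A0 B0 where U0: "open U0" "x0 \<in> U0" "U0 \<subseteq> W" and IJ0: "open I0" "\<sigma> x0 \<in> I0" "open J0" "\<tau> x0 \<in> J0"
    and hom0: "homeomorphism U0 {z :: real ^ 2. z $ 1 \<in> I0 \<and> z $ 2 \<in> J0} (\<lambda>x. vector [\<sigma> x, \<tau> x]) N0"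
    and A0: "smooth_on I0 A0" and B0: "smooth_on J0 B0"
    and fA0: "\<And>x. x \<in> U0 \<Longrightarrow> f x = A0 (\<sigma> x)" and hB0: "\<And>x. x \<in> U0 \<Longrightarrow> h x = B0 (\<tau> x)"
    by (rule split_coordinates[OF W xW subW[OF \<sigma>] subW[OF \<tau>] subW[OF sf] subW[OF sh] \<Delta>[OF xW, unfolded \<Delta>_def] ker_f ker_h]) (assumption+, rule that, assumption+)
  have A0_mem: "A0 s \<in> cimg c1" "A0 s $ a = s" if s: "s \<in> I0" for s
  proof -
    obtain x where x: "x \<in> U0" "\<sigma> x = s" by (rule inner_curve_mem[OF hom0 s IJ0(4)]) (rule that)
    have A0x: "A0 s = f x" using fA0[OF x(1)] x(2) by simp
    show "A0 s \<in> cimg c1" unfolding A0x using x(1) U0(3) WW by (intro W0D(5)) auto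
    show "A0 s $ a = s" unfolding A0x using x(2) by (simp only: \<sigma>_def)
  qed
  have B0_mem: "B0 t \<in> cimg c2" "B0 t $ b = t" if t: "t \<in> J0" for t
  proof -
    obtain x where x: "x \<in> U0" "\<tau> x = t" by (rule inner_curve_mem[OF hom0 IJ0(2) t]) (rule that)
    have B0x: "B0 t = h x" using hB0[OF x(1)] x(2) by simp
    show "B0 t \<in> cimg c2" unfolding B0x using x(1) U0(3) WW by (intro W0D(6)) auto
    show "B0 t $ b = t" unfolding B0x using x(2) by (simp only: \<tau>_def)
  qed
  \<comment> \<open>Since the coordinates are components of \<open>f\<close> and \<open>h\<close>,
    one component of each curve is its own parameter, and the velocity cannot vanish.\<close>
  have regular: "vector_derivative X (at s) \<noteq> 0"
    if X: "open K" "smooth_on K X" "\<And>s. s \<in> K \<Longrightarrow> X s $ i = s" and s: "s \<in> K" for X :: "real \<Rightarrow> real ^ 2" and K i s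
  proof
    assume 0: "vector_derivative X (at s) = 0"
    have 1: "((\<lambda>s. X s $ i) has_derivative (\<lambda>h. (h *\<^sub>R vector_derivative X (at s)) $ i)) (at s)"
      using has_derivative_nth smooth_on_has_vector_derivative[OF X(2) s] by (simp only: has_vector_derivative_def)
    have "((\<lambda>s. X s $ i) has_derivative (\<lambda>h. h)) (at s)"
      by (rule has_derivative_transform_within_open[OF has_derivative_ident X(1) s]) (simp add: X(3))
    from fun_cong[OF has_derivative_unique[OF this 1], of 1] 0 show False by simp
  qed
  have A0img: "A0 ` I0 \<subseteq> cimg c1" and B0img: "B0 ` J0 \<subseteq> cimg c2" using A0_mem B0_mem by auto
  obtain q1 where q1: "smooth_on I0 q1" "\<And>t. t \<in> I0 \<Longrightarrow> q1 t > 0"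
    "\<And>t. t \<in> I0 \<Longrightarrow> mform (metric \<Sigma>1 c1 (A0 t)) (vector_derivative A0 (at t)) (vector_derivative A0 (at t)) = q1 t * q1 t"
    using g1.smooth_speed[OF IJ0(1) A0 A0img regular[OF IJ0(1) A0 A0_mem(2)]] by blast
  obtain q2 where q2: "smooth_on J0 q2" "\<And>t. t \<in> J0 \<Longrightarrow> q2 t > 0"
    "\<And>t. t \<in> J0 \<Longrightarrow> mform (metric \<Sigma>2 c2 (B0 t)) (vector_derivative B0 (at t)) (vector_derivative B0 (at t)) = q2 t * q2 t"
    using g2.smooth_speed[OF IJ0(3) B0 B0img regular[OF IJ0(3) B0 B0_mem(2)]] by blast
  obtain I1 L1 where I1: "open I1" "\<sigma> x0 \<in> I1" "I1 \<subseteq> I0" "smooth_on I1 L1" "\<And>s. s \<in> I1 \<Longrightarrow> (L1 has_real_derivative q1 s) (at s)"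
    by (rule smooth_antiderivative[OF IJ0(1,2) q1(1)]) (rule that, assumption+)
  obtain J1 L2 where J1: "open J1" "\<tau> x0 \<in> J1" "J1 \<subseteq> J0" "smooth_on J1 L2" "\<And>s. s \<in> J1 \<Longrightarrow> (L2 has_real_derivative q2 s) (at s)"
    by (rule smooth_antiderivative[OF IJ0(3,4) q2(1)]) (rule that, assumption+)
  have sU0: "smooth_on U0 \<sigma>" "smooth_on U0 \<tau>"
    using smooth_on_subset[OF \<sigma>] smooth_on_subset[OF \<tau>] U0(3) WW by auto
  define W1 where "W1 = (U0 \<inter> \<sigma> -` I1) \<inter> (U0 \<inter> \<tau> -` J1)"
  have W1: "open W1" unfolding W1_def
    by (intro open_Int continuous_open_preimage smooth_on_imp_continuous_on sU0 U0 I1 J1)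
  have W1D: "x \<in> W0" "x \<in> W" "x \<in> U0" "\<sigma> x \<in> I1" "\<tau> x \<in> J1" if "x \<in> W1" for x
    using that U0(3) WW by (auto simp: W1_def)
  have xW1: "x0 \<in> W1" using U0 I1 J1 by (simp add: W1_def)
  have sub1: "W1 \<subseteq> W0" "W1 \<subseteq> W" using W1D by auto
  define \<sigma>' where "\<sigma>' x = L1 (\<sigma> x)" for x
  define \<tau>' where "\<tau>' x = L2 (\<tau> x)" for x
  have s\<sigma>': "smooth_on W1 \<sigma>'"
    unfolding \<sigma>'_def[abs_def] by (rule smooth_on_compose[OF W1 I1(1) _ smooth_on_subset[OF \<sigma> sub1(1)] I1(4)]) (use W1D in auto)
  have s\<tau>': "smooth_on W1 \<tau>'"
    unfolding \<tau>'_def[abs_def] by (rule smooth_on_compose[OF W1 J1(1) _ smooth_on_subset[OF \<tau> sub1(1)] J1(4)]) (use W1D in auto)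
  have d\<sigma>': "frechet_derivative \<sigma>' (at x) v = q1 (\<sigma> x) * frechet_derivative \<sigma> (at x) v" if "x \<in> W1" for x v
    using fun_cong[OF frechet_derivative_at[OF diff_chain_at[OF smooth_on_derivative[OF \<sigma> W1D(1)[OF that]] I1(5)[OF W1D(4)[OF that], unfolded has_field_derivative_def]]], of v]
    by (simp add: \<sigma>'_def[abs_def] o_def)
  have d\<tau>': "frechet_derivative \<tau>' (at x) v = q2 (\<tau> x) * frechet_derivative \<tau> (at x) v" if "x \<in> W1" for x v
    using fun_cong[OF frechet_derivative_at[OF diff_chain_at[OF smooth_on_derivative[OF \<tau> W1D(1)[OF that]] J1(5)[OF W1D(5)[OF that], unfolded has_field_derivative_def]]], of v]
    by (simp add: \<tau>'_def[abs_def] o_def)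
  have qpos: "q1 (\<sigma> x) > 0" "q2 (\<tau> x) > 0" if "x \<in> W1" for x
    using q1(2) q2(2) W1D(4,5)[OF that] I1(3) J1(3) by auto
  \<comment> \<open>Passing to arclength multiplies the Jacobian determinant by the two positive
    speeds.\<close>
  have "partial 1 \<sigma>' x0 * partial 2 \<tau>' x0 - partial 2 \<sigma>' x0 * partial 1 \<tau>' x0 = q1 (\<sigma> x0) * q2 (\<tau> x0) * \<Delta> x0"
    by (simp add: partial_def d\<sigma>'[OF xW1] d\<tau>'[OF xW1] \<Delta>_def algebra_simps)
  then have det': "partial 1 \<sigma>' x0 * partial 2 \<tau>' x0 - partial 2 \<sigma>' x0 * partial 1 \<tau>' x0 \<noteq> 0"
    using qpos[OF xW1] \<Delta>[OF xW] by simp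
  have ker_f': "frechet_derivative f (at x) v = 0" if "x \<in> W1" "frechet_derivative \<sigma>' (at x) v = 0" for x v
    using ker_f[OF W1D(2)[OF that(1)]] that(2) qpos[OF that(1)] by (simp add: d\<sigma>'[OF that(1)])
  have ker_h': "frechet_derivative h (at x) v = 0" if "x \<in> W1" "frechet_derivative \<tau>' (at x) v = 0" for x v
    using ker_h[OF W1D(2)[OF that(1)]] that(2) qpos[OF that(1)] by (simp add: d\<tau>'[OF that(1)])
  note sub1' = smooth_on_subset[OF _ sub1(1)]
  obtain U I J N A B where U: "open U" "x0 \<in> U" "U \<subseteq> W1" and I: "open I" "is_interval I" "\<sigma>' x0 \<in> I" and J: "open J" "is_interval J" "\<tau>' x0 \<in> J"
    and hom: "homeomorphism U {z :: real ^ 2. z $ 1 \<in> I \<and> z $ 2 \<in> J} (\<lambda>x. vector [\<sigma>' x, \<tau>' x]) N"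
    and N: "smooth_on {z :: real ^ 2. z $ 1 \<in> I \<and> z $ 2 \<in> J} N"
    and A: "smooth_on I A" and B: "smooth_on J B"
    and fA: "\<And>x. x \<in> U \<Longrightarrow> f x = A (\<sigma>' x)" and hB: "\<And>x. x \<in> U \<Longrightarrow> h x = B (\<tau>' x)"
    by (rule split_coordinates[OF W1 xW1 s\<sigma>' s\<tau>' sub1'[OF sf] sub1'[OF sh] det' ker_f' ker_h']) (assumption+, rule that, assumption+)
  have UW: "U \<subseteq> W0" using U(3) sub1 by auto
  have transversal: "\<exists>v. frechet_derivative \<sigma> (at x) v \<noteq> 0" "\<exists>v. frechet_derivative \<tau> (at x) v \<noteq> 0" if "x \<in> W" for x
    using \<Delta>[OF that] unfolding \<Delta>_def partial_def by (metis diff_self mult_zero_left mult_zero_right)+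
  have unitA: "A s \<in> cimg c1" "mform (metric \<Sigma>1 c1 (A s)) (vector_derivative A (at s)) (vector_derivative A (at s)) = 1" if s: "s \<in> I" for s
  proof -
    obtain x where x: "x \<in> U" "\<sigma>' x = s" by (rule inner_curve_mem[OF hom s J(3)]) (rule that)
    have x1: "x \<in> W1" using x U by auto
    have Ax: "A s = f x" "A s = A0 (\<sigma> x)" using fA[OF x(1)] fA0[OF W1D(3)[OF x1]] x(2) by auto
    show "A s \<in> cimg c1" unfolding Ax(1) by (rule W0D(5)[OF W1D(1)[OF x1]])
    obtain v where v: "frechet_derivative \<sigma> (at x) v \<noteq> 0" using transversal(1)[OF W1D(2)[OF x1]] by blast
    have I0x: "\<sigma> x \<in> I0" using W1D(4)[OF x1] I1(3) by auto
    \<comment> \<open>\<open>A0\<close> has speed \<open>q1\<close>, which is also the derivative of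
      the reparametrization \<open>L1\<close>; hence \<open>A\<close> has speed one.\<close>
    have "vector_derivative A0 (at (\<sigma> x)) = q1 (\<sigma> x) *\<^sub>R vector_derivative A (at s)"
    proof (rule reparametrized_velocity[OF U(1) x(1) _ smooth_on_derivative[OF \<sigma> W1D(1)[OF x1]] v smooth_on_has_vector_derivative[OF A0 I0x] I1(5)[OF W1D(4)[OF x1]]])
      show "A0 (\<sigma> y) = A (L1 (\<sigma> y))" if "y \<in> U" for y
        using fA[OF that] fA0[OF W1D(3)] that U(3) by (auto simp: \<sigma>'_def)
      show "(A has_vector_derivative vector_derivative A (at s)) (at (L1 (\<sigma> x)))"
        using smooth_on_has_vector_derivative[OF A s] x(2) by (simp add: \<sigma>'_def)
    qed
    with q1(3)[OF I0x] have "q1 (\<sigma> x) * q1 (\<sigma> x) * mform (metric \<Sigma>1 c1 (A s)) (vector_derivative A (at s)) (vector_derivative A (at s)) = q1 (\<sigma> x) * q1 (\<sigma> x)"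
      by (simp add: mform_simps Ax(2))
    then show "mform (metric \<Sigma>1 c1 (A s)) (vector_derivative A (at s)) (vector_derivative A (at s)) = 1"
      using qpos[OF x1] by simp
  qed
  have unitB: "B t \<in> cimg c2" "mform (metric \<Sigma>2 c2 (B t)) (vector_derivative B (at t)) (vector_derivative B (at t)) = 1" if t: "t \<in> J" for t
  proof -
    obtain x where x: "x \<in> U" "\<tau>' x = t" by (rule inner_curve_mem[OF hom I(3) t]) (rule that)
    have x1: "x \<in> W1" using x U by auto
    have Bx: "B t = h x" "B t = B0 (\<tau> x)" using hB[OF x(1)] hB0[OF W1D(3)[OF x1]] x(2) by auto
    show "B t \<in> cimg c2" unfolding Bx(1) by (rule W0D(6)[OF W1D(1)[OF x1]])
    obtain v where v: "frechet_derivative \<tau> (at x) v \<noteq> 0" using transversal(2)[OF W1D(2)[OF x1]] by blast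
    have J0x: "\<tau> x \<in> J0" using W1D(5)[OF x1] J1(3) by auto
    have "vector_derivative B0 (at (\<tau> x)) = q2 (\<tau> x) *\<^sub>R vector_derivative B (at t)"
    proof (rule reparametrized_velocity[OF U(1) x(1) _ smooth_on_derivative[OF \<tau> W1D(1)[OF x1]] v smooth_on_has_vector_derivative[OF B0 J0x] J1(5)[OF W1D(5)[OF x1]]])
      show "B0 (\<tau> y) = B (L2 (\<tau> y))" if "y \<in> U" for y
        using hB[OF that] hB0[OF W1D(3)] that U(3) by (auto simp: \<tau>'_def)
      show "(B has_vector_derivative vector_derivative B (at t)) (at (L2 (\<tau> x)))"
        using smooth_on_has_vector_derivative[OF B t] x(2) by (simp add: \<tau>'_def)
    qed
    with q2(3)[OF J0x] have "q2 (\<tau> x) * q2 (\<tau> x) * mform (metric \<Sigma>2 c2 (B t)) (vector_derivative B (at t)) (vector_derivative B (at t)) = q2 (\<tau> x) * q2 (\<tau> x)"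
      by (simp add: mform_simps Bx(2))
    then show "mform (metric \<Sigma>2 c2 (B t)) (vector_derivative B (at t)) (vector_derivative B (at t)) = 1"
      using qpos[OF x1] by simp
  qed
  define Box where "Box = {z :: real ^ 2. z $ 1 \<in> I \<and> z $ 2 \<in> J}"
  have "Box = (\<lambda>z. z $ 1) -` I \<inter> (\<lambda>z. z $ 2) -` J" by (auto simp: Box_def)
  then have oBox: "open Box" using I J by (auto intro!: open_Int open_vimage continuous_intros)
  define c' where "c' = (cinv c ` U, (\<lambda>x. vector [\<sigma>' x, \<tau>' x] :: real ^ 2) \<circ> coord c)"
  have Uc: "U \<subseteq> cimg c" using UW W0D(1) by auto
  have cc: "compatible_chart S c'" "cimg c' = Box"
    using compatible_chart_compose[OF S c(1) U(1) Uc oBox hom[folded Box_def] smooth_on_vector2[OF U(1) smooth_on_subset[OF s\<sigma>' U(3)] smooth_on_subset[OF s\<tau>' U(3)]] N[folded Box_def], folded c'_def]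
    by auto
  have Aimg: "A ` I \<subseteq> cimg c1" and Bimg: "B ` J \<subseteq> cimg c2" using unitA unitB by auto
  have "arclength_splitting \<Sigma>1 \<Sigma>2 S \<Phi> c' I J (cinv c1 \<circ> A) (cinv c2 \<circ> B)"
    unfolding arclength_splitting_def
  proof (intro conjI ballI)
    show "compatible_chart S c'" by fact
    show "open I" "is_interval I" "I \<noteq> {}" "open J" "is_interval J" "J \<noteq> {}" using I J by auto
    show "cimg c' = {x. x $ 1 \<in> I \<and> x $ 2 \<in> J}" using cc by (simp add: Box_def)
    show "smooth_curve \<Sigma>1 I (cinv c1 \<circ> A)" by (rule smooth_curve_cinv[OF at1 c(2) I(1) A Aimg])
    show "smooth_curve \<Sigma>2 J (cinv c2 \<circ> B)" by (rule smooth_curve_cinv[OF at2 c(3) J(1) B Bimg])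
    show "unit_speed \<Sigma>1 I (cinv c1 \<circ> A)" by (rule unit_speed_cinv[OF \<Sigma>1 c(2) I(1) A Aimg unitA(2)])
    show "unit_speed \<Sigma>2 J (cinv c2 \<circ> B)" by (rule unit_speed_cinv[OF \<Sigma>2 c(3) J(1) B Bimg unitB(2)])
    fix r assume "r \<in> cdom c'"
    then obtain x where x: "x \<in> U" "r = cinv c x" by (auto simp: c'_def)
    then have xW0: "x \<in> W0" using UW by auto
    have "coord c' r $ 1 = \<sigma>' x" "coord c' r $ 2 = \<tau>' x"
      using x W0D(3)[OF xW0] by (simp_all add: c'_def)
    then show "\<Phi> r = ((cinv c1 \<circ> A) (coord c' r $ 1), (cinv c2 \<circ> B) (coord c' r $ 2))"
      using fA[OF x(1)] hB[OF x(1)] W0D(7,8)[OF xW0] x(2) by simp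
  qed
  moreover have "p \<in> cdom c'"
    using U(2) is_chartD(5)[OF ch(1) c(4)] by (auto simp: c'_def x0_def image_iff intro!: bexI[of _ "coord c p"])
  ultimately show thesis by (rule that)
qed

text \<open>Carries the curvature bound from the splitting chart \<open>e\<close> to the charts in
  which the integrand at \<open>p\<close> is written.\<close>

lemma second_variation_integrand_nonneg:
  assumes orient: "oriented_atlas (charts \<Sigma>1)" "oriented_atlas (charts \<Sigma>2)"
    and curvature: "\<And>c I J \<phi> \<psi> k\<^sub>\<phi> k\<^sub>\<psi>.
           \<lbrakk>arclength_splitting \<Sigma>1 \<Sigma>2 S \<Phi> c I J \<phi> \<psi>;
            has_curvature \<Sigma>1 I \<phi> k\<^sub>\<phi>; has_curvature \<Sigma>2 J \<psi> k\<^sub>\<psi>\<rbrakk> \<Longrightarrow>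
           (\<forall>s\<in>I. gauss_curvature \<Sigma>1 (\<phi> s) \<le> - 2 * (k\<^sub>\<phi> s)\<^sup>2) \<and>
           (\<forall>t\<in>J. gauss_curvature \<Sigma>2 (\<psi> t) \<le> - 2 * (k\<^sub>\<psi> t)\<^sup>2)"
  shows "second_variation_integrand \<epsilon> \<Sigma>1 \<Sigma>2 S \<Phi> u p \<ge> 0"
proof -
  obtain e I J \<alpha> \<beta> where e: "arclength_splitting \<Sigma>1 \<Sigma>2 S \<Phi> e I J \<alpha> \<beta>" "p \<in> cdom e"
    by (rule exists_splitting)
  have compat: "compatible_chart S e" and I: "open I" and J: "open J"
    and img: "cimg e = {x. x $ 1 \<in> I \<and> x $ 2 \<in> J}"
    and \<alpha>: "smooth_curve \<Sigma>1 I \<alpha>" "unit_speed \<Sigma>1 I \<alpha>" and \<beta>: "smooth_curve \<Sigma>2 J \<beta>" "unit_speed \<Sigma>2 J \<beta>"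
    and \<Phi>: "\<And>r. r \<in> cdom e \<Longrightarrow> \<Phi> r = (\<alpha> (coord e r $ 1), \<beta> (coord e r $ 2))"
    using e(1) unfolding arclength_splitting_def by blast+
  obtain k1 where k1: "has_curvature \<Sigma>1 I \<alpha> k1" using exists_curvature[OF \<Sigma>1 orient(1) I \<alpha>] by blast
  obtain k2 where k2: "has_curvature \<Sigma>2 J \<beta> k2" using exists_curvature[OF \<Sigma>2 orient(2) J \<beta>] by blast
  define c where "c = chart_at S p"
  define c1 where "c1 = chart_at (charts \<Sigma>1) (fst (\<Phi> p))"
  define c2 where "c2 = chart_at (charts \<Sigma>2) (snd (\<Phi> p))"
  have c: "c \<in> S" "c1 \<in> charts \<Sigma>1" "c2 \<in> charts \<Sigma>2" "p \<in> cdom c" "\<Phi> p \<in> cdom c1 \<times> cdom c2"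
    using chart_at[OF S] chart_at[OF at1] chart_at[OF at2] by (simp_all add: c_def c1_def c2_def mem_Times_iff)
  note ch = smooth_atlasD(1)[OF S c(1,1)] smooth_atlasD(1)[OF at1 c(2,2)] smooth_atlasD(1)[OF at2 c(3,3)]
  have che: "is_chart e" and T: "smooth_on (overlap c e) (transition c e)"
    using compat c(1) by (simp_all add: compatible_chart_def)
  define x where "x = coord c p"
  define s where "s = coord e p $ 1"
  define t where "t = coord e p $ 2"
  have coord_e: "coord e r $ 1 \<in> I" "coord e r $ 2 \<in> J" if "r \<in> cdom e" for r
    using is_chartD(4)[OF che that] img by auto
  have st: "s \<in> I" "t \<in> J" "\<alpha> s = fst (\<Phi> p)" "\<beta> t = snd (\<Phi> p)"
    using coord_e[OF e(2)] \<Phi>[OF e(2)] by (simp_all add: s_def t_def)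
  have st': "\<alpha> s \<in> cdom c1" "\<beta> t \<in> cdom c2" using c(5) st by (auto simp: mem_Times_iff)
  \<comment> \<open>A neighbourhood of \<open>x\<close> on which the splitting chart and both target
    charts are available.\<close>
  define N where "N = overlap c e \<inter> (coord c ` (cdom c \<inter> (fst \<circ> \<Phi>) -` cdom c1) \<inter> coord c ` (cdom c \<inter> (snd \<circ> \<Phi>) -` cdom c2))"
  have N: "open N"
    unfolding N_def by (intro open_Int open_overlap[OF ch(1) che] rep_smooth(1)[OF smooth_components(1) S at1 c(1,2)]
        rep_smooth(1)[OF smooth_components(2) S at2 c(1,3)])
  have xN: "x \<in> N" using c e(2) by (auto simp: N_def x_def overlap_def mem_Times_iff)
  have ND: "cinv c z \<in> cdom e" "fst (\<Phi> (cinv c z)) \<in> cdom c1" "snd (\<Phi> (cinv c z)) \<in> cdom c2" if "z \<in> N" for z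
  proof -
    show "cinv c z \<in> cdom e" using that overlap_iff[OF ch(1), of z e] by (simp add: N_def)
    from that obtain q q' where "z = coord c q" "q \<in> cdom c" "fst (\<Phi> q) \<in> cdom c1" "z = coord c q'" "q' \<in> cdom c" "snd (\<Phi> q') \<in> cdom c2"
      unfolding N_def by fastforce
    then show "fst (\<Phi> (cinv c z)) \<in> cdom c1" "snd (\<Phi> (cinv c z)) \<in> cdom c2"
      using is_chartD(5)[OF ch(1)] by metis+
  qed
  have Tx: "transition c e x = coord e p" unfolding x_def by (rule transition_coord[OF ch(1) c(4)])
  define P where "P = {s \<in> I. \<alpha> s \<in> cdom c1}"
  define Q where "Q = {t \<in> J. \<beta> t \<in> cdom c2}"
  define F where "F = prep c c1 c2 \<Phi>"
  have sub: "N \<subseteq> overlap c e" by (auto simp: N_def)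
  \<comment> \<open>Seen from \<open>c\<close>, the arclength parameters are the components of the
    transition map into the splitting chart.\<close>
  interpret split_immersion "cimg c1" "metric \<Sigma>1 c1" "cimg c2" "metric \<Sigma>2 c2" \<epsilon> N "\<lambda>z. transition c e z $ 1" "\<lambda>z. transition c e z $ 2"
    P Q "coord c1 \<circ> \<alpha>" "coord c2 \<circ> \<beta>" F x "k1 s" "k2 t"
  proof (intro split_immersion.intro surface_product.intro surface_product_axioms.intro split_immersion_axioms.intro)
    show "surface_metric (cimg c1) (metric \<Sigma>1 c1)" by (rule surface_metric_chart[OF \<Sigma>1 c(2)])
    show "surface_metric (cimg c2) (metric \<Sigma>2 c2)" by (rule surface_metric_chart[OF \<Sigma>2 c(3)])
    show "\<epsilon> * \<epsilon> = 1" using eps by auto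
    show "open N" "x \<in> N" by fact+
    show "smooth_on N (\<lambda>z. transition c e z $ 1)" "smooth_on N (\<lambda>z. transition c e z $ 2)"
      by (rule smooth_on_nth[OF N smooth_on_subset[OF T sub]])+
    show "(\<lambda>z. transition c e z $ 1) ` N \<subseteq> P" "(\<lambda>z. transition c e z $ 2) ` N \<subseteq> Q"
      using ND \<Phi> coord_e by (auto simp: P_def Q_def transition_def)
    show "open P" "smooth_on P (coord c1 \<circ> \<alpha>)"
      unfolding P_def by (rule smooth_curve_chart[OF \<alpha>(1) I \<Sigma>1 c(2)])+
    show "open Q" "smooth_on Q (coord c2 \<circ> \<beta>)"
      unfolding Q_def by (rule smooth_curve_chart[OF \<beta>(1) J \<Sigma>2 c(3)])+
    show "F z = join ((coord c1 \<circ> \<alpha>) (transition c e z $ 1)) ((coord c2 \<circ> \<beta>) (transition c e z $ 2))" if "z \<in> N" for z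
      using \<Phi>[OF ND(1)[OF that]] by (simp add: F_def prep_def rep_def transition_def)
    show "(coord c1 \<circ> \<alpha>) (transition c e x $ 1) \<in> cimg c1" "(coord c2 \<circ> \<beta>) (transition c e x $ 2) \<in> cimg c2"
      using is_chartD(4)[OF ch(2) st'(1)] is_chartD(4)[OF ch(3) st'(2)] by (simp_all add: Tx s_def t_def)
    show "inj (frechet_derivative F (at x))"
      unfolding F_def x_def by (rule inj_prep[OF c])
    show "mform (metric \<Sigma>1 c1 ((coord c1 \<circ> \<alpha>) (transition c e x $ 1))) (vector_derivative (coord c1 \<circ> \<alpha>) (at (transition c e x $ 1)))
        (vector_derivative (coord c1 \<circ> \<alpha>) (at (transition c e x $ 1))) = 1"
      using \<alpha>(2) c(2) st(1) st'(1) unfolding unit_speed_def velocity_def Tx s_def[symmetric] by simp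
    show "mform (metric \<Sigma>2 c2 ((coord c2 \<circ> \<beta>) (transition c e x $ 2))) (vector_derivative (coord c2 \<circ> \<beta>) (at (transition c e x $ 2)))
        (vector_derivative (coord c2 \<circ> \<beta>) (at (transition c e x $ 2))) = 1"
      using \<beta>(2) c(3) st(2) st'(2) unfolding unit_speed_def velocity_def Tx t_def[symmetric] by simp
    show "covariant_acceleration (metric \<Sigma>1 c1) ((coord c1 \<circ> \<alpha>) (transition c e x $ 1)) (vector_derivative (coord c1 \<circ> \<alpha>) (at (transition c e x $ 1)))
        (vector_derivative (\<lambda>s. vector_derivative (coord c1 \<circ> \<alpha>) (at s)) (at (transition c e x $ 1)))
      = k1 s *\<^sub>R (rot (metric \<Sigma>1 c1 ((coord c1 \<circ> \<alpha>) (transition c e x $ 1))) *v vector_derivative (coord c1 \<circ> \<alpha>) (at (transition c e x $ 1)))"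
      using k1 c(2) st(1) st'(1) unfolding has_curvature_def acceleration_eq velocity_eq Tx s_def[symmetric] by simp
    show "covariant_acceleration (metric \<Sigma>2 c2) ((coord c2 \<circ> \<beta>) (transition c e x $ 2)) (vector_derivative (coord c2 \<circ> \<beta>) (at (transition c e x $ 2)))
        (vector_derivative (\<lambda>s. vector_derivative (coord c2 \<circ> \<beta>) (at s)) (at (transition c e x $ 2)))
      = k2 t *\<^sub>R (rot (metric \<Sigma>2 c2 ((coord c2 \<circ> \<beta>) (transition c e x $ 2))) *v vector_derivative (coord c2 \<circ> \<beta>) (at (transition c e x $ 2)))"
      using k2 c(3) st(2) st'(2) unfolding has_curvature_def acceleration_eq velocity_eq Tx t_def[symmetric] by simp
  qed
  \<comment> \<open>\<open>gauss_curvature\<close> selects the same charts \<open>c1\<close> and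
    \<open>c2\<close>, because \<open>\<alpha> s\<close> and \<open>\<beta> t\<close> are the
    components of \<open>\<Phi> p\<close>.\<close>
  have "gauss_curvature_local (metric \<Sigma>1 c1) ((coord c1 \<circ> \<alpha>) (transition c e x $ 1)) \<le> - 2 * (k1 s)\<^sup>2"
    "gauss_curvature_local (metric \<Sigma>2 c2) ((coord c2 \<circ> \<beta>) (transition c e x $ 2)) \<le> - 2 * (k2 t)\<^sup>2"
    using bspec[OF conjunct1[OF curvature[OF e(1) k1 k2]] st(1)] bspec[OF conjunct2[OF curvature[OF e(1) k1 k2]] st(2)]
    unfolding Tx s_def[symmetric] t_def[symmetric] gauss_curvature_def Let_def st(3,4) c1_def[symmetric] c2_def[symmetric]
    by (simp_all add: st)
  note nonneg = integrand_nonneg[OF this]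
  \<comment> \<open>The estimate holds for every vector, in particular for the gradient, and the
    Laplacian contributes a square.\<close>
  show ?thesis
    unfolding second_variation_integrand_def Let_def c_def[symmetric] c1_def[symmetric] c2_def[symmetric] F_def[symmetric] x_def[symmetric]
    using nonneg[of "gradient (induced_metric \<epsilon> \<Sigma>1 \<Sigma>2 \<Phi> c) (u \<circ> cinv c) x"]
      zero_le_power2[of "laplacian (induced_metric \<epsilon> \<Sigma>1 \<Sigma>2 \<Phi> c) (u \<circ> cinv c) x"]
    by linarith
qed

end

theorem theorem4:
  fixes \<Sigma>1 :: "('a::{t2_space,second_countable_topology}, 2) manifold"
    and \<Sigma>2 :: "('b::{t2_space,second_countable_topology}, 2) manifold"
    and S :: "('s::{t2_space,second_countable_topology}, 2) chart set"
    and \<Phi> :: "'s \<Rightarrow> 'a \<times> 'b"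
    and \<epsilon> :: real
  assumes "riemannian_manifold \<Sigma>1" and "oriented_atlas (charts \<Sigma>1)"
    and "connected (UNIV :: 'a set)" and "geodesically_complete \<Sigma>1"
    and "riemannian_manifold \<Sigma>2" and "oriented_atlas (charts \<Sigma>2)"
    and "connected (UNIV :: 'b set)" and "geodesically_complete \<Sigma>2"
    and "\<epsilon> \<in> {1, -1}"
    and "smooth_atlas S"
    and "projected_rank_one \<Sigma>1 \<Sigma>2 S \<Phi>"
    and "hamiltonian_minimal \<epsilon> \<Sigma>1 \<Sigma>2 S \<Phi>"
    and "\<And>c I J \<phi> \<psi> k\<^sub>\<phi> k\<^sub>\<psi>.
           \<lbrakk>arclength_splitting \<Sigma>1 \<Sigma>2 S \<Phi> c I J \<phi> \<psi>;
            has_curvature \<Sigma>1 I \<phi> k\<^sub>\<phi>; has_curvature \<Sigma>2 J \<psi> k\<^sub>\<psi>\<rbrakk> \<Longrightarrow>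
           (\<forall>s\<in>I. gauss_curvature \<Sigma>1 (\<phi> s) \<le> - 2 * (k\<^sub>\<phi> s)\<^sup>2) \<and>
           (\<forall>t\<in>J. gauss_curvature \<Sigma>2 (\<psi> t) \<le> - 2 * (k\<^sub>\<psi> t)\<^sup>2)"
  shows "hamiltonian_local_minimizer \<epsilon> \<Sigma>1 \<Sigma>2 S \<Phi>"
proof -
  interpret rank_one_lagrangian \<Sigma>1 \<Sigma>2 S \<Phi> \<epsilon>
    using assms(12) by unfold_locales (use assms in \<open>simp_all add: hamiltonian_minimal_def\<close>)
  have "second_variation_integrand \<epsilon> \<Sigma>1 \<Sigma>2 S \<Phi> u p \<ge> 0" for u p
    by (rule second_variation_integrand_nonneg[OF assms(2,6,13)])
  \<comment> \<open>A nonnegative integrand has nonnegative integral for any measure; the value is 0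
    if it is not integrable.\<close>
  then show ?thesis
    unfolding hamiltonian_local_minimizer_def second_variation_def by (intro allI impI Bochner_Integration.integral_nonneg)
qed

end
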